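(* Let $$\langle f,g \rangle= \int_{-1}^{1} f(x) g(x) \,d\mu(x) +\sum_{j=1}^{N} \eta_{j,d_j} \,f^{(d_j)}(c_{j})\, g^{(d_j)}(c_{j})$$ be a sequentially-ordered discrete Sobolev inner product with $\mu\in\mathbf{M}(0,1)$, let $k\ge 1$ be an integer, and let $K$ be a (nonempty) compact subset of $\Omega_\infty^*=\overline{\mathbb{C}}\setminus\big([-1,1]\cup\{c_1,\dots,c_N\}\big)$. With $R^{[k]}_n=S^{[k]}_n/S_{n+k}$ and $\widehat{\mu}_{k}(z)= \int_{-1}^{1} \frac{Q_{k-1}(x)}{z-x}\, d\mu_{\rho}(x)$, $$\limsup_{n\to\infty} \left\|\widehat{\mu}_{k} - R^{[k]}_n\right\|_K^{1/(2n)}\leq \|\varphi^{-1}\|_K<1 .$$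
   Context: $\|f\|_K=\sup_{z\in K}|f(z)|$. $\varphi(z)=z+\sqrt{z^2-1}$ (branch with $\sqrt{z^2-1}>0$ for $z>1$) is the conformal map of the complement of $[-1,1]$ onto the exterior of the unit circle, and $\varphi^{-1}=1/\varphi$ (with value $0$ at $\infty$). $\mu$ is a finite positive Borel measure on $[-1,1]$ whose support contains infinitely many points; $N\ge 0$ is an integer, $\eta_{j,d_j}>0$, $c_j\in\mathbb{R}\setminus[-1,1]$, and $d_j\in\mathbb{Z}_+=\{0,1,2,\dots\}$ for $j=1,\dots,N$. $\overline{\mathbb C}$ is the extended complex plane (rational functions and $\widehat\mu_k$ are extended to $\infty$ by their limits). Sequentially-ordered: the inner product is called sequentially-ordered if the pairs $(c_j,d_j)$, $1\le j\le N$, can be arranged into a finite sequence $(r_1,\nu_1),\dots,(r_N,\nu_N)$ such that (1) $0\le \nu_1\le\cdots\le\nu_N$, and (2) for each $k=1,\dots,N$, $r_k$ does not belong to the convex hull of $(-1,1)\cup\{r_1,\dots,r_{k-1}\}$. Nevai class: $\mu\in\mathbf{M}(0,1)$ means that $\operatorname{supp}\mu=[-1,1]$ and the monic orthogonal polynomials $P_n$ of $\mu$, which satisfy $P_{n+1}(z)=(z-b_n)P_n(z)-a_n^2P_{n-1}(z)$ with $P_{-1}=0$, $P_0=1$, $b_n\in\mathbb{R}$, $a_n>0$ for $n\ge1$, have $\lim_{n\to\infty} a_n=1/2$ and $\lim_{n\to\infty} b_n=0$. $S_n$ is the (unique) monic polynomial of degree $n$ with $\langle x^k,S_n\rangle=0$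 for $k=0,\dots,n-1$. Put $\rho(z)=\prod_{c_j<-1}(z-c_j)^{d_j+1}\prod_{c_j>1}(c_j-z)^{d_j+1}$ and $d\mu_\rho(x)=\rho(x)\,d\mu(x)$; $\{Q_n\}_{n\ge0}$ are the monic orthogonal polynomials with respect to $\mu_\rho$. For integers $k\ge 1$, $n\ge 0$, $$S^{[k]}_{n}(z) = \int_{-1}^{1} \frac{S_{n+k}(z)-S_{n+k}(x)}{z-x}\, Q_{k-1}(x) \,d\mu_{\rho}(x).$$ *)

theory Defs
  imports "HOL-Analysis.Analysis"
begin

section \<open>Measures, inner products and monic orthogonal polynomials\<close>

definition measure_supp :: "real measure \<Rightarrow> real set" where
  "measure_supp M = {x. \<forall>U. open U \<longrightarrow> x \<in> U \<longrightarrow> emeasure M U > 0}"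

text \<open>
  A Borel measure on $[-1,1]$ is represented by a Borel measure on the real line
  that does not charge the complement of $[-1,1]$.
\<close>

definition finite_borel_on_interval :: "real measure \<Rightarrow> bool" where
  "finite_borel_on_interval M \<longleftrightarrow>
     sets M = sets borel \<and> finite_measure M \<and> emeasure M (- {-1..1}) = 0"

definition l2_inner :: "real measure \<Rightarrow> (real \<Rightarrow> real) \<Rightarrow> (real \<Rightarrow> real) \<Rightarrow> real" where
  "l2_inner M f g = (LINT x:{-1..1}|M. f x * g x)"

definition sobolev_inner ::
  "real measure \<Rightarrow> nat \<Rightarrow> (nat \<Rightarrow> real) \<Rightarrow> (nat \<Rightarrow> nat) \<Rightarrow> (nat \<Rightarrow> real) \<Rightarrow>
     (real \<Rightarrow> real) \<Rightarrow> (real \<Rightarrow> real) \<Rightarrow> real" where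
  "sobolev_inner M N c d eta f g =
     (LINT x:{-1..1}|M. f x * g x) +
     (\<Sum>j = 1..N. eta j * (deriv ^^ d j) f (c j) * (deriv ^^ d j) g (c j))"

definition monic_op :: "((real \<Rightarrow> real) \<Rightarrow> (real \<Rightarrow> real) \<Rightarrow> real) \<Rightarrow> nat \<Rightarrow> real poly" where
  "monic_op B n = (THE p. degree p = n \<and> lead_coeff p = 1 \<and>
                     (\<forall>k<n. B (\<lambda>x. x ^ k) (poly p) = 0))"

definition sequentially_ordered :: "nat \<Rightarrow> (nat \<Rightarrow> real) \<Rightarrow> (nat \<Rightarrow> nat) \<Rightarrow> bool" where
  "sequentially_ordered N c d \<longleftrightarrow>
     (\<exists>\<sigma>. bij_betw \<sigma> {1..N} {1..N} \<and>
          (\<forall>i\<in>{1..N}. \<forall>j\<in>{1..N}. i \<le> j \<longrightarrow> d (\<sigma> i) \<le> d (\<sigma> j)) \<and>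
          (\<forall>k\<in>{1..N}. c (\<sigma> k) \<notin> convex hull ({-1<..<1} \<union> (\<lambda>i. c (\<sigma> i)) ` {1..<k})))"

definition nevai_class :: "real measure \<Rightarrow> bool" where
  "nevai_class M \<longleftrightarrow>
     measure_supp M = {-1..1} \<and>
     (\<exists>a b :: nat \<Rightarrow> real.
        (\<forall>n\<ge>1. a n > 0) \<and>
        (\<forall>n. monic_op (l2_inner M) (Suc n) =
               [:- b n, 1:] * monic_op (l2_inner M) n -
               smult ((a n)\<^sup>2) (if n = 0 then 0 else monic_op (l2_inner M) (n - 1))) \<and>
        a \<longlonglongrightarrow> 1 / 2 \<and> b \<longlonglongrightarrow> 0)"

section \<open>The modified measure, associated polynomials and rational approximants\<close>

definition rho :: "nat \<Rightarrow> (nat \<Rightarrow> real) \<Rightarrow> (nat \<Rightarrow> nat) \<Rightarrow> real \<Rightarrow> real" where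
  "rho N c d x =
     (\<Prod>j\<in>{j\<in>{1..N}. c j < -1}. (x - c j) ^ (d j + 1)) *
     (\<Prod>j\<in>{j\<in>{1..N}. c j > 1}. (c j - x) ^ (d j + 1))"

text \<open>
  \<^const>\<open>ennreal\<close> truncates negative numbers to zero; this is harmless because the weight
  is positive on $[-1,1]$, the only set charged by the measure.
\<close>

definition mu_rho :: "real measure \<Rightarrow> nat \<Rightarrow> (nat \<Rightarrow> real) \<Rightarrow> (nat \<Rightarrow> nat) \<Rightarrow> real measure" where
  "mu_rho M N c d = density M (\<lambda>x. ennreal (rho N c d x))"

definition Q_poly :: "real measure \<Rightarrow> nat \<Rightarrow> (nat \<Rightarrow> real) \<Rightarrow> (nat \<Rightarrow> nat) \<Rightarrow> nat \<Rightarrow> real poly" where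
  "Q_poly M N c d n = monic_op (l2_inner (mu_rho M N c d)) n"

definition S_poly ::
  "real measure \<Rightarrow> nat \<Rightarrow> (nat \<Rightarrow> real) \<Rightarrow> (nat \<Rightarrow> nat) \<Rightarrow> (nat \<Rightarrow> real) \<Rightarrow> nat \<Rightarrow> real poly" where
  "S_poly M N c d eta n = monic_op (sobolev_inner M N c d eta) n"

definition cpoly :: "real poly \<Rightarrow> complex \<Rightarrow> complex" where
  "cpoly p z = poly (map_poly complex_of_real p) z"

text \<open>
  On the diagonal the difference quotient takes its limiting value, so that it is a
  polynomial in both variables.
\<close>

definition diff_quot :: "real poly \<Rightarrow> complex \<Rightarrow> complex \<Rightarrow> complex" where
  "diff_quot p z w = (if z = w then cpoly (pderiv p) z else (cpoly p z - cpoly p w) / (z - w))"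

definition S_assoc ::
  "real measure \<Rightarrow> nat \<Rightarrow> (nat \<Rightarrow> real) \<Rightarrow> (nat \<Rightarrow> nat) \<Rightarrow> (nat \<Rightarrow> real) \<Rightarrow>
     nat \<Rightarrow> nat \<Rightarrow> complex \<Rightarrow> complex" where
  "S_assoc M N c d eta k n z =
     (LINT x:{-1..1}|mu_rho M N c d.
        diff_quot (S_poly M N c d eta (n + k)) z (of_real x) *
        of_real (poly (Q_poly M N c d (k - 1)) x))"

definition R_approx ::
  "real measure \<Rightarrow> nat \<Rightarrow> (nat \<Rightarrow> real) \<Rightarrow> (nat \<Rightarrow> nat) \<Rightarrow> (nat \<Rightarrow> real) \<Rightarrow>
     nat \<Rightarrow> nat \<Rightarrow> complex \<Rightarrow> complex" where
  "R_approx M N c d eta k n z =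
     S_assoc M N c d eta k n z / cpoly (S_poly M N c d eta (n + k)) z"

definition mu_hat ::
  "real measure \<Rightarrow> nat \<Rightarrow> (nat \<Rightarrow> real) \<Rightarrow> (nat \<Rightarrow> nat) \<Rightarrow> nat \<Rightarrow> complex \<Rightarrow> complex" where
  "mu_hat M N c d k z =
     (LINT x:{-1..1}|mu_rho M N c d.
        of_real (poly (Q_poly M N c d (k - 1)) x) / (z - of_real x))"

section \<open>Functions on the extended complex plane\<close>

text \<open>
  The extended complex plane is \<^typ>\<open>complex option\<close> with the topology of the one-point
  compactification; \<^const>\<open>None\<close> is the point at infinity.
\<close>

definition riemann_sphere :: "complex option topology" where
  "riemann_sphere = Alexandroff_compactification euclidean"

definition Omega_star :: "nat \<Rightarrow> (nat \<Rightarrow> real) \<Rightarrow> complex option set" where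
  "Omega_star N c = UNIV - Some ` complex_of_real ` ({-1..1} \<union> c ` {1..N})"

text \<open>
  The functions below are meromorphic near each point where they are evaluated, infinity
  included, so the limit exists in $[0,\infty]$. Hence removable singularities are
  filled in, the value at infinity is the limit, and a pole yields the value infinity rather
  than the result of a division by zero.
\<close>

definition ext_modulus :: "(complex \<Rightarrow> complex) \<Rightarrow> complex option \<Rightarrow> ennreal" where
  "ext_modulus f p =
     Lim (case p of None \<Rightarrow> at_infinity | Some z \<Rightarrow> at z) (\<lambda>w. ennreal (cmod (f w)))"

definition sup_norm :: "complex option set \<Rightarrow> (complex \<Rightarrow> complex) \<Rightarrow> ennreal" where
  "sup_norm K f = (SUP p\<in>K. ext_modulus f p)"

definition ennreal_powr :: "ennreal \<Rightarrow> real \<Rightarrow> ennreal" where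
  "ennreal_powr x a = (if x = \<infinity> then \<infinity> else ennreal (enn2real x powr a))"

text \<open>
  The product of the principal square roots of $z-1$ and $z+1$ is the branch of
  $\sqrt{z^2-1}$ that is holomorphic off $[-1,1]$ and positive for $z>1$
  (\<^term>\<open>csqrt (z\<^sup>2 - 1)\<close> itself jumps across the imaginary axis).
\<close>

definition phi :: "complex \<Rightarrow> complex" where
  "phi z = z + csqrt (z - 1) * csqrt (z + 1)"

end

theory Submission
  imports Defs "HOL-Complex_Analysis.Conformal_Mappings"
begin

text \<open>
  Write \<open>m = n + k\<close>, let \<open>P\<^sub>m\<close> be the monic orthogonal polynomials of \<open>\<mu>\<close>, let \<open>D\<close> be the degree of
  \<open>\<rho>\<close>, and let \<open>\<parallel>\<cdot>\<parallel>\<close> be the norm of \<open>L\<^sup>2(\<mu>)\<close>. Since \<open>\<rho> p\<close> annihilates the discrete part of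
  the inner product, \<open>S\<^sub>m\<close> is orthogonal to all polynomials of degree below \<open>m - D\<close> with respect to
  \<open>\<mu>\<^sub>\<rho>\<close>. Hence the error is a function of the second kind divided by \<open>S\<^sub>m\<close>, and for suitable
  \<open>l = m - O(1)\<close>
  \[ \widehat\mu_k(z) - R_n(z) = \frac{1}{S_m(z) P_l(z)}
       \int \frac{S_m(x) P_l(x) Q_{k-1}(x)}{z - x} \, d\mu_\rho(x), \]
  so that its modulus is at most a constant times \<open>\<parallel>S\<^sub>m\<parallel> \<parallel>P\<^sub>l\<parallel> / (\<bar>S\<^sub>m(z)\<bar> \<bar>P\<^sub>l(z)\<bar>)\<close>. It remains to see
  that each of the two quotients decays like \<open>\<bar>\<phi>(z)\<bar>\<^sup>-\<^sup>m\<close> up to a factor \<open>s\<^sup>-\<^sup>m\<close> with \<open>s < 1\<close>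
  arbitrarily close to \<open>1\<close> (lemma \<open>error_bound\<close>).

  For \<open>P\<^sub>l\<close> this is elementary. Gauss quadrature gives \<open>\<parallel>P\<^sub>l\<parallel> \<le> C \<bar>P\<^sub>l(z)\<bar>\<close> off the interval
  (\<open>P_norm_le_value\<close>), and the maximum principle in the variable \<open>\<zeta> = 1 / \<phi>(z)\<close> improves this to the
  desired geometric rate (\<open>P_joukowski_lower_bound\<close>).

  The polynomial \<open>S\<^sub>m\<close> is compared with \<open>P\<^sub>m\<close>. Its norm is at most a constant times \<open>\<parallel>P\<^sub>m\<parallel>\<close>, by
  extremality and because \<open>\<parallel>P\<^sub>n\<^sub>+\<^sub>1\<parallel> / \<parallel>P\<^sub>n\<parallel> = a\<^sub>n\<^sub>+\<^sub>1\<close> tends to \<open>1/2\<close> (\<open>S_norm_le\<close>). The ordering of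
  the mass points and a Rolle argument show that \<open>S\<^sub>m\<close> has at least \<open>m - N\<close> sign changes in the
  interval (\<open>S_sign_changes\<close>); thus \<open>S\<^sub>m = q w\<close>, where \<open>q\<close> has its zeros there and \<open>w\<close> has
  degree at most \<open>N\<close>. Quasi-orthogonality and Gauss quadrature force the zeros of \<open>q\<close> to interlace
  with those of \<open>P\<^sub>m\<close> up to a bounded number of defects, so \<open>\<bar>q(z)\<bar>\<close> is at least a constant times
  \<open>\<bar>P\<^sub>m(z)\<bar> / (1 + \<bar>z\<bar>)\<^sup>N\<close> (\<open>P_le_root_poly_factor\<close>). Finally \<open>w\<close> converges to
  \<open>\<Prod>\<^sub>j (z - c\<^sub>j)\<close>: testing orthogonality with a polynomial that sees only the mass at \<open>c\<^sub>j\<close> shows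
  that the \<open>d\<^sub>j\<close>-th derivative of \<open>S\<^sub>m\<close> at \<open>c\<^sub>j\<close> is exponentially small relative to \<open>q(c\<^sub>j)\<close>, and in
  Leibniz' formula the term \<open>q\<^bsup>(d\<^sub>j)\<^esup>(c\<^sub>j) w(c\<^sub>j)\<close> dominates, whence \<open>w(c\<^sub>j) \<rightarrow> 0\<close>
  (\<open>cofactor_small_at_mass_point\<close>, \<open>cofactor_lower_bound\<close>).
\<close>

section \<open>Polynomials with prescribed zeros and derivative conditions\<close>

definition root_poly :: "real set \<Rightarrow> real poly" where
  "root_poly A = (\<Prod>t\<in>A. [:- t, 1:])"

lemma poly_root_poly: "poly (root_poly A) x = (\<Prod>t\<in>A. x - t)"
  by (simp add: root_poly_def poly_prod)

lemma poly_root_poly_eq_0_iff: "finite A \<Longrightarrow> poly (root_poly A) x = 0 \<longleftrightarrow> x \<in> A"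
  by (auto simp: poly_root_poly)

lemma root_poly_nonzero [simp]: "root_poly A \<noteq> 0"
  by (cases "finite A") (auto simp: root_poly_def)

lemma root_poly_empty [simp]: "root_poly {} = 1"
  by (simp add: root_poly_def)

lemma root_poly_insert: "finite A \<Longrightarrow> t \<notin> A \<Longrightarrow> root_poly (insert t A) = [:- t, 1:] * root_poly A"
  by (simp add: root_poly_def)

lemma root_poly_remove: "finite A \<Longrightarrow> t \<in> A \<Longrightarrow> root_poly A = [:- t, 1:] * root_poly (A - {t})"
  by (simp add: root_poly_def prod.remove[of A t])

lemma root_poly_union_disjoint:
  "finite A \<Longrightarrow> finite B \<Longrightarrow> A \<inter> B = {} \<Longrightarrow> root_poly (A \<union> B) = root_poly A * root_poly B"
  by (simp add: root_poly_def prod.union_disjoint)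

lemma degree_root_poly: "degree (root_poly A) = card A"
proof (induction A rule: infinite_finite_induct)
  case (insert x F)
  then show ?case
    by (simp add: root_poly_insert degree_mult_eq del: mult_pCons_left)
qed (auto simp: root_poly_def)

lemma lead_coeff_root_poly: "lead_coeff (root_poly A) = 1"
proof (induction A rule: infinite_finite_induct)
  case (insert x F)
  then show ?case
    by (simp add: root_poly_insert lead_coeff_mult del: mult_pCons_left)
qed (auto simp: root_poly_def)

lemma higher_pderiv_linear_mult:
  fixes p :: "'a :: {idom, semiring_char_0} poly"
  shows "(pderiv ^^ k) ([:- t, 1:] * p) =
           [:- t, 1:] * (pderiv ^^ k) p + smult (of_nat k) ((pderiv ^^ (k - 1)) p)"
proof (induction k)
  case (Suc k)
  have l: "pderiv [:- t, 1:] = 1"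
    by (simp add: pderiv_pCons)
  have *: "smult (of_nat k) (pderiv ((pderiv ^^ (k - 1)) p)) = smult (of_nat k) ((pderiv ^^ k) p)"
    by (cases k) auto
  have "(pderiv ^^ Suc k) ([:- t, 1:] * p) =
        pderiv ([:- t, 1:] * (pderiv ^^ k) p + smult (of_nat k) ((pderiv ^^ (k - 1)) p))"
    using Suc by simp
  also have "\<dots> = [:- t, 1:] * (pderiv ^^ Suc k) p + (pderiv ^^ k) p
                 + smult (of_nat k) ((pderiv ^^ k) p)"
    unfolding pderiv_add pderiv_mult pderiv_smult l * by simp
  finally show ?case
    by (simp add: smult_add_left algebra_simps)
qed auto

lemma higher_pderiv_power_linear_mult:
  fixes g :: "real poly"
  shows "poly ((pderiv ^^ k) ([:- c, 1:] ^ (k + j) * g)) c = (if j = 0 then fact k * poly g c else 0)"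
proof (induction k)
  case (Suc k)
  have "poly ((pderiv ^^ Suc k) ([:- c, 1:] ^ (Suc k + j) * g)) c =
        poly ((pderiv ^^ Suc k) ([:- c, 1:] * ([:- c, 1:] ^ (k + j) * g))) c"
    by (simp only: power_Suc add_Suc mult.assoc)
  also have "\<dots> = of_nat (Suc k) * poly ((pderiv ^^ k) ([:- c, 1:] ^ (k + j) * g)) c"
    unfolding higher_pderiv_linear_mult by simp
  finally show ?case using Suc by (simp add: algebra_simps)
qed (auto simp: poly_power)

lemma poly_higher_pderiv_eq_0:
  fixes f :: "real poly"
  assumes "[:- c, 1:] ^ Suc k dvd f"
  shows "poly ((pderiv ^^ k) f) c = 0"
proof -
  from assms obtain g where "f = [:- c, 1:] ^ (k + 1) * g"
    by (metis Suc_eq_plus1 dvdE)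
  then show ?thesis using higher_pderiv_power_linear_mult[of k c 1 g] by simp
qed

lemma higher_pderiv_mult:
  fixes p q :: "real poly"
  shows "(pderiv ^^ n) (p * q) =
    (\<Sum>i\<le>n. smult (of_nat (n choose i)) ((pderiv ^^ (n - i)) p * (pderiv ^^ i) q))"
proof (induction n)
  case (Suc n)
  let ?a = "\<lambda>i j. (pderiv ^^ i) p * (pderiv ^^ j) q"
  have pderiv_sum: "pderiv (sum f A) = (\<Sum>i\<in>A. pderiv (f i))" for f :: "nat \<Rightarrow> real poly" and A
    using higher_pderiv_sum[of 1 f A] by simp
  have "(pderiv ^^ Suc n) (p * q) =
        (\<Sum>i\<le>n. smult (of_nat (n choose i)) (?a (Suc n - i) i))
      + (\<Sum>i\<le>n. smult (of_nat (n choose i)) (?a (n - i) (Suc i)))"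
    using Suc by (simp add: pderiv_sum pderiv_smult pderiv_mult smult_add_right sum.distrib
        Suc_diff_le algebra_simps)
  also have "(\<Sum>i\<le>n. smult (of_nat (n choose i)) (?a (Suc n - i) i)) =
             (\<Sum>i\<le>Suc n. smult (of_nat (n choose i)) (?a (Suc n - i) i))"
    by simp
  also have "\<dots> = ?a (Suc n) 0 + (\<Sum>i\<le>n. smult (of_nat (n choose Suc i)) (?a (n - i) (Suc i)))"
    by (subst sum.atMost_Suc_shift) simp
  also have "?a (Suc n) 0 + (\<Sum>i\<le>n. smult (of_nat (n choose Suc i)) (?a (n - i) (Suc i)))
      + (\<Sum>i\<le>n. smult (of_nat (n choose i)) (?a (n - i) (Suc i))) =
      ?a (Suc n) 0 + (\<Sum>i\<le>n. smult (of_nat (Suc n choose Suc i)) (?a (n - i) (Suc i)))"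
    by (simp add: sum.distrib smult_add_left add.assoc add.commute)
  also have "\<dots> = (\<Sum>i\<le>Suc n. smult (of_nat (Suc n choose i)) (?a (Suc n - i) i))"
    by (subst sum.atMost_Suc_shift) simp
  finally show ?case .
qed simp

text \<open>
  Elimination of one functional at a time: the first member of the family on which the last
  functional does not vanish serves as pivot and is subtracted from the later ones. The pivot has
  smaller degree than those, so degrees stay distinct.
\<close>

lemma exists_annihilated_poly:
  fixes L :: "nat \<Rightarrow> real poly \<Rightarrow> real" and g :: "nat \<Rightarrow> real poly"
  assumes "\<And>j p q. L j (p + q) = L j p + L j q" "\<And>j a p. L j (smult a p) = a * L j p"
    and "\<And>p q. p \<in> V \<Longrightarrow> q \<in> V \<Longrightarrow> p + q \<in> V" "\<And>a p. p \<in> V \<Longrightarrow> smult a p \<in> V"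
    and "\<And>k. k \<le> n \<Longrightarrow> g k \<in> V" "\<And>k. k \<le> n \<Longrightarrow> g k \<noteq> 0"
    and "\<And>i j. i < j \<Longrightarrow> j \<le> n \<Longrightarrow> degree (g i) < degree (g j)"
  shows "\<exists>p\<in>V. p \<noteq> 0 \<and> degree p \<le> degree (g n) \<and> (\<forall>j<n. L j p = 0)"
  using assms(3-)
proof (induction n arbitrary: V g)
  case 0
  then show ?case by blast
next
  case (Suc n)
  define W where "W = {p \<in> V. L n p = 0}"
  have W: "p + q \<in> W" "smult a p \<in> W" if "p \<in> W" "q \<in> W" for a p q
    using that Suc.prems(1,2) assms(1,2) by (auto simp: W_def)
  have IH: "\<exists>p\<in>W. p \<noteq> 0 \<and> degree p \<le> degree (h n) \<and> (\<forall>j<n. L j p = 0)"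
    if "\<And>k. k \<le> n \<Longrightarrow> h k \<in> W" "\<And>k. k \<le> n \<Longrightarrow> h k \<noteq> 0"
      "\<And>i j. i < j \<Longrightarrow> j \<le> n \<Longrightarrow> degree (h i) < degree (h j)" for h
    by (rule Suc.IH) (use W that in auto)
  have fin: ?case if "\<exists>p\<in>W. p \<noteq> 0 \<and> degree p \<le> degree (g (Suc n)) \<and> (\<forall>j<n. L j p = 0)"
    using that by (auto simp: W_def less_Suc_eq)
  show ?case
  proof (cases "\<forall>k\<le>n. L n (g k) = 0")
    case True
    have "\<exists>p\<in>W. p \<noteq> 0 \<and> degree p \<le> degree (g n) \<and> (\<forall>j<n. L j p = 0)"
      by (rule IH) (use Suc.prems True in \<open>auto simp: W_def\<close>)
    then obtain p where "p \<in> W" "p \<noteq> 0" "degree p \<le> degree (g n)" "\<forall>j<n. L j p = 0"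
      by blast
    moreover have "degree (g n) < degree (g (Suc n))" using Suc.prems(5) by auto
    ultimately show ?thesis by (intro fin bexI[of _ p]) auto
  next
    case False
    define k0 where "k0 = (LEAST k. L n (g k) \<noteq> 0)"
    obtain k where k: "k \<le> n" "L n (g k) \<noteq> 0" using False by blast
    have k0: "L n (g k0) \<noteq> 0"
      unfolding k0_def by (rule LeastI, rule k(2))
    have k0n: "k0 \<le> n"
      unfolding k0_def by (rule order.trans[OF Least_le k(1)], rule k(2))
    have small: "L n (g k) = 0" if "k < k0" for k
      using that not_less_Least unfolding k0_def by blast
    define e where "e k = smult (- L n (g k) / L n (g k0)) (g k0)" for k
    define h where "h k = (if k < k0 then g k else g (Suc k) + e (Suc k))" for k
    have dege: "degree (e k) \<le> degree (g k0)" for k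
      unfolding e_def by (rule degree_smult_le)
    have deg: "degree (g k + e k) = degree (g k)" if "k0 < k" "k \<le> Suc n" for k
      using that Suc.prems(5)[of k0 k] dege[of k] by (intro degree_add_eq_left) simp
    have nz: "g k + e k \<noteq> 0" if "k0 < k" "k \<le> Suc n" for k
      using deg[OF that] Suc.prems(5)[of k0 k] that by fastforce
    have kill: "g k + e k \<in> W" if "k \<le> Suc n" for k
    proof -
      have "g k + e k \<in> V"
        unfolding e_def using that k0n by (intro Suc.prems(1,2,3)) auto
      moreover have "L n (g k + e k) = 0"
        unfolding e_def assms(1,2) using k0 by simp
      ultimately show ?thesis by (simp add: W_def)
    qed
    have "\<exists>p\<in>W. p \<noteq> 0 \<and> degree p \<le> degree (h n) \<and> (\<forall>j<n. L j p = 0)"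
    proof (rule IH)
      fix k assume k: "k \<le> n"
      show "h k \<in> W"
        using k k0n small Suc.prems(3) kill by (auto simp: W_def h_def)
      show "h k \<noteq> 0"
        using k nz[of "Suc k"] Suc.prems(4) by (auto simp: h_def)
    next
      fix i j assume "i < j" "j \<le> n"
      then show "degree (h i) < degree (h j)"
        using deg[of "Suc i"] deg[of "Suc j"] Suc.prems(5) by (auto simp: h_def)
    qed
    moreover have "degree (h n) = degree (g (Suc n))"
      using k0n deg[of "Suc n"] by (auto simp: h_def)
    ultimately show ?thesis by (intro fin) auto
  qed
qed

text \<open>
  Splitting off linear factors one by one while cancelling those that occur twice leaves one
  factor for every sign change.
\<close>

lemma sign_change_factorization:
  fixes p :: "real poly"
  assumes "p \<noteq> 0"
  obtains Z w where "finite Z" "Z \<subseteq> {-1<..<1}" "p = root_poly Z * w"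
    "(\<forall>x\<in>{-1..1}. poly w x \<ge> 0) \<or> (\<forall>x\<in>{-1..1}. poly w x \<le> 0)"
proof -
  have "\<exists>Z w. finite Z \<and> Z \<subseteq> {-1<..<1} \<and> p = root_poly Z * w \<and>
          ((\<forall>x\<in>{-1..1}. poly w x \<ge> 0) \<or> (\<forall>x\<in>{-1..1}. poly w x \<le> 0))"
    using assms
  proof (induction "degree p" arbitrary: p rule: less_induct)
    case (less p)
    show ?case
    proof (cases "\<exists>t\<in>{-1<..<1}. poly p t = 0")
      case False
      have "(\<forall>x\<in>{-1..1}. poly p x \<ge> 0) \<or> (\<forall>x\<in>{-1..1}. poly p x \<le> 0)"
      proof (rule ccontr)
        assume "\<not> ?thesis"
        then obtain x y where xy: "x \<in> {-1..1}" "y \<in> {-1..1}" "poly p x < 0" "poly p y > 0"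
          by (auto simp: not_le)
        then have "x \<noteq> y" by force
        then have "x < y \<or> y < x" by linarith
        then have "\<exists>t\<in>{-1<..<1}. poly p t = 0"
          using xy poly_IVT_pos[of x y p] poly_IVT_neg[of y x p] by fastforce
        then show False using False by blast
      qed
      then show ?thesis
        by (intro exI[of _ "{}"] exI[of _ p]) auto
    next
      case True
      then obtain t where t: "t \<in> {-1<..<1}" "poly p t = 0" by blast
      then obtain p' where p': "p = [:- t, 1:] * p'"
        by (metis poly_eq_0_iff_dvd dvdE)
      with less.prems have "p' \<noteq> 0" by auto
      moreover from this have "degree p' < degree p"
        by (simp add: p' degree_mult_eq del: mult_pCons_left)
      ultimately obtain Z w where Z: "finite Z" "Z \<subseteq> {-1<..<1}" "p' = root_poly Z * w"
          "(\<forall>x\<in>{-1..1}. poly w x \<ge> 0) \<or> (\<forall>x\<in>{-1..1}. poly w x \<le> 0)"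
        using less.hyps by meson
      show ?thesis
      proof (cases "t \<in> Z")
        case False
        then show ?thesis
          using Z t p' by (intro exI[of _ "insert t Z"] exI[of _ w])
            (auto simp: root_poly_insert simp del: mult_pCons_left)
      next
        case True
        have "p = root_poly (Z - {t}) * ([:- t, 1:]\<^sup>2 * w)"
          unfolding p' Z(3) root_poly_remove[OF Z(1) True] power2_eq_square
          by (simp only: mult.assoc mult.left_commute mult.commute)
        moreover have "poly ([:- t, 1:]\<^sup>2 * w) x = (x - t)\<^sup>2 * poly w x" for x
          by (simp add: poly_power)
        ultimately show ?thesis
          using Z by (intro exI[of _ "Z - {t}"] exI[of _ "[:- t, 1:]\<^sup>2 * w"])
            (auto simp: zero_le_mult_iff mult_le_0_iff)
      qed
    qed
  qed
  then show ?thesis using that by blast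
qed

section \<open>Rolle's theorem with multiplicities\<close>

definition zero_count :: "real poly \<Rightarrow> real set \<Rightarrow> nat" where
  "zero_count p J = (\<Sum>a | a \<in> J \<and> poly p a = 0. order a p)"

lemma zero_count_alt: "finite A \<Longrightarrow> {a \<in> J. poly p a = 0} \<subseteq> A \<Longrightarrow> A \<subseteq> J \<Longrightarrow> p \<noteq> 0 \<Longrightarrow>
    zero_count p J = (\<Sum>a\<in>A. order a p)"
  unfolding zero_count_def
  by (rule sum.mono_neutral_left) (auto simp: order_root)

lemma finite_roots_in: "p \<noteq> 0 \<Longrightarrow> finite {a. a \<in> J \<and> poly p a = (0::real)}"
  using poly_roots_finite[of p] by (rule rev_finite_subset) auto

lemma zero_count_mult:
  assumes "p \<noteq> 0" "q \<noteq> 0"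
  shows "zero_count (p * q) J = zero_count p J + zero_count q J"
proof -
  let ?A = "{a. a \<in> J \<and> poly (p * q) a = 0}"
  have fin: "finite ?A" using assms by (intro finite_roots_in) auto
  have "zero_count p J = (\<Sum>a\<in>?A. order a p)" "zero_count q J = (\<Sum>a\<in>?A. order a q)"
    using assms fin by (auto intro!: zero_count_alt)
  then show ?thesis
    using assms by (simp add: zero_count_def order_mult sum.distrib del: poly_mult)
qed

lemma zero_count_ge_1:
  assumes "p \<noteq> 0" "a \<in> J" "poly p a = 0"
  shows "zero_count p J \<ge> 1"
proof -
  have "order a p \<le> zero_count p J"
    unfolding zero_count_def using assms finite_roots_in[OF assms(1)]
    by (intro member_le_sum) auto
  moreover have "order a p \<noteq> 0" using assms by (simp add: order_root)
  ultimately show ?thesis by linarith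
qed

lemma zero_count_root_poly:
  assumes "finite A" "A \<subseteq> J"
  shows "zero_count (root_poly A) J \<ge> card A"
  using assms
proof (induction A)
  case (insert t A)
  have "zero_count [:- t, 1:] J \<ge> 1"
    using insert by (intro zero_count_ge_1[of _ t]) auto
  then show ?case
    using insert by (simp add: root_poly_insert zero_count_mult del: mult_pCons_left)
qed (simp add: zero_count_def)

lemma zero_count_le_degree:
  assumes "p \<noteq> 0"
  shows "zero_count p J \<le> degree p"
proof -
  have "(\<Sum>a\<in>{a. a \<in> J \<and> poly p a = 0}. order a p) \<le> (\<Sum>a\<in>{a. poly p a = 0}. order a p)"
    using poly_roots_finite[OF assms] by (intro sum_mono2) auto
  also have "\<dots> = size (proots p)"
    using assms by (simp add: size_multiset_overloaded_eq)
  also have "\<dots> \<le> degree p" by (rule size_proots_le)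
  finally show ?thesis by (simp add: zero_count_def)
qed

text \<open>
  A zero of multiplicity \<open>r\<close> survives with multiplicity \<open>r - 1\<close>, and between two neighbouring
  zeros the derivative gains one.
\<close>

lemma zero_count_pderiv:
  assumes J: "convex J" and p': "pderiv p \<noteq> 0"
  shows "zero_count p J \<le> zero_count (pderiv p) J + 1"
proof -
  from p' have p: "p \<noteq> 0" by auto
  define A where "A = {a. a \<in> J \<and> poly p a = 0}"
  have fin: "finite A" unfolding A_def by (rule finite_roots_in[OF p])
  define nxt where "nxt a = Min {b \<in> A. a < b}" for a
  define A' where "A' = A - {Max A}"
  have nxt: "nxt a \<in> A" "a < nxt a" if "a \<in> A'" for a
  proof -
    have "Max A \<in> {b \<in> A. a < b}"
      using that fin by (auto simp: A'_def intro!: Max_in le_neq_trans)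
    then have "nxt a \<in> {b \<in> A. a < b}"
      unfolding nxt_def using fin by (intro Min_in) auto
    then show "nxt a \<in> A" "a < nxt a" by auto
  qed
  have nxt_le: "nxt a \<le> b" if "b \<in> A" "a < b" for a b
    unfolding nxt_def using that fin by (intro Min_le) auto
  have "\<exists>x. a < x \<and> x < nxt a \<and> poly (pderiv p) x = 0" if "a \<in> A'" for a
    using poly_MVT[of a "nxt a" p] nxt[OF that] that by (auto simp: A_def A'_def)
  then obtain r where r: "\<And>a. a \<in> A' \<Longrightarrow> a < r a \<and> r a < nxt a \<and> poly (pderiv p) (r a) = 0"
    by metis
  have inj: "inj_on r A'"
  proof (rule linorder_inj_onI)
    fix a b assume "a < b" "a \<in> A'" "b \<in> A'"
    then show "r a \<noteq> r b"
      using nxt_le[of b a] r[of a] r[of b] by (auto simp: A'_def)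
  qed auto
  have rJ: "r a \<in> J" if "a \<in> A'" for a
  proof -
    have "a \<in> J" "nxt a \<in> J" using that nxt by (auto simp: A'_def A_def)
    with r[OF that] J show ?thesis
      by (meson convex_contains_segment closed_segment_eq_real_ivl atLeastAtMost_iff
          less_imp_le subsetD order.strict_trans is_interval_convex_1 mem_is_interval_1_I)
  qed
  have rA: "r a \<notin> A" if "a \<in> A'" for a
    using nxt_le[of "r a" a] r[OF that] by force
  let ?B = "{a. a \<in> J \<and> poly (pderiv p) a = 0}"
  have "card A - 1 = card (r ` A')"
    using inj fin by (cases "A = {}") (auto simp: card_image A'_def card_Diff_singleton_if)
  also have "\<dots> = (\<Sum>x\<in>r ` A'. 1)" by simp
  also have "\<dots> \<le> (\<Sum>x\<in>r ` A'. order x (pderiv p))"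
    using r p' by (intro sum_mono) (force simp: order_root Suc_le_eq)
  finally have 1: "card A - 1 \<le> (\<Sum>x\<in>r ` A'. order x (pderiv p))" .
  have 2: "zero_count p J = (\<Sum>a\<in>A. order a (pderiv p)) + card A"
  proof -
    have "order a p = order a (pderiv p) + 1" if "a \<in> A" for a
      using that p p' by (subst order_pderiv) (auto simp: A_def order_root)
    then have "zero_count p J = (\<Sum>a\<in>A. order a (pderiv p) + 1)"
      unfolding zero_count_def A_def by (intro sum.cong) auto
    then show ?thesis by (simp add: sum_Suc)
  qed
  have finr: "finite (r ` A')" using fin by (simp add: A'_def)
  have "(\<Sum>a\<in>A. order a (pderiv p)) + (\<Sum>x\<in>r ` A'. order x (pderiv p)) =
        (\<Sum>x\<in>A \<union> r ` A'. order x (pderiv p))"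
    using fin finr rA by (intro sum.union_disjoint[symmetric]) auto
  also have "\<dots> \<le> (\<Sum>x\<in>A \<union> r ` A' \<union> ?B. order x (pderiv p))"
    using fin finr finite_roots_in[OF p'] by (intro sum_mono2) auto
  also have "\<dots> = zero_count (pderiv p) J"
    by (rule zero_count_alt[symmetric])
       (use fin finr finite_roots_in[OF p'] p' rJ in \<open>auto simp: A_def\<close>)
  finally show ?thesis using 1 2 by linarith
qed

lemma zero_count_higher_pderiv:
  assumes "convex J" "(pderiv ^^ k) p \<noteq> 0"
  shows "zero_count p J \<le> zero_count ((pderiv ^^ k) p) J + k"
  using assms(2)
proof (induction k)
  case (Suc k)
  from Suc.prems have "(pderiv ^^ k) p \<noteq> 0" by auto
  then show ?case
    using Suc zero_count_pderiv[OF assms(1), of "(pderiv ^^ k) p"] by auto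
qed simp

lemma zero_count_extend:
  assumes "p \<noteq> 0" "C \<subseteq> C'" "a \<in> C'" "a \<notin> C" "poly p a = 0"
  shows "zero_count p C + 1 \<le> zero_count p C'"
proof -
  let ?A = "{x. x \<in> C \<and> poly p x = 0}" and ?B = "{x. x \<in> C' \<and> poly p x = 0}"
  have "order a p \<noteq> 0" using assms by (simp add: order_root)
  then have "zero_count p C + 1 \<le> (\<Sum>x\<in>insert a ?A. order x p)"
    using assms finite_roots_in[OF assms(1), of C] by (simp add: zero_count_def)
  also have "\<dots> \<le> zero_count p C'"
    unfolding zero_count_def using assms finite_roots_in[OF assms(1)] by (intro sum_mono2) auto
  finally show ?thesis .
qed

text \<open>
  Each differentiation costs at most one zero in the current hull, and each condition contributes
  one: by the ordering, \<open>r k\<close> lies outside the previous hull and is therefore a new zero.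
\<close>

lemma sequential_conditions_zero_count:
  fixes r :: "nat \<Rightarrow> real" and \<nu> :: "nat \<Rightarrow> nat"
  defines "C \<equiv> \<lambda>k. convex hull ({-1<..<1} \<union> r ` {1..<k})"
  assumes new: "\<And>k. k \<in> {1..i} \<Longrightarrow> r k \<notin> C k"
    and mono: "\<And>j k. 1 \<le> j \<Longrightarrow> j \<le> k \<Longrightarrow> k \<le> i \<Longrightarrow> \<nu> j \<le> \<nu> k"
    and f: "f \<noteq> 0" and cond: "\<And>j. j \<in> {1..i} \<Longrightarrow> poly ((pderiv ^^ \<nu> j) f) (r j) = 0"
    and deg: "i \<ge> 1 \<Longrightarrow> \<nu> i \<le> degree f"
  shows "zero_count f {-1<..<1} + i \<le> degree f"
proof -
  let ?J = "{-1<..<1} :: real set"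
  have conv: "convex (C k)" for k by (simp add: C_def)
  have nz: "(pderiv ^^ e) f \<noteq> 0" if "e \<le> degree f" for e
  proof -
    have "coeff ((pderiv ^^ e) f) (degree f - e) \<noteq> 0"
      using that f by (simp add: coeff_higher_pderiv pochhammer_eq_0_iff)
    then show ?thesis by auto
  qed
  have main: "zero_count f ?J + n \<le> zero_count ((pderiv ^^ e) f) (C (Suc n)) + e"
    if "n \<le> i" "n \<ge> 1 \<Longrightarrow> \<nu> n \<le> e" "e \<le> degree f" for n e
    using that
  proof (induction n arbitrary: e)
    case 0
    have "C (Suc 0) = ?J" by (simp add: C_def hull_same)
    then show ?case using zero_count_higher_pderiv[of ?J e f] nz 0 by simp
  next
    case (Suc n)
    let ?\<nu> = "\<nu> (Suc n)" let ?g = "(pderiv ^^ \<nu> (Suc n)) f"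
    have \<nu>: "?\<nu> \<le> e" "?\<nu> \<le> degree f" using Suc.prems by auto
    have "zero_count f ?J + n \<le> zero_count ?g (C (Suc n)) + ?\<nu>"
      using Suc.prems \<nu> mono[of n "Suc n"] by (intro Suc.IH) auto
    moreover have "zero_count ?g (C (Suc n)) + 1 \<le> zero_count ?g (C (Suc (Suc n)))"
    proof (rule zero_count_extend)
      show "?g \<noteq> 0" using nz \<nu> by blast
      show "C (Suc n) \<subseteq> C (Suc (Suc n))" unfolding C_def by (intro hull_mono) auto
      show "r (Suc n) \<in> C (Suc (Suc n))" unfolding C_def by (intro hull_inc) auto
    qed (use new cond Suc.prems in auto)
    moreover have "zero_count ?g (C (Suc (Suc n))) \<le>
        zero_count ((pderiv ^^ (e - ?\<nu>)) ?g) (C (Suc (Suc n))) + (e - ?\<nu>)"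
      using nz[of e] \<nu> Suc.prems conv
      by (intro zero_count_higher_pderiv) (auto simp flip: funpow_add[THEN fun_cong, simplified])
    moreover have "(pderiv ^^ (e - ?\<nu>)) ?g = (pderiv ^^ e) f"
      using \<nu> by (simp flip: funpow_add[THEN fun_cong, simplified])
    ultimately show ?case using \<nu> by simp
  qed
  show ?thesis
  proof (cases "i = 0")
    case True
    then show ?thesis using zero_count_le_degree[OF f] by simp
  next
    case False
    then have "zero_count f ?J + i \<le> zero_count ((pderiv ^^ \<nu> i) f) (C (Suc i)) + \<nu> i"
      using deg by (intro main) auto
    also have "zero_count ((pderiv ^^ \<nu> i) f) (C (Suc i)) \<le> degree f - \<nu> i"
      using zero_count_le_degree[OF nz] deg False by (simp add: degree_higher_pderiv)
    finally show ?thesis using deg False by simp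
  qed
qed

text \<open>
  Among all nonzero multiples of the given polynomial that satisfy the derivative conditions,
  one of least degree works. Conditions of an order above that degree hold trivially; the
  remaining ones, say \<open>i\<close> in number, can already be met in degree \<open>card Z + i\<close>, while a zero of
  the cofactor in the interval would force the degree up to \<open>card Z + 1 + i\<close>.
\<close>

lemma exists_test_polynomial:
  fixes r :: "nat \<Rightarrow> real" and \<nu> :: "nat \<Rightarrow> nat"
  assumes new: "\<And>k. k \<in> {1..N} \<Longrightarrow> r k \<notin> convex hull ({-1<..<1} \<union> r ` {1..<k})"
    and mono: "\<And>j k. 1 \<le> j \<Longrightarrow> j \<le> k \<Longrightarrow> k \<le> N \<Longrightarrow> \<nu> j \<le> \<nu> k"
    and Z: "finite Z" "Z \<subseteq> {-1<..<1}"
  obtains g where "g \<noteq> 0" "degree g \<le> N" "\<And>t. t \<in> {-1<..<1} \<Longrightarrow> poly g t \<noteq> 0"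
    "\<And>j. j \<in> {1..N} \<Longrightarrow> poly ((pderiv ^^ \<nu> j) (root_poly Z * g)) (r j) = 0"
proof -
  let ?q = "root_poly Z" and ?J = "{-1<..<1} :: real set"
  define adm where "adm i f \<longleftrightarrow> f \<noteq> 0 \<and> ?q dvd f \<and> (\<forall>j\<in>{1..i}. poly ((pderiv ^^ \<nu> j) f) (r j) = 0)"
    for i f
  have ex: "\<exists>f. adm i f \<and> degree f \<le> card Z + i" for i
  proof -
    have deg: "degree (monom 1 k * ?q) = k + card Z" for k
      by (simp add: degree_mult_eq degree_root_poly degree_monom_eq)
    have "\<exists>f\<in>{f. ?q dvd f}. f \<noteq> 0 \<and> degree f \<le> degree (monom 1 i * ?q) \<and>
            (\<forall>j<i. poly ((pderiv ^^ \<nu> (Suc j)) f) (r (Suc j)) = 0)"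
      by (rule exists_annihilated_poly)
         (auto simp: higher_pderiv_add higher_pderiv_smult deg intro: dvd_smult)
    then obtain f where f: "?q dvd f" "f \<noteq> 0" "degree f \<le> card Z + i"
      "\<And>j. j < i \<Longrightarrow> poly ((pderiv ^^ \<nu> (Suc j)) f) (r (Suc j)) = 0"
      by (auto simp: deg add.commute)
    have "poly ((pderiv ^^ \<nu> j) f) (r j) = 0" if "j \<in> {1..i}" for j
      using f(4)[of "j - 1"] that by auto
    then show ?thesis using f by (auto simp: adm_def)
  qed
  obtain f0 where f0: "adm N f0" "degree f0 \<le> card Z + N" using ex by blast
  obtain f where f: "adm N f" and least: "\<And>f'. adm N f' \<Longrightarrow> degree f \<le> degree f'"
    using ex_has_least_nat[of "adm N" f0 degree] f0(1) by blast
  from f obtain g where g: "f = ?q * g" by (auto simp: adm_def dvd_def)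
  have g0: "g \<noteq> 0" using f g by (auto simp: adm_def)
  have "poly g t \<noteq> 0" if t: "t \<in> ?J" for t
  proof
    assume gt: "poly g t = 0"
    have "card Z + 1 \<le> zero_count f ?J"
      using zero_count_root_poly[OF Z] zero_count_ge_1[OF g0 t gt] g0
      by (simp add: g zero_count_mult)
    define I where "I = {i. i \<le> N \<and> (i \<ge> 1 \<longrightarrow> \<nu> i \<le> degree f)}"
    define i where "i = Max I"
    have "finite I" "0 \<in> I" by (auto simp: I_def)
    then have "i \<in> I" unfolding i_def by (intro Max_in) auto
    have "j \<le> i" if "j \<in> I" for j unfolding i_def using \<open>finite I\<close> that by (rule Max_ge)
    then have above: "degree f < \<nu> j" if "j \<in> {1..N}" "j > i" for j
      using that by (force simp: I_def)
    have "zero_count f ?J + i \<le> degree f"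
      by (rule sequential_conditions_zero_count[where r = r and \<nu> = \<nu>])
         (use new mono f \<open>i \<in> I\<close> in \<open>auto simp: I_def adm_def\<close>)
    obtain h where h: "adm i h" "degree h \<le> card Z + i" using ex by blast
    have small: "degree h < degree f"
      using h \<open>zero_count f ?J + i \<le> degree f\<close> \<open>card Z + 1 \<le> zero_count f ?J\<close> by linarith
    have "poly ((pderiv ^^ \<nu> j) h) (r j) = 0" if "j \<in> {1..N}" for j
    proof (cases "j \<le> i")
      case True
      then show ?thesis using h that by (auto simp: adm_def)
    next
      case False
      then have "degree h < \<nu> j" using above[of j] that small by linarith
      then have "(pderiv ^^ \<nu> j) h = 0"
        by (intro poly_eqI) (simp add: coeff_higher_pderiv coeff_eq_0)
      then show ?thesis by simp
    qed
    then have "adm N h" using h by (auto simp: adm_def)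
    then show False using least[of h] small by simp
  qed
  moreover have "degree g \<le> N"
    using least[OF f0(1)] f0(2) g g0 by (simp add: degree_mult_eq degree_root_poly)
  moreover have "poly ((pderiv ^^ \<nu> j) (?q * g)) (r j) = 0" if "j \<in> {1..N}" for j
    using f that by (simp add: adm_def g)
  ultimately show ?thesis using g0 that by blast
qed

section \<open>Derivatives of a real-rooted polynomial off its zeros\<close>

lemma root_poly_higher_pderiv_sign:
  fixes \<sigma> c :: real
  assumes "finite Z" "\<sigma>\<^sup>2 = 1" "\<And>t. t \<in> Z \<Longrightarrow> \<sigma> * (c - t) > 0"
  shows "\<sigma> ^ (card Z + i) * poly ((pderiv ^^ i) (root_poly Z)) c \<ge> 0"
  using assms(1,3)
proof (induction Z arbitrary: i)
  case empty
  show ?case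
  proof (cases i)
    case (Suc n)
    have "(pderiv ^^ i) (1 :: real poly) = 0"
      by (simp add: Suc funpow_Suc_right del: funpow.simps)
    then show ?thesis by simp
  qed auto
next
  case (insert t Z)
  have IH: "\<sigma> ^ (card Z + j) * poly ((pderiv ^^ j) (root_poly Z)) c \<ge> 0" for j
    using insert.IH[of j] insert.prems by simp
  have "\<sigma> ^ (card Z + i + 1) * (of_nat i * poly ((pderiv ^^ (i - 1)) (root_poly Z)) c) \<ge> 0"
  proof (cases i)
    case (Suc n)
    have eq: "\<sigma> ^ (card Z + i + 1) = \<sigma> ^ (card Z + n)"
      using assms(2) by (simp add: Suc power2_eq_square mult.assoc[symmetric])
    have "0 \<le> of_nat i * (\<sigma> ^ (card Z + n) * poly ((pderiv ^^ n) (root_poly Z)) c)"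
      by (rule mult_nonneg_nonneg[OF of_nat_0_le_iff IH])
    then show ?thesis unfolding eq by (simp add: Suc mult_ac)
  qed simp
  moreover have "(\<sigma> * (c - t)) * (\<sigma> ^ (card Z + i) * poly ((pderiv ^^ i) (root_poly Z)) c) \<ge> 0"
    by (rule mult_nonneg_nonneg[OF less_imp_le[OF insert.prems[of t]] IH]) simp
  ultimately show ?case
    using insert.hyps unfolding root_poly_insert[OF insert.hyps(1,2)] higher_pderiv_linear_mult
    by (simp add: algebra_simps)
qed

text \<open>
  Let \<open>q\<close> be the polynomial, \<open>n\<close> its degree and \<open>q\<^sub>t = q / (x - t)\<close>. Differentiating
  \<open>n q = \<Sum>\<^sub>t (x - t) q\<^sub>t\<close> repeatedly gives \<open>(n - i) q\<^bsup>(i)\<^esup> = \<Sum>\<^sub>t (x - t) q\<^sub>t\<^bsup>(i)\<^esup>\<close>, whereas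
  \<open>q\<^bsup>(i+1)\<^esup> = \<Sum>\<^sub>t q\<^sub>t\<^bsup>(i)\<^esup>\<close>. To the right (or left) of all zeros the summands share a sign.
\<close>

lemma root_poly_higher_pderiv_growth:
  assumes Z: "finite Z" "Z \<subseteq> {-1<..<1}" and c: "\<bar>c\<bar> > 1"
  shows "(real (card Z) - real i) * \<bar>poly ((pderiv ^^ i) (root_poly Z)) c\<bar>
           \<le> (\<bar>c\<bar> + 1) * \<bar>poly ((pderiv ^^ Suc i) (root_poly Z)) c\<bar>"
proof -
  define \<sigma> where "\<sigma> = sgn c"
  have \<sigma>: "\<sigma>\<^sup>2 = 1" "\<bar>\<sigma>\<bar> = 1" "\<And>t. t \<in> Z \<Longrightarrow> \<sigma> * (c - t) > 0"
    using c Z by (force simp: \<sigma>_def sgn_if)+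
  let ?q = "root_poly Z"
  let ?d = "\<lambda>i t. poly ((pderiv ^^ i) (root_poly (Z - {t}))) c"
  have p1: "pderiv ?q = (\<Sum>t\<in>Z. root_poly (Z - {t}))"
    unfolding root_poly_def pderiv_prod by (intro sum.cong) (auto simp: pderiv_pCons)
  have pS: "poly ((pderiv ^^ Suc n) ?q) c = (\<Sum>t\<in>Z. ?d n t)" for n
    by (simp add: funpow_Suc_right p1 higher_pderiv_sum poly_sum del: funpow.simps)
  have "real (card Z) * poly ((pderiv ^^ i) ?q) c =
        (\<Sum>t\<in>Z. poly ((pderiv ^^ i) ([:- t, 1:] * root_poly (Z - {t}))) c)"
  proof -
    have "(\<Sum>t\<in>Z. poly ((pderiv ^^ i) ([:- t, 1:] * root_poly (Z - {t}))) c) =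
          (\<Sum>t\<in>Z. poly ((pderiv ^^ i) ?q) c)"
      by (rule sum.cong[OF refl]) (simp only: root_poly_remove[OF Z(1), symmetric])
    then show ?thesis by simp
  qed
  also have "\<dots> = (\<Sum>t\<in>Z. (c - t) * ?d i t) + (\<Sum>t\<in>Z. real i * ?d (i - 1) t)"
    unfolding higher_pderiv_linear_mult by (simp add: sum.distrib left_diff_distrib)
  also have "(\<Sum>t\<in>Z. real i * ?d (i - 1) t) = real i * poly ((pderiv ^^ i) ?q) c"
    by (cases i) (simp_all add: pS sum_distrib_left del: funpow.simps)
  finally have eq: "(real (card Z) - real i) * poly ((pderiv ^^ i) ?q) c = (\<Sum>t\<in>Z. (c - t) * ?d i t)"
    by (simp add: left_diff_distrib)
  have abs: "\<bar>?d i t\<bar> = \<sigma> ^ (card Z - 1 + i) * ?d i t" if "t \<in> Z" for t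
  proof -
    have "0 \<le> \<sigma> ^ (card (Z - {t}) + i) * ?d i t"
      using Z \<sigma> by (intro root_poly_higher_pderiv_sign) auto
    then have "\<bar>\<sigma> ^ (card Z - 1 + i) * ?d i t\<bar> = \<sigma> ^ (card Z - 1 + i) * ?d i t"
      using that Z by (simp add: card_Diff_singleton)
    then show ?thesis using \<sigma>(2) by (simp add: abs_mult power_abs)
  qed
  have "(real (card Z) - real i) * \<bar>poly ((pderiv ^^ i) ?q) c\<bar> \<le>
        \<bar>(real (card Z) - real i) * poly ((pderiv ^^ i) ?q) c\<bar>"
    by (simp add: abs_mult mult_right_mono)
  also have "\<dots> \<le> (\<Sum>t\<in>Z. \<bar>(c - t) * ?d i t\<bar>)"
    unfolding eq by (rule sum_abs)
  also have "\<dots> \<le> (\<Sum>t\<in>Z. (\<bar>c\<bar> + 1) * \<bar>?d i t\<bar>)"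
    unfolding abs_mult using Z by (intro sum_mono mult_right_mono) force+
  also have "\<dots> = (\<bar>c\<bar> + 1) * (\<sigma> ^ (card Z - 1 + i) * poly ((pderiv ^^ Suc i) ?q) c)"
    unfolding pS by (simp add: abs sum_distrib_left)
  also have "\<dots> \<le> (\<bar>c\<bar> + 1) * \<bar>\<sigma> ^ (card Z - 1 + i) * poly ((pderiv ^^ Suc i) ?q) c\<bar>"
    by (intro mult_left_mono) auto
  also have "\<dots> = (\<bar>c\<bar> + 1) * \<bar>poly ((pderiv ^^ Suc i) ?q) c\<bar>"
    using \<sigma>(2) by (simp add: abs_mult power_abs)
  finally show ?thesis .
qed

section \<open>Evaluation of real polynomials at complex points\<close>

lemma cpoly_0 [simp]: "cpoly 0 z = 0"
  by (simp add: cpoly_def)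

lemma cpoly_pCons: "cpoly (pCons a p) z = of_real a + z * cpoly p z"
  by (simp add: cpoly_def map_poly_pCons)

lemma cpoly_1 [simp]: "cpoly 1 z = 1"
  by (simp add: cpoly_def)

lemma cpoly_add: "cpoly (p + q) z = cpoly p z + cpoly q z"
  by (induction p q rule: poly_induct2) (simp_all add: cpoly_pCons algebra_simps)

lemma cpoly_smult: "cpoly (smult a p) z = of_real a * cpoly p z"
  by (induction p) (simp_all add: cpoly_pCons algebra_simps)

lemma cpoly_mult: "cpoly (p * q) z = cpoly p z * cpoly q z"
  by (induction p) (simp_all add: cpoly_pCons cpoly_add cpoly_smult algebra_simps)

lemma cpoly_diff: "cpoly (p - q) z = cpoly p z - cpoly q z"
  using cpoly_add[of p "- q" z] cpoly_smult[of "-1" q z] by simp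

lemma cpoly_of_real: "cpoly p (of_real x) = of_real (poly p x)"
  by (induction p) (simp_all add: cpoly_pCons)

lemma cpoly_root_poly: "cpoly (root_poly A) z = (\<Prod>t\<in>A. z - of_real t)"
  by (induction A rule: infinite_finite_induct)
     (simp_all add: root_poly_insert cpoly_mult cpoly_pCons del: mult_pCons_left,
      simp_all add: root_poly_def)

lemma cmod_cpoly_root_poly: "cmod (cpoly (root_poly A) z) = (\<Prod>t\<in>A. cmod (z - of_real t))"
  by (simp add: cpoly_root_poly prod_norm)

lemma cpoly_altdef: "cpoly p z = (\<Sum>i\<le>degree p. of_real (coeff p i) * z ^ i)"
proof (cases "p = 0")
  case False
  then have "degree (map_poly complex_of_real p) = degree p"
    by (intro map_poly_degree_eq) simp
  then show ?thesis by (simp add: cpoly_def poly_altdef coeff_map_poly)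
qed simp

lemma isCont_cpoly [continuous_intros]: "isCont (cpoly p) z"
  unfolding cpoly_def[abs_def] by (rule poly_isCont)

section \<open>Coefficient norm and Lagrange interpolation\<close>

definition coeff_norm :: "nat \<Rightarrow> real poly \<Rightarrow> real" where
  "coeff_norm n p = (\<Sum>i\<le>n. \<bar>coeff p i\<bar>)"

lemma coeff_norm_nonneg: "coeff_norm n p \<ge> 0"
  by (simp add: coeff_norm_def sum_nonneg)

lemma coeff_norm_triangle: "coeff_norm n (p + q) \<le> coeff_norm n p + coeff_norm n q"
  unfolding coeff_norm_def sum.distrib[symmetric] by (intro sum_mono) simp

lemma coeff_norm_smult: "coeff_norm n (smult a p) = \<bar>a\<bar> * coeff_norm n p"
  by (simp add: coeff_norm_def abs_mult sum_distrib_left)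

lemma coeff_norm_sum: "coeff_norm n (sum f A) \<le> (\<Sum>x\<in>A. coeff_norm n (f x))"
proof (induction A rule: infinite_finite_induct)
  case (insert x F)
  then show ?case using coeff_norm_triangle[of n "f x" "sum f F"] by simp
qed (auto simp: coeff_norm_def)

lemma coeff_norm_monic:
  assumes "lead_coeff p = 1" "degree p \<le> n"
  shows "coeff_norm n p \<ge> 1"
proof -
  have "\<bar>coeff p (degree p)\<bar> \<le> coeff_norm n p"
    unfolding coeff_norm_def using assms by (intro member_le_sum) auto
  then show ?thesis using assms by simp
qed

lemma linear_functional_bound:
  fixes L :: "real poly \<Rightarrow> real"
  assumes add: "\<And>p q. L (p + q) = L p + L q" and smult: "\<And>a p. L (smult a p) = a * L p"
  obtains C where "C \<ge> 0" "\<And>p. degree p \<le> n \<Longrightarrow> \<bar>L p\<bar> \<le> C * coeff_norm n p"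
proof
  let ?C = "\<Sum>i\<le>n. \<bar>L (monom 1 i)\<bar>"
  show "?C \<ge> 0" by (simp add: sum_nonneg)
  fix p :: "real poly" assume deg: "degree p \<le> n"
  have L0: "L 0 = 0" using smult[of 0 0] by simp
  have sum: "L (sum f A) = (\<Sum>i\<in>A. L (f i))" for f :: "nat \<Rightarrow> real poly" and A
    by (induction A rule: infinite_finite_induct) (simp_all add: add L0)
  have "L p = L (\<Sum>i\<le>n. smult (coeff p i) (monom 1 i))"
    using poly_as_sum_of_monoms'[OF deg] by (simp add: smult_monom)
  also have "\<dots> = (\<Sum>i\<le>n. coeff p i * L (monom 1 i))"
    unfolding sum smult ..
  also have "\<bar>\<dots>\<bar> \<le> (\<Sum>i\<le>n. \<bar>coeff p i\<bar> * ?C)"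
    unfolding abs_mult[symmetric]
    by (rule order.trans[OF sum_abs], intro sum_mono)
       (auto simp: abs_mult intro!: mult_left_mono member_le_sum)
  finally show "\<bar>L p\<bar> \<le> ?C * coeff_norm n p"
    by (simp add: coeff_norm_def sum_distrib_right[symmetric] mult.commute)
qed

lemma cmod_cpoly_le:
  assumes "degree p \<le> n"
  shows "cmod (cpoly p z) \<le> coeff_norm n p * (1 + cmod z) ^ n"
proof -
  have "cpoly p z = (\<Sum>i\<le>n. of_real (coeff p i) * z ^ i)"
    unfolding cpoly_altdef
    by (rule sum.mono_neutral_left) (use assms in \<open>auto simp: coeff_eq_0\<close>)
  also have "cmod \<dots> \<le> (\<Sum>i\<le>n. \<bar>coeff p i\<bar> * (1 + cmod z) ^ n)"
  proof (rule sum_norm_le)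
    fix i assume "i \<in> {..n}"
    then have "cmod z ^ i \<le> (1 + cmod z) ^ n"
      by (metis atMost_iff le_add_same_cancel1 le_add_same_cancel2 norm_ge_zero order.trans
          power_increasing power_mono zero_le_one)
    then show "cmod (of_real (coeff p i) * z ^ i) \<le> \<bar>coeff p i\<bar> * (1 + cmod z) ^ n"
      by (simp add: norm_mult norm_power mult_left_mono)
  qed
  finally show ?thesis by (simp add: coeff_norm_def sum_distrib_right)
qed

definition lagrange_basis :: "real set \<Rightarrow> real \<Rightarrow> real poly" where
  "lagrange_basis X x = smult (1 / (\<Prod>y\<in>X - {x}. x - y)) (root_poly (X - {x}))"

lemma poly_lagrange_basis:
  assumes "finite X" "x \<in> X" "y \<in> X"
  shows "poly (lagrange_basis X x) y = (if y = x then 1 else 0)"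
proof (cases "y = x")
  case True
  have "(\<Prod>y\<in>X - {x}. x - y) \<noteq> 0" using assms by auto
  then show ?thesis using True by (simp add: lagrange_basis_def poly_root_poly)
next
  case False
  then have "(\<Prod>t\<in>X - {x}. y - t) = 0" using assms by auto
  then show ?thesis using False by (simp add: lagrange_basis_def poly_root_poly)
qed

lemma degree_lagrange_basis: "degree (lagrange_basis X x) \<le> card (X - {x})"
  unfolding lagrange_basis_def using degree_smult_le degree_root_poly by metis

lemma poly_eq_0_if_many_roots:
  fixes p :: "real poly"
  assumes "finite X" "\<And>x. x \<in> X \<Longrightarrow> poly p x = 0" "\<And>i. i \<ge> card X \<Longrightarrow> coeff p i = 0"
  shows "p = 0"
proof (rule ccontr)
  assume p: "p \<noteq> 0"
  have "card X \<le> card {x. poly p x = 0}"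
    using assms(2) poly_roots_finite[OF p] by (intro card_mono) auto
  also have "\<dots> \<le> degree p" using p by (rule card_poly_roots_bound)
  finally have "lead_coeff p = 0" by (rule assms(3))
  then show False using p by simp
qed

lemma lagrange_interpolation:
  assumes X: "finite X" and p: "\<And>i. i \<ge> card X \<Longrightarrow> coeff p i = 0"
  shows "p = (\<Sum>x\<in>X. smult (poly p x) (lagrange_basis X x))"
proof -
  let ?s = "\<Sum>x\<in>X. smult (poly p x) (lagrange_basis X x)"
  have "p - ?s = 0"
  proof (rule poly_eq_0_if_many_roots[OF X])
    fix y assume y: "y \<in> X"
    have "poly ?s y = (\<Sum>x\<in>X. if y = x then poly p x else 0)"
      unfolding poly_sum using X y by (intro sum.cong) (auto simp: poly_lagrange_basis)
    then show "poly (p - ?s) y = 0" using X y by simp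
  next
    fix i assume i: "i \<ge> card X"
    have "coeff (lagrange_basis X x) i = 0" if "x \<in> X" for x
    proof (rule coeff_eq_0)
      have "card (X - {x}) < card X" using X that by (rule card_Diff1_less)
      then show "degree (lagrange_basis X x) < i" using degree_lagrange_basis[of X x] i by linarith
    qed
    then have "coeff ?s i = 0" by (simp add: coeff_sum)
    then show "coeff (p - ?s) i = 0" using p i by simp
  qed
  then show ?thesis by simp
qed

lemma coeff_norm_le_values:
  assumes X: "finite X"
  obtains C where "C > 0"
    "\<And>p. (\<And>i. i \<ge> card X \<Longrightarrow> coeff p i = 0) \<Longrightarrow> coeff_norm n p \<le> C * (\<Sum>x\<in>X. \<bar>poly p x\<bar>)"
proof
  let ?C = "\<Sum>x\<in>X. coeff_norm n (lagrange_basis X x)"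
  show "?C + 1 > 0" using sum_nonneg[of X "\<lambda>x. coeff_norm n (lagrange_basis X x)"] coeff_norm_nonneg
    by fastforce
  fix p :: "real poly" assume p: "\<And>i. i \<ge> card X \<Longrightarrow> coeff p i = 0"
  have "coeff_norm n p \<le> (\<Sum>x\<in>X. coeff_norm n (smult (poly p x) (lagrange_basis X x)))"
    by (subst lagrange_interpolation[OF X p]) (auto intro: coeff_norm_sum)
  also have "\<dots> \<le> (\<Sum>x\<in>X. \<bar>poly p x\<bar> * (?C + 1))"
    unfolding coeff_norm_smult
  proof (intro sum_mono mult_left_mono)
    fix x assume "x \<in> X"
    then have "coeff_norm n (lagrange_basis X x) \<le> ?C"
      using X by (intro member_le_sum) (auto simp: coeff_norm_nonneg)
    then show "coeff_norm n (lagrange_basis X x) \<le> ?C + 1" by simp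
  qed auto
  finally show "coeff_norm n p \<le> (?C + 1) * (\<Sum>x\<in>X. \<bar>poly p x\<bar>)"
    by (simp add: sum_distrib_right[symmetric] mult.commute)
qed


text \<open>
  Subtracting \<open>\<Prod>(x - c\<^sub>j)\<close>, times the coefficient of \<open>x\<^sup>N\<close>, leaves a polynomial that Lagrange
  interpolation recovers from its values at the \<open>c\<^sub>j\<close>. Were the degree below \<open>N\<close>, the polynomial
  itself would be small relative to its own norm.
\<close>

lemma monic_almost_vanishing:
  assumes X: "finite X" and \<eta>: "\<eta> > 0"
  obtains \<epsilon> where "\<epsilon> > 0"
    "\<And>w. lead_coeff w = 1 \<Longrightarrow> degree w \<le> card X \<Longrightarrow>
       (\<And>x. x \<in> X \<Longrightarrow> \<bar>poly w x\<bar> \<le> \<epsilon> * coeff_norm (card X) w) \<Longrightarrow>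
       degree w = card X \<and> coeff_norm (card X) (w - root_poly X) \<le> \<eta>"
proof -
  define n where "n = card X"
  let ?\<omega> = "root_poly X"
  obtain C where C: "C > 0" "\<And>p. (\<And>i. i \<ge> n \<Longrightarrow> coeff p i = 0) \<Longrightarrow>
      coeff_norm n p \<le> C * (\<Sum>x\<in>X. \<bar>poly p x\<bar>)"
    unfolding n_def using coeff_norm_le_values[OF X] by metis
  define W where "W = coeff_norm n ?\<omega>"
  have W: "W \<ge> 1" unfolding W_def n_def
    by (intro coeff_norm_monic) (use lead_coeff_root_poly[of X] in \<open>simp_all add: degree_root_poly\<close>)
  define \<epsilon> where "\<epsilon> = min (1 / (2 * C * (n + 1))) (\<eta> / (2 * C * (n + 1) * W))"
  have \<epsilon>: "\<epsilon> > 0" "\<epsilon> * (C * (n + 1)) \<le> 1 / 2" "\<epsilon> * (C * (n + 1)) * (2 * W) \<le> \<eta>"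
  proof -
    show "\<epsilon> > 0" using C \<eta> W by (simp add: \<epsilon>_def)
    have "\<epsilon> * (C * (n + 1)) \<le> (1 / (2 * C * (n + 1))) * (C * (n + 1))"
      using C by (intro mult_right_mono) (auto simp: \<epsilon>_def)
    then show "\<epsilon> * (C * (n + 1)) \<le> 1 / 2" using C by simp
    have "\<epsilon> * (C * (n + 1)) * (2 * W) \<le> (\<eta> / (2 * C * (n + 1) * W)) * (C * (n + 1)) * (2 * W)"
      using C W by (intro mult_right_mono) (auto simp: \<epsilon>_def)
    then show "\<epsilon> * (C * (n + 1)) * (2 * W) \<le> \<eta>" using C W by simp
  qed
  have main: "degree w = n \<and> coeff_norm n (w - ?\<omega>) \<le> \<eta>"
    if w: "lead_coeff w = 1" "degree w \<le> n" "\<And>x. x \<in> X \<Longrightarrow> \<bar>poly w x\<bar> \<le> \<epsilon> * coeff_norm n w" for w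
  proof -
    let ?k = "coeff w n"
    have small: "coeff_norm n (w - smult ?k ?\<omega>) \<le> \<epsilon> * (C * (n + 1)) * coeff_norm n w"
    proof -
      have "coeff_norm n (w - smult ?k ?\<omega>) \<le> C * (\<Sum>x\<in>X. \<bar>poly (w - smult ?k ?\<omega>) x\<bar>)"
      proof (rule C(2))
        fix i assume "i \<ge> n"
        then consider "i = n" | "i > n" by linarith
        then show "coeff (w - smult ?k ?\<omega>) i = 0"
        proof cases
          case 1
          then show ?thesis using lead_coeff_root_poly[of X] by (simp add: degree_root_poly n_def)
        next
          case 2
          then have "coeff w i = 0" "coeff ?\<omega> i = 0"
            using w(2) by (auto intro!: coeff_eq_0 simp: degree_root_poly n_def)
          then show ?thesis by simp
        qed
      qed
      also have "(\<Sum>x\<in>X. \<bar>poly (w - smult ?k ?\<omega>) x\<bar>) = (\<Sum>x\<in>X. \<bar>poly w x\<bar>)"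
        using X by (intro sum.cong) (simp_all add: poly_root_poly_eq_0_iff[THEN iffD2])
      also have "\<dots> \<le> (\<Sum>x\<in>X. \<epsilon> * coeff_norm n w)"
        using w(3) by (rule sum_mono)
      also have "\<dots> \<le> (n + 1) * (\<epsilon> * coeff_norm n w)"
        using \<epsilon>(1) coeff_norm_nonneg[of n w] by (simp add: n_def mult_right_mono)
      finally show ?thesis using C(1) by (simp add: mult_left_mono algebra_simps)
    qed
    have w1: "coeff_norm n w \<ge> 1" using w by (intro coeff_norm_monic)
    have half: "\<epsilon> * (C * (n + 1)) * coeff_norm n w \<le> coeff_norm n w / 2"
      using mult_right_mono[OF \<epsilon>(2) coeff_norm_nonneg[of n w]] by simp
    have "degree w = n"
    proof (rule ccontr)
      assume "degree w \<noteq> n"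
      then have "?k = 0" using w(2) by (intro coeff_eq_0) simp
      then have "coeff_norm n w \<le> coeff_norm n w / 2" using small half by simp
      then show False using w1 by simp
    qed
    then have k: "?k = 1" using w(1) by simp
    have "coeff_norm n w \<le> coeff_norm n (w - ?\<omega>) + W"
      using coeff_norm_triangle[of n "w - ?\<omega>" ?\<omega>] by (simp add: W_def)
    then have le: "coeff_norm n w \<le> 2 * W" using small half k by simp
    have "coeff_norm n (w - ?\<omega>) \<le> \<epsilon> * (C * (n + 1)) * (2 * W)"
    proof -
      have "0 \<le> \<epsilon> * (C * (n + 1))" using \<epsilon>(1) C(1) by simp
      from mult_left_mono[OF le this] show ?thesis using small k by simp
    qed
    then show ?thesis using \<epsilon>(3) \<open>degree w = n\<close> by simp
  qed
  show ?thesis by (rule that[OF \<epsilon>(1)]) (use main in \<open>simp add: n_def\<close>)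
qed

section \<open>Comparing products over two almost interlacing sets\<close>

lemma card_le_nth_sorted:
  fixes Y :: "real set"
  assumes Y: "finite Y" and i: "i < card Y"
  shows "card {y \<in> Y. y \<le> sorted_list_of_set Y ! i} \<ge> i + 1"
    "card {y \<in> Y. y \<ge> sorted_list_of_set Y ! i} \<ge> card Y - i"
    "a < sorted_list_of_set Y ! i \<Longrightarrow> card {y \<in> Y. y \<le> a} \<le> i"
    "sorted_list_of_set Y ! i < a \<Longrightarrow> card {y \<in> Y. y \<ge> a} \<le> card Y - (i + 1)"
proof -
  let ?l = "sorted_list_of_set Y"
  have len: "length ?l = card Y" by simp
  have bij: "bij_betw (\<lambda>j. ?l ! j) {..<card Y} Y"
    by (metis Y bij_betw_nth distinct_sorted_list_of_set len set_sorted_list_of_set)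
  have mono: "?l ! j \<le> ?l ! k" if "j \<le> k" "k < card Y" for j k
    using that by (auto intro: sorted_nth_mono)
  have inj: "inj_on (\<lambda>j. ?l ! j) J" if "J \<subseteq> {..<card Y}" for J
    using bij that by (meson bij_betw_def inj_on_subset)
  have Yj: "\<exists>j<card Y. y = ?l ! j" if "y \<in> Y" for y
    using bij that by (auto simp: bij_betw_def)
  have jY: "?l ! j \<in> Y" if "j < card Y" for j
    using bij that by (auto simp: bij_betw_def)
  have "card ((\<lambda>j. ?l ! j) ` {..i}) \<le> card {y \<in> Y. y \<le> ?l ! i}"
    using i Y mono jY by (intro card_mono) auto
  then show "card {y \<in> Y. y \<le> ?l ! i} \<ge> i + 1"
    using i by (subst (asm) card_image) (auto intro!: inj)
  have "card ((\<lambda>j. ?l ! j) ` {i..<card Y}) \<le> card {y \<in> Y. y \<ge> ?l ! i}"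
    using i Y mono jY by (intro card_mono) auto
  then show "card {y \<in> Y. y \<ge> ?l ! i} \<ge> card Y - i"
    using i by (subst (asm) card_image) (auto intro!: inj)
  show "card {y \<in> Y. y \<le> a} \<le> i" if a: "a < ?l ! i"
  proof -
    have "{y \<in> Y. y \<le> a} \<subseteq> (\<lambda>j. ?l ! j) ` {..<i}"
    proof
      fix y assume y: "y \<in> {y \<in> Y. y \<le> a}"
      then obtain j where j: "j < card Y" "y = ?l ! j" using Yj by blast
      then have "j < i" using mono[of i j] y a by force
      then show "y \<in> (\<lambda>j. ?l ! j) ` {..<i}" using j by auto
    qed
    then have "card {y \<in> Y. y \<le> a} \<le> card ((\<lambda>j. ?l ! j) ` {..<i})" by (intro card_mono) auto
    also have "\<dots> \<le> i" using card_image_le[of "{..<i}"] by fastforce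
    finally show ?thesis .
  qed
  show "card {y \<in> Y. y \<ge> a} \<le> card Y - (i + 1)" if a: "?l ! i < a"
  proof -
    have "{y \<in> Y. y \<ge> a} \<subseteq> (\<lambda>j. ?l ! j) ` {Suc i..<card Y}"
    proof
      fix y assume y: "y \<in> {y \<in> Y. y \<ge> a}"
      then obtain j where j: "j < card Y" "y = ?l ! j" using Yj by blast
      then have "i < j" using mono[of j i] y a i by force
      then show "y \<in> (\<lambda>j. ?l ! j) ` {Suc i..<card Y}" using j by auto
    qed
    then have "card {y \<in> Y. y \<ge> a} \<le> card ((\<lambda>j. ?l ! j) ` {Suc i..<card Y})" by (intro card_mono) auto
    also have "\<dots> \<le> card Y - (i + 1)" using card_image_le[of "{Suc i..<card Y}"] by fastforce
    finally show ?thesis .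
  qed
qed

lemma sum_shift_le:
  fixes h :: "nat \<Rightarrow> real"
  assumes "\<And>i. h i \<in> {-1..1}"
  shows "(\<Sum>l<a. h (l + k) - h l) \<le> 2 * real k"
proof (induction k)
  case (Suc k)
  have "(\<Sum>l<a. h (l + Suc k) - h (l + k)) = h (a + k) - h k"
    using sum_lessThan_telescope[of "\<lambda>l. h (l + k)" a] by simp
  also have "\<dots> \<le> 2" using assms[of "a + k"] assms[of k] by simp
  moreover have "(\<Sum>l<a. h (l + Suc k) - h l) =
      (\<Sum>l<a. h (l + Suc k) - h (l + k)) + (\<Sum>l<a. h (l + k) - h l)"
    by (simp add: sum.distrib[symmetric])
  ultimately show ?case using Suc by simp
qed simp

text \<open>
  The two counting hypotheses place the \<open>l\<close>-th point of \<open>Z\<close> between the points of \<open>Y\<close> with indices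
  \<open>l - D\<close> and \<open>l + D\<close>. When points of equal index are paired, the distances add up to at most
  \<open>4 D\<close>, and each quotient \<open>(z - y) / (z - t)\<close> has modulus at most \<open>exp (\<bar>y - t\<bar> / \<delta>)\<close>. The
  unpaired points of \<open>Y\<close> account for the power of \<open>1 + \<bar>z\<bar>\<close>.
\<close>

lemma root_poly_almost_interlacing:
  fixes Y Z :: "real set"
  assumes Y: "finite Y" "Y \<subseteq> {-1<..<1}" and Z: "finite Z" "Z \<subseteq> {-1<..<1}"
    and ZY: "card Z \<le> card Y"
    and below: "\<And>y. y \<in> Y \<Longrightarrow> card {y' \<in> Y. y' \<le> y} \<le> card {t \<in> Z. t \<le> y} + D"
    and above: "\<And>y. y \<in> Y \<Longrightarrow> card {y' \<in> Y. y' \<ge> y} \<le> card {t \<in> Z. t \<ge> y} + D"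
    and \<delta>: "\<delta> > 0" and z: "\<And>x. x \<in> {-1..1} \<Longrightarrow> cmod (z - of_real x) \<ge> \<delta>"
  shows "cmod (cpoly (root_poly Y) z) \<le>
    exp (4 * real D / \<delta>) * (1 + cmod z) ^ (card Y - card Z) * cmod (cpoly (root_poly Z) z)"
proof -
  define yl where "yl = (\<lambda>i. sorted_list_of_set Y ! i)"
  define zl where "zl = (\<lambda>i. sorted_list_of_set Z ! i)"
  define m where "m = card Y"
  define a where "a = card Z"
  have bijY: "bij_betw yl {..<m} Y"
    unfolding yl_def m_def
    by (metis Y(1) bij_betw_nth distinct_sorted_list_of_set length_sorted_list_of_set
      set_sorted_list_of_set)
  have bijZ: "bij_betw zl {..<a} Z"
    unfolding zl_def a_def
    by (metis Z(1) bij_betw_nth distinct_sorted_list_of_set length_sorted_list_of_set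
      set_sorted_list_of_set)
  have yl: "yl i \<in> Y" if "i < m" for i using bijY that by (auto simp: bij_betw_def)
  have zl: "zl i \<in> Z" if "i < a" for i using bijZ that by (auto simp: bij_betw_def)
  have ymono: "yl i \<le> yl j" if "i \<le> j" "j < m" for i j
    using that unfolding yl_def m_def by (auto intro: sorted_nth_mono)
  \<comment> \<open>The sorted points of \<open>Y\<close>, shifted by \<open>D\<close> and padded with the endpoints of the interval.\<close>
  define h where "h i = (if i < D then -1 else if i - D < m then yl (i - D) else 1)" for i
  have h: "h i \<in> {-1..1}" for i
    using yl[of "i - D"] Y(2) by (force simp: h_def)
  have hyl: "h l \<le> yl l" "yl l \<le> h (l + 2 * D)" if "l < m" for l
  proof -
    have "yl l \<in> {-1<..<1}" using yl[OF that] Y(2) by blast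
    then show "h l \<le> yl l" "yl l \<le> h (l + 2 * D)"
      using ymono[of "l - D" l] ymono[of l "l + D"] that by (auto simp: h_def mult_2)
  qed
  have up: "zl l \<le> h (l + 2 * D)" if "l < a" for l
  proof (cases "l + D < m")
    case True
    have "zl l \<le> yl (l + D)"
    proof (rule ccontr)
      assume "\<not> ?thesis"
      then have "card {t \<in> Z. t \<le> yl (l + D)} \<le> l"
        using card_le_nth_sorted(3)[OF Z(1), of l] that by (simp add: zl_def a_def)
      moreover have "l + D + 1 \<le> card {y' \<in> Y. y' \<le> yl (l + D)}"
        using card_le_nth_sorted(1)[OF Y(1), of "l + D"] True by (simp add: yl_def m_def)
      ultimately show False using below[OF yl[OF True]] by linarith
    qed
    then show ?thesis using True by (simp add: h_def mult_2)
  next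
    case False
    then show ?thesis using zl[OF that] Z(2) by (force simp: h_def)
  qed
  have low: "h l \<le> zl l" if "l < a" for l
  proof (cases "l < D")
    case False
    then have lm: "l - D < m" using that ZY by (simp add: a_def m_def)
    have "yl (l - D) \<le> zl l"
    proof (rule ccontr)
      assume "\<not> ?thesis"
      then have "card {t \<in> Z. t \<ge> yl (l - D)} \<le> a - (l + 1)"
        using card_le_nth_sorted(4)[OF Z(1), of l] that by (simp add: zl_def a_def)
      moreover have "m - (l - D) \<le> card {y' \<in> Y. y' \<ge> yl (l - D)}"
        using card_le_nth_sorted(2)[OF Y(1), of "l - D"] lm by (simp add: yl_def m_def)
      ultimately show False using above[OF yl[OF lm]] False that ZY by (simp add: a_def m_def)
    qed
    then show ?thesis using False lm by (simp add: h_def)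
  qed (use zl[OF that] Z(2) in \<open>force simp: h_def\<close>)
  have pair: "cmod (z - of_real (yl l)) \<le> exp ((h (l + 2 * D) - h l) / \<delta>) * cmod (z - of_real (zl l))"
    if "l < a" for l
  proof -
    have \<delta>z: "cmod (z - of_real (zl l)) \<ge> \<delta>" using zl[OF that] Z(2) by (intro z) force
    have dist: "\<bar>zl l - yl l\<bar> \<le> h (l + 2 * D) - h l"
      using up[OF that] low[OF that] hyl[of l] that ZY by (simp add: a_def m_def abs_le_iff)
    have "z - of_real (yl l) = (z - of_real (zl l)) + of_real (zl l - yl l)" by simp
    then have "cmod (z - of_real (yl l)) \<le> cmod (z - of_real (zl l)) + \<bar>zl l - yl l\<bar>"
      by (metis norm_triangle_ineq norm_of_real)
    also have "\<bar>zl l - yl l\<bar> \<le> (h (l + 2 * D) - h l) / \<delta> * cmod (z - of_real (zl l))"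
    proof -
      have "(h (l + 2 * D) - h l) / \<delta> * \<delta> \<le> (h (l + 2 * D) - h l) / \<delta> * cmod (z - of_real (zl l))"
        using \<delta>z dist \<delta> by (intro mult_left_mono) auto
      then show ?thesis using dist \<delta> by simp
    qed
    finally have "cmod (z - of_real (yl l)) \<le>
      (1 + (h (l + 2 * D) - h l) / \<delta>) * cmod (z - of_real (zl l))"
      by (simp add: algebra_simps)
    also have "\<dots> \<le> exp ((h (l + 2 * D) - h l) / \<delta>) * cmod (z - of_real (zl l))"
      by (intro mult_right_mono exp_ge_add_one_self) auto
    finally show ?thesis .
  qed
  have "cmod (cpoly (root_poly Y) z) = (\<Prod>l<m. cmod (z - of_real (yl l)))"
    unfolding cmod_cpoly_root_poly by (rule prod.reindex_bij_betw[OF bijY, symmetric])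
  also have "{..<m} = {..<a} \<union> {a..<m}" using ZY by (auto simp: a_def m_def)
  also have "(\<Prod>l\<in>{..<a} \<union> {a..<m}. cmod (z - of_real (yl l))) =
      (\<Prod>l<a. cmod (z - of_real (yl l))) * (\<Prod>l\<in>{a..<m}. cmod (z - of_real (yl l)))"
    by (rule prod.union_disjoint) auto
  also have "\<dots> \<le> (\<Prod>l<a. exp ((h (l + 2 * D) - h l) / \<delta>) * cmod (z - of_real (zl l))) *
      (\<Prod>l\<in>{a..<m}. 1 + cmod z)"
  proof (intro mult_mono prod_mono conjI norm_ge_zero prod_nonneg ballI)
    fix l assume "l \<in> {a..<m}"
    then have "cmod (of_real (yl l)) \<le> 1" using yl[of l] Y(2) by force
    then show "cmod (z - of_real (yl l)) \<le> 1 + cmod z"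
      using norm_triangle_ineq4[of z "of_real (yl l)"] by linarith
  qed (use pair in auto)
  also have "\<dots> = exp (\<Sum>l<a. (h (l + 2 * D) - h l) / \<delta>) * (\<Prod>l<a. cmod (z - of_real (zl l))) *
      (1 + cmod z) ^ (m - a)"
    by (simp add: prod.distrib exp_sum)
  also have "(\<Prod>l<a. cmod (z - of_real (zl l))) = cmod (cpoly (root_poly Z) z)"
    unfolding cmod_cpoly_root_poly by (rule prod.reindex_bij_betw[OF bijZ])
  also have "exp (\<Sum>l<a. (h (l + 2 * D) - h l) / \<delta>) * cmod (cpoly (root_poly Z) z) *
    (1 + cmod z) ^ (m - a)
      \<le> exp (4 * real D / \<delta>) * cmod (cpoly (root_poly Z) z) * (1 + cmod z) ^ (m - a)"
  proof -
    have "(\<Sum>l<a. h (l + 2 * D) - h l) \<le> 4 * real D"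
      using sum_shift_le[OF h, where a = a and k = "2 * D"] by simp
    then have "(\<Sum>l<a. (h (l + 2 * D) - h l) / \<delta>) \<le> 4 * real D / \<delta>"
      using \<delta> by (simp add: sum_divide_distrib[symmetric] divide_right_mono)
    then show ?thesis by (intro mult_right_mono) auto
  qed
  finally show ?thesis by (simp add: m_def a_def mult_ac)
qed

section \<open>Monic orthogonal polynomials\<close>

locale poly_inner =
  fixes ip :: "real poly \<Rightarrow> real poly \<Rightarrow> real"
  assumes ip_sym: "ip p q = ip q p"
    and ip_add: "ip (p + q) r = ip p r + ip q r"
    and ip_smult: "ip (smult a p) r = a * ip p r"
    and ip_pos: "p \<noteq> 0 \<Longrightarrow> ip p p > 0"
begin

definition is_monic_orth :: "nat \<Rightarrow> real poly \<Rightarrow> bool" where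
  "is_monic_orth n p \<longleftrightarrow> degree p = n \<and> lead_coeff p = 1 \<and> (\<forall>k<n. ip (monom 1 k) p = 0)"

lemma ip_0: "ip 0 r = 0"
  using ip_smult[of 0 0 r] by simp

lemma ip_diff: "ip (p - q) r = ip p r - ip q r"
  using ip_add[of p "smult (-1) q" r] ip_smult[of "-1" q r] by simp

lemma ip_diff_right: "ip r (p - q) = ip r p - ip r q"
  using ip_diff[of p q r] by (simp only: ip_sym[of r])

lemma ip_sum: "ip (sum f A) r = (\<Sum>i\<in>A. ip (f i) r)"
  by (induction A rule: infinite_finite_induct) (simp_all add: ip_0 ip_add)

lemma orthogonal_lower_degree:
  assumes "\<And>k. k < n \<Longrightarrow> ip (monom 1 k) p = 0" "degree q < n"
  shows "ip q p = 0"
proof -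
  have "ip q p = ip (\<Sum>i\<le>degree q. smult (coeff q i) (monom 1 i)) p"
    using poly_as_sum_of_monoms[of q] by (simp add: smult_monom)
  also have "\<dots> = 0"
    unfolding ip_sum ip_smult using assms by simp
  finally show ?thesis .
qed

lemma is_monic_orth_unique:
  assumes "is_monic_orth n p" "is_monic_orth n q"
  shows "p = q"
proof (rule ccontr)
  assume "p \<noteq> q"
  have "coeff (p - q) n = 0" "degree (p - q) \<le> n"
    using assms degree_diff_le_max[of p q] by (auto simp: is_monic_orth_def)
  then have deg: "degree (p - q) < n"
    using \<open>p \<noteq> q\<close> by (metis eq_iff_diff_eq_0 leading_coeff_0_iff le_neq_implies_less)
  have "ip (p - q) p = 0" "ip (p - q) q = 0"
    using assms deg by (auto simp: is_monic_orth_def intro: orthogonal_lower_degree)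
  then have "ip (p - q) (p - q) = 0"
    unfolding ip_diff_right by simp
  then show False using ip_pos[of "p - q"] \<open>p \<noteq> q\<close> by simp
qed

lemma is_monic_orth_exists: "\<exists>p. is_monic_orth n p"
proof -
  have "\<exists>p\<in>UNIV. p \<noteq> 0 \<and> degree p \<le> degree (monom (1::real) n) \<and> (\<forall>j<n. ip p (monom 1 j) = 0)"
    by (rule exists_annihilated_poly) (auto simp: ip_add ip_smult degree_monom_eq)
  then obtain p where p: "p \<noteq> 0" "degree p \<le> n" "\<And>j. j < n \<Longrightarrow> ip (monom 1 j) p = 0"
    by (auto simp: degree_monom_eq ip_sym)
  have "degree p = n"
    using orthogonal_lower_degree[of n p p] p ip_pos[of p] by fastforce
  then have "is_monic_orth n (smult (1 / lead_coeff p) p)"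
    using p by (auto simp: is_monic_orth_def ip_sym[of "monom _ _"] ip_smult)
  then show ?thesis by blast
qed

definition monic_orth :: "nat \<Rightarrow> real poly" where
  "monic_orth n = (THE p. is_monic_orth n p)"

lemma is_monic_orth_monic_orth: "is_monic_orth n (monic_orth n)"
  unfolding monic_orth_def using is_monic_orth_exists is_monic_orth_unique by (metis theI)

lemma degree_monic_orth [simp]: "degree (monic_orth n) = n"
  and lead_coeff_monic_orth: "lead_coeff (monic_orth n) = 1"
  using is_monic_orth_monic_orth[of n] by (auto simp: is_monic_orth_def)

lemma coeff_monic_orth [simp]: "coeff (monic_orth n) n = 1"
  using lead_coeff_monic_orth[of n] by simp

lemma monic_orth_nonzero [simp]: "monic_orth n \<noteq> 0"
  using coeff_monic_orth[of n] by (metis coeff_0 zero_neq_one)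

lemma monic_orth_orthogonal: "degree q < n \<Longrightarrow> ip q (monic_orth n) = 0"
  using is_monic_orth_monic_orth[of n]
    by (auto simp: is_monic_orth_def intro: orthogonal_lower_degree)

lemma degree_less_of_monic_diff:
  fixes p q :: "real poly"
  assumes "degree p = n" "lead_coeff p = 1" "degree q = n" "lead_coeff q = 1"
  shows "p = q \<or> degree (p - q) < n"
  using assms degree_diff_le_max[of p q]
  by (metis coeff_diff eq_iff_diff_eq_0 leading_coeff_0_iff le_neq_implies_less max.idem)

lemma monic_orth_minimal:
  assumes "degree f = n" "lead_coeff f = 1"
  shows "ip (monic_orth n) (monic_orth n) \<le> ip f f"
proof -
  let ?g = "f - monic_orth n"
  have "ip ?g (monic_orth n) = 0"
    using degree_less_of_monic_diff[of f n "monic_orth n"] assms monic_orth_orthogonal ip_0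
      by fastforce
  then have "ip f (monic_orth n) = ip (monic_orth n) (monic_orth n)" by (simp add: ip_diff)
  then have "ip f f = ip (monic_orth n) (monic_orth n) + ip ?g ?g"
    using ip_sym[of f "monic_orth n"] by (simp add: ip_diff ip_diff_right)
  moreover have "ip ?g ?g \<ge> 0"
    using ip_pos[of ?g] ip_0 by (cases "?g = 0") auto
  ultimately show ?thesis by simp
qed

end

section \<open>Integration of polynomials over the interval\<close>

locale interval_measure =
  fixes M :: "real measure"
  assumes M: "finite_borel_on_interval M" and infinite_supp: "infinite (measure_supp M)"
begin

lemma sets_M [measurable_cong]: "sets M = sets borel"
  and finite_M: "finite_measure M"
  and null_outside: "emeasure M (- {-1..1}) = 0"
  using M by (auto simp: finite_borel_on_interval_def)

lemma space_M [simp]: "space M = UNIV"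
  using sets_eq_imp_space_eq[OF sets_M] by simp

lemma AE_in_interval: "AE x in M. x \<in> {-1..1}"
  by (rule AE_I[of _ _ "- {-1..1}"]) (auto simp: null_outside sets_M)

lemma set_integrable_continuous:
  fixes f :: "real \<Rightarrow> 'b :: {banach, second_countable_topology}"
  assumes "continuous_on {-1..1} f"
  shows "set_integrable M {-1..1} f"
proof -
  have "bounded (f ` {-1..1})"
    using assms by (intro compact_imp_bounded compact_continuous_image) auto
  then obtain B where B: "\<And>x. x \<in> {-1..1} \<Longrightarrow> norm (f x) \<le> B"
    unfolding bounded_iff by blast
  have "norm (f 0) \<le> B" by (rule B) simp
  then have "B \<ge> 0" by (rule order.trans[OF norm_ge_zero])
  have "(\<lambda>x. indicator {-1..1} x *\<^sub>R f x) \<in> borel_measurable M"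
    using borel_measurable_continuous_on_indicator[OF _ assms] measurable_cong_sets[OF sets_M refl]
    by auto
  then show ?thesis
    unfolding set_integrable_def
    using finite_M B \<open>B \<ge> 0\<close>
    by (intro finite_measure.integrable_const_bound[of _ _ B]) (auto simp: indicator_def)
qed

definition integ :: "real poly \<Rightarrow> real" where
  "integ p = (LINT x:{-1..1}|M. poly p x)"

lemma set_integrable_poly [simp]: "set_integrable M {-1..1} (poly p)"
  by (intro set_integrable_continuous continuous_intros)

lemma integ_add: "integ (p + q) = integ p + integ q"
  using set_integral_add(2)[OF set_integrable_poly set_integrable_poly, of p q]
    by (simp add: integ_def)

lemma integ_smult: "integ (smult a p) = a * integ p"
  by (simp add: integ_def)

lemma integ_0 [simp]: "integ 0 = 0"
  using integ_smult[of 0 0] by simp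

lemma integ_diff: "integ (p - q) = integ p - integ q"
  using integ_add[of p "smult (-1) q"] integ_smult[of "-1" q] by simp

lemma integ_sum: "integ (sum f A) = (\<Sum>i\<in>A. integ (f i))"
  by (induction A rule: infinite_finite_induct) (simp_all add: integ_add)

lemma set_integral_mono_continuous:
  fixes f g :: "real \<Rightarrow> real"
  assumes "continuous_on {-1..1} f" "continuous_on {-1..1} g" "\<And>x. x \<in> {-1..1} \<Longrightarrow> f x \<le> g x"
  shows "(LINT x:{-1..1}|M. f x) \<le> (LINT x:{-1..1}|M. g x)"
  using assms by (intro set_integral_mono set_integrable_continuous)

lemma integ_mono: "(\<And>x. x \<in> {-1..1} \<Longrightarrow> poly p x \<le> poly q x) \<Longrightarrow> integ p \<le> integ q"
  unfolding integ_def by (intro set_integral_mono_continuous continuous_intros)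

lemma integ_nonneg: "(\<And>x. x \<in> {-1..1} \<Longrightarrow> poly p x \<ge> 0) \<Longrightarrow> integ p \<ge> 0"
  using integ_mono[of 0 p] by simp

text \<open>The support is infinite, so it is not contained in the zero set of a polynomial.\<close>

lemma integ_pos:
  assumes "p \<noteq> 0" "\<And>x. x \<in> {-1..1} \<Longrightarrow> poly p x \<ge> 0"
  shows "integ p > 0"
proof (rule ccontr)
  assume "\<not> integ p > 0"
  then have "integ p = 0" using integ_nonneg[OF assms(2)] by simp
  then have "AE x in M. indicator {-1..1} x *\<^sub>R poly p x = 0"
    using set_integrable_poly[of p] assms(2)
    unfolding integ_def set_lebesgue_integral_def set_integrable_def
    by (subst (asm) integral_nonneg_eq_0_iff_AE) (auto simp: indicator_def)
  then have AE0: "AE x in M. poly p x = 0"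
    using AE_in_interval by eventually_elim auto
  have "measure_supp M \<subseteq> {x. poly p x = 0}"
  proof (rule ccontr)
    assume "\<not> ?thesis"
    then obtain x where x: "x \<in> measure_supp M" "poly p x \<noteq> 0" by blast
    define U where "U = {x. poly p x \<noteq> 0}"
    have U: "open U" unfolding U_def
      by (intro open_Collect_neq continuous_intros)
    then have "emeasure M U > 0" using x by (auto simp: measure_supp_def U_def)
    moreover have "emeasure M U = 0"
    proof -
      have "U \<in> sets M" using U by (simp add: sets_M)
      then show ?thesis using AE0 by (subst (asm) AE_iff_measurable[of U]) (auto simp: U_def)
    qed
    ultimately show False by simp
  qed
  then have "finite (measure_supp M)"
    using poly_roots_finite[OF assms(1)] finite_subset by blast
  then show False using infinite_supp by simp
qed

lemma integ_square_pos: "p \<noteq> 0 \<Longrightarrow> integ (p * p) > 0"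
  by (rule integ_pos) auto

definition l2_norm :: "real poly \<Rightarrow> real" where
  "l2_norm p = sqrt (integ (p * p))"

lemma l2_norm_pos: "p \<noteq> 0 \<Longrightarrow> l2_norm p > 0"
  using integ_square_pos by (simp add: l2_norm_def)

lemma l2_norm_nonneg: "l2_norm p \<ge> 0"
  by (simp add: l2_norm_def integ_nonneg)

lemma l2_norm_square: "l2_norm p ^ 2 = integ (p * p)"
  by (simp add: l2_norm_def integ_nonneg)

text \<open>The inequality of Cauchy and Schwarz, from \<open>2 \<bar>a b\<bar> \<le> \<tau> a\<^sup>2 + b\<^sup>2 / \<tau>\<close> with optimal \<open>\<tau>\<close>.\<close>

lemma set_integral_abs_mult_le:
  assumes p: "p \<noteq> 0" and q: "q \<noteq> 0"
  shows "(LINT x:{-1..1}|M. \<bar>poly p x * poly q x\<bar>) \<le> l2_norm p * l2_norm q"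
proof -
  define \<tau> where "\<tau> = l2_norm q / l2_norm p"
  have \<tau>: "\<tau> > 0" using l2_norm_pos p q by (simp add: \<tau>_def)
  have "(LINT x:{-1..1}|M. \<bar>poly p x * poly q x\<bar>) \<le>
    integ (smult (\<tau> / 2) (p * p) + smult (1 / (2 * \<tau>)) (q * q))"
    unfolding integ_def
  proof (intro set_integral_mono_continuous continuous_intros)
    fix x
    have "0 \<le> (\<tau> * \<bar>poly p x\<bar> - \<bar>poly q x\<bar>)\<^sup>2" by simp
    also have "\<dots> = \<tau>\<^sup>2 * (poly p x)\<^sup>2 + (poly q x)\<^sup>2 - 2 * \<tau> * (\<bar>poly p x\<bar> * \<bar>poly q x\<bar>)"
      by (simp add: power2_eq_square algebra_simps)
    finally have "2 * \<tau> * \<bar>poly p x * poly q x\<bar> \<le> \<tau>\<^sup>2 * (poly p x)\<^sup>2 + (poly q x)\<^sup>2"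
      by (simp add: abs_mult)
    then have "\<bar>poly p x * poly q x\<bar> \<le> (\<tau>\<^sup>2 * (poly p x)\<^sup>2 + (poly q x)\<^sup>2) / (2 * \<tau>)"
      using \<tau> by (simp add: field_simps)
    then show "\<bar>poly p x * poly q x\<bar> \<le> poly (smult (\<tau> / 2) (p * p) + smult (1 / (2 * \<tau>)) (q * q)) x"
      using \<tau> by (simp add: field_simps power2_eq_square)
  qed
  also have "\<dots> = \<tau> / 2 * (l2_norm p)\<^sup>2 + 1 / (2 * \<tau>) * (l2_norm q)\<^sup>2"
    by (simp add: integ_add integ_smult l2_norm_square)
  also have "\<dots> = l2_norm p * l2_norm q"
    using l2_norm_pos[OF p] l2_norm_pos[OF q] by (simp add: \<tau>_def field_simps power2_eq_square)
  finally show ?thesis .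
qed

end

section \<open>Sign changes of the Sobolev orthogonal polynomials\<close>

lemma poly_deriv: "deriv (poly p) = poly (pderiv p)" for p :: "real poly"
  by (rule ext, rule DERIV_imp_deriv, rule poly_DERIV)

lemma higher_deriv_poly: "(deriv ^^ k) (poly p) = poly ((pderiv ^^ k) p)" for p :: "real poly"
  by (induction k) (simp_all add: poly_deriv)

locale discrete_sobolev = interval_measure M for M +
  fixes N :: nat and c eta :: "nat \<Rightarrow> real" and d :: "nat \<Rightarrow> nat"
  assumes eta: "\<And>j. j \<in> {1..N} \<Longrightarrow> eta j > 0"
    and c: "\<And>j. j \<in> {1..N} \<Longrightarrow> c j \<notin> {-1..1}"
    and ordered: "sequentially_ordered N c d"
begin

definition sobolev :: "real poly \<Rightarrow> real poly \<Rightarrow> real" where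
  "sobolev p q = sobolev_inner M N c d eta (poly p) (poly q)"

lemma sobolev_eq: "sobolev p q = integ (p * q) +
    (\<Sum>j = 1..N. eta j * poly ((pderiv ^^ d j) p) (c j) * poly ((pderiv ^^ d j) q) (c j))"
  by (simp add: sobolev_def sobolev_inner_def integ_def higher_deriv_poly)

sublocale sobolev: poly_inner sobolev
proof
  fix p q r :: "real poly" and a :: real
  show "sobolev p q = sobolev q p" by (simp add: sobolev_eq mult_ac)
  show "sobolev (p + q) r = sobolev p r + sobolev q r"
    by (simp add: sobolev_eq integ_add higher_pderiv_add algebra_simps sum.distrib)
  show "sobolev (smult a p) r = a * sobolev p r"
    by (simp add: sobolev_eq integ_smult higher_pderiv_smult algebra_simps sum_distrib_left)
  assume "p \<noteq> 0"
  have "(\<Sum>j = 1..N. eta j * poly ((pderiv ^^ d j) p) (c j) * poly ((pderiv ^^ d j) p) (c j)) \<ge> 0"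
    using eta by (intro sum_nonneg) (simp add: mult.assoc less_imp_le)
  then show "sobolev p p > 0" using integ_square_pos[OF \<open>p \<noteq> 0\<close>] by (simp add: sobolev_eq)
qed

abbreviation S :: "nat \<Rightarrow> real poly" where
  "S n \<equiv> S_poly M N c d eta n"

lemma S_eq_monic_orth: "S n = sobolev.monic_orth n"
proof -
  have "(\<lambda>x. x ^ k) = poly (monom (1::real) k)" for k by (simp add: poly_monom fun_eq_iff)
  then show ?thesis
    by (simp add: S_poly_def monic_op_def sobolev.monic_orth_def sobolev.is_monic_orth_def
      sobolev_def)
qed

lemma degree_S [simp]: "degree (S n) = n"
  and coeff_S [simp]: "coeff (S n) n = 1"
  and S_nonzero [simp]: "S n \<noteq> 0"
  by (simp_all add: S_eq_monic_orth)

lemma S_orthogonal: "degree q < n \<Longrightarrow> sobolev q (S n) = 0"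
  by (simp add: S_eq_monic_orth sobolev.monic_orth_orthogonal)

text \<open>
  If there were fewer sign changes, the product of the corresponding linear factors with the
  cofactor \<open>g\<close> of \<open>exists_test_polynomial\<close> would have degree less than \<open>n\<close> and annihilate all
  the discrete terms, while the remaining integrand has constant sign.
\<close>

lemma S_sign_changes:
  obtains Z w where "finite Z" "Z \<subseteq> {-1<..<1}" "S n = root_poly Z * w"
    "(\<forall>x\<in>{-1..1}. poly w x \<ge> 0) \<or> (\<forall>x\<in>{-1..1}. poly w x \<le> 0)"
    "n \<le> card Z + N" "lead_coeff w = 1" "card Z + degree w = n"
proof -
  obtain Z w where Z: "finite Z" "Z \<subseteq> {-1<..<1}" and S: "S n = root_poly Z * w"
    and w: "(\<forall>x\<in>{-1..1}. poly w x \<ge> 0) \<or> (\<forall>x\<in>{-1..1}. poly w x \<le> 0)"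
    using sign_change_factorization[OF S_nonzero[of n]] by metis
  have w0: "w \<noteq> 0" using S S_nonzero[of n] by auto
  have deg: "card Z + degree w = n"
    using degree_mult_eq[OF root_poly_nonzero[of Z] w0] by (simp add: S[symmetric] degree_root_poly)
  have lc: "lead_coeff w = 1"
    using lead_coeff_mult[of "root_poly Z" w] coeff_S[of n]
    by (simp only: S[symmetric] degree_S lead_coeff_root_poly mult_1)
  have "n \<le> card Z + N"
  proof (rule ccontr)
    assume less: "\<not> n \<le> card Z + N"
    obtain \<sigma> where \<sigma>: "bij_betw \<sigma> {1..N} {1..N}"
      "\<And>i j. i \<in> {1..N} \<Longrightarrow> j \<in> {1..N} \<Longrightarrow> i \<le> j \<Longrightarrow> d (\<sigma> i) \<le> d (\<sigma> j)"
      "\<And>k. k \<in> {1..N} \<Longrightarrow> c (\<sigma> k) \<notin> convex hull ({-1<..<1} \<union> (\<lambda>i. c (\<sigma> i)) ` {1..<k})"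
      using ordered unfolding sequentially_ordered_def by metis
    obtain g where g: "g \<noteq> 0" "degree g \<le> N" "\<And>t. t \<in> {-1<..<1} \<Longrightarrow> poly g t \<noteq> 0"
      "\<And>j. j \<in> {1..N} \<Longrightarrow> poly ((pderiv ^^ d (\<sigma> j)) (root_poly Z * g)) (c (\<sigma> j)) = 0"
    proof (rule exists_test_polynomial[of N "\<lambda>i. c (\<sigma> i)" "\<lambda>i. d (\<sigma> i)" Z])
      show "c (\<sigma> k) \<notin> convex hull ({-1<..<1} \<union> (\<lambda>i. c (\<sigma> i)) ` {1..<k})" if "k \<in> {1..N}" for k
        using \<sigma>(3) that .
    qed (use \<sigma>(2) Z in auto)
    let ?f = "root_poly Z * g"
    have disc: "poly ((pderiv ^^ d j) ?f) (c j) = 0" if "j \<in> {1..N}" for j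
    proof -
      from \<sigma>(1) that obtain i where "i \<in> {1..N}" "j = \<sigma> i" by (metis bij_betw_imp_surj_on imageE)
      then show ?thesis using g(4)[of i] by simp
    qed
    have "degree ?f < n"
      using less g by (simp add: degree_mult_eq degree_root_poly)
    then have 0: "integ (?f * S n) = 0"
      using S_orthogonal[of ?f n] disc by (simp add: sobolev_eq)
    obtain Z' w' where w': "Z' \<subseteq> {-1<..<1}" "g = root_poly Z' * w'" "finite Z'"
      "(\<forall>x\<in>{-1..1}. poly w' x \<ge> 0) \<or> (\<forall>x\<in>{-1..1}. poly w' x \<le> 0)"
      using sign_change_factorization[OF g(1)] by metis
    have "Z' = {}"
      using g(3) w' by (auto simp: poly_root_poly_eq_0_iff)
    then have gs: "(\<forall>x\<in>{-1..1}. poly g x \<ge> 0) \<or> (\<forall>x\<in>{-1..1}. poly g x \<le> 0)"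
      using w' by simp
    have eq: "poly (?f * S n) x = (poly (root_poly Z) x)\<^sup>2 * (poly g x * poly w x)" for x
      by (simp add: S power2_eq_square mult_ac)
    have nz: "?f * S n \<noteq> 0" using g by simp
    consider "\<forall>x\<in>{-1..1}. poly g x * poly w x \<ge> 0" | "\<forall>x\<in>{-1..1}. poly g x * poly w x \<le> 0"
      using gs w by (meson mult_nonneg_nonneg mult_nonneg_nonpos mult_nonpos_nonneg
        mult_nonpos_nonpos)
    then show False
    proof cases
      case 1
      then have "integ (?f * S n) > 0"
        using nz by (intro integ_pos) (simp_all only: eq zero_le_mult_iff[of "_\<^sup>2"], auto)
      then show ?thesis using 0 by simp
    next
      case 2
      then have "integ (smult (-1) (?f * S n)) > 0"
        using nz by (intro integ_pos) (simp_all only: poly_smult eq, auto simp: mult_nonneg_nonpos)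
      then show ?thesis using 0 by (simp only: integ_smult)
    qed
  qed
  then show ?thesis using that Z S w lc deg by blast
qed

end

section \<open>Gauss quadrature and lower bounds for orthogonal polynomials\<close>

lemma sobolev_inner_0: "sobolev_inner M 0 c d eta = l2_inner M"
  by (simp add: sobolev_inner_def l2_inner_def fun_eq_iff)

text \<open>The coefficients of \<open>(p(x) - p(z)) / (x - z)\<close>, split into real and imaginary parts.\<close>

lemma divided_difference_poly:
  obtains u v where "\<And>i. i \<ge> degree p \<Longrightarrow> coeff u i = 0" "\<And>i. i \<ge> degree p \<Longrightarrow> coeff v i = 0"
    "\<And>x. of_real (poly p x) - cpoly p z = (of_real x - z) * Complex (poly u x) (poly v x)"
proof -
  have "\<exists>u v. (\<forall>i\<ge>degree p. coeff u i = 0 \<and> coeff v i = 0) \<and>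
    (\<forall>x. of_real (poly p x) - cpoly p z = (of_real x - z) * Complex (poly u x) (poly v x))"
  proof (induction p)
    case 0
    then show ?case by (intro exI[of _ 0]) (auto simp: Complex_eq_0)
  next
    case (pCons a p)
    then obtain u v where uv: "\<And>i. i \<ge> degree p \<Longrightarrow> coeff u i = 0 \<and> coeff v i = 0"
      "\<And>x. of_real (poly p x) - cpoly p z = (of_real x - z) * Complex (poly u x) (poly v x)"
      by blast
    have "(\<forall>i\<ge>degree (pCons a p). coeff (pCons (Re (cpoly p z)) u) i =
      0 \<and> coeff (pCons (Im (cpoly p z)) v) i = 0)"
    proof (cases "p = 0")
      case True
      then have "u = 0" "v = 0" using uv(1) by (auto intro!: poly_eqI)
      then show ?thesis using True by simp
    next
      case False
      then show ?thesis using uv(1) by (auto simp: coeff_pCons split: nat.splits)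
    qed
    moreover have "of_real (poly (pCons a p) x) - cpoly (pCons a p) z = (of_real x - z) *
        Complex (poly (pCons (Re (cpoly p z)) u) x) (poly (pCons (Im (cpoly p z)) v) x)" for x
    proof -
      have "Complex (poly (pCons (Re (cpoly p z)) u) x) (poly (pCons (Im (cpoly p z)) v) x) =
          cpoly p z + of_real x * Complex (poly u x) (poly v x)"
        by (simp add: complex_eq_iff)
      moreover have "of_real (poly (pCons a p) x) - cpoly (pCons a p) z =
          of_real x * (of_real (poly p x) - cpoly p z) + (of_real x - z) * cpoly p z"
        by (simp add: cpoly_pCons algebra_simps)
      ultimately show ?thesis unfolding uv(2) by (simp add: algebra_simps)
    qed
    ultimately show ?case by blast
  qed
  then show ?thesis using that by metis
qed

context interval_measure
begin

definition P :: "nat \<Rightarrow> real poly" where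
  "P n = monic_op (l2_inner M) n"

text \<open>
  Without mass points the Sobolev inner product is that of \<open>L\<^sup>2(\<mu>)\<close>, so that \<open>P\<^sub>n\<close> inherits the
  results on \<open>S\<^sub>n\<close>. The values \<open>2\<close>, \<open>1\<close> and \<open>0\<close> are placeholders for parameters indexed by the
  empty set.
\<close>

lemma P_sobolev: "discrete_sobolev M 0 (\<lambda>_. 2) (\<lambda>_. 1) (\<lambda>_. 0)"
    "P n = S_poly M 0 (\<lambda>_. 2) (\<lambda>_. 0) (\<lambda>_. 1) n"
    "discrete_sobolev.sobolev M 0 (\<lambda>_. 2) (\<lambda>_. 1) (\<lambda>_. 0) p q = integ (p * q)"
proof -
  show *: "discrete_sobolev M 0 (\<lambda>_. 2) (\<lambda>_. 1) (\<lambda>_. 0)"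
    by unfold_locales (auto simp: sequentially_ordered_def bij_betw_def)
  show "P n = S_poly M 0 (\<lambda>_. 2) (\<lambda>_. 0) (\<lambda>_. 1) n"
    by (simp add: P_def S_poly_def sobolev_inner_0)
  show "discrete_sobolev.sobolev M 0 (\<lambda>_. 2) (\<lambda>_. 1) (\<lambda>_. 0) p q = integ (p * q)"
    by (simp add: discrete_sobolev.sobolev_eq[OF *])
qed

lemma degree_P [simp]: "degree (P n) = n"
  and coeff_P [simp]: "coeff (P n) n = 1"
  and P_nonzero [simp]: "P n \<noteq> 0"
  unfolding P_sobolev(2) using discrete_sobolev.degree_S discrete_sobolev.coeff_S
    discrete_sobolev.S_nonzero P_sobolev(1) by blast+

lemma P_orthogonal: "degree q < n \<Longrightarrow> integ (q * P n) = 0"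
  using discrete_sobolev.S_orthogonal[OF P_sobolev(1)] by (simp add: P_sobolev(2,3))

lemma P_eq_root_poly:
  obtains Y where "finite Y" "Y \<subseteq> {-1<..<1}" "card Y = n" "P n = root_poly Y"
proof -
  obtain Y w where Y: "finite Y" "Y \<subseteq> {-1<..<1}" "P n = root_poly Y * w"
    "n \<le> card Y + 0" "lead_coeff w = 1" "card Y + degree w = n"
    using discrete_sobolev.S_sign_changes[OF P_sobolev(1), of n] unfolding P_sobolev(2) by metis
  then have "degree w = 0" "card Y = n" by auto
  then obtain a where "w = [:a:]" by (metis degree_eq_zeroE)
  with Y(5) have "w = 1" by (simp add: one_pCons)
  with Y \<open>card Y = n\<close> show ?thesis using that by simp
qed

lemma gauss_quadrature:
  assumes Y: "finite Y" "card Y = n" "P n = root_poly Y"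
  obtains wt where "\<And>y. y \<in> Y \<Longrightarrow> wt y > 0"
    "\<And>f. degree f < 2 * n \<Longrightarrow> integ f = (\<Sum>y\<in>Y. wt y * poly f y)"
proof
  let ?wt = "\<lambda>y. integ (lagrange_basis Y y)"
  show quad: "integ f = (\<Sum>y\<in>Y. ?wt y * poly f y)" if f: "degree f < 2 * n" for f
  proof -
    let ?q = "f div P n" and ?r = "f mod P n"
    have n: "n > 0" using f by linarith
    have dr: "degree ?r < n"
      using degree_mod_less'[of "P n" f] n by (cases "?r = 0") auto
    have "degree ?q < n"
    proof (cases "?q = 0")
      case False
      have "degree ?q + n = degree (?q * P n)" using False by (simp add: degree_mult_eq)
      also have "?q * P n = f - ?r" by (simp add: minus_mod_eq_div_mult)
      also have "degree (f - ?r) < 2 * n" using f dr by (intro degree_diff_less) auto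
      finally show ?thesis by simp
    qed (use n in simp)
    then have "integ (?q * P n) = 0" by (rule P_orthogonal)
    moreover have "f = ?q * P n + ?r" by (rule div_mult_mod_eq[symmetric])
    ultimately have "integ f = integ ?r" by (metis integ_add add_0)
    also have "?r = (\<Sum>y\<in>Y. smult (poly ?r y) (lagrange_basis Y y))"
      using Y dr by (intro lagrange_interpolation) (auto intro: coeff_eq_0)
    also have "integ \<dots> = (\<Sum>y\<in>Y. poly ?r y * ?wt y)"
      by (simp add: integ_sum integ_smult)
    also have "\<dots> = (\<Sum>y\<in>Y. ?wt y * poly f y)"
    proof (intro sum.cong refl)
      fix y assume "y \<in> Y"
      then have "poly (P n) y = 0" using Y by (simp add: poly_root_poly_eq_0_iff)
      moreover have "poly f y = poly ?q y * poly (P n) y + poly ?r y"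
        by (metis div_mult_mod_eq poly_add poly_mult)
      ultimately show "poly ?r y * ?wt y = ?wt y * poly f y" by simp
    qed
    finally show ?thesis .
  qed
  show "?wt y > 0" if y: "y \<in> Y" for y
  proof -
    let ?l = "lagrange_basis Y y"
    have n: "n > 0" using y Y card_gt_0_iff by blast
    have "degree (?l * ?l) \<le> card (Y - {y}) + card (Y - {y})"
      using degree_mult_le[of ?l ?l] degree_lagrange_basis[of Y y] by linarith
    also have "\<dots> < 2 * n" using y Y n by (simp add: card_Diff_singleton)
    finally have "integ (?l * ?l) = (\<Sum>x\<in>Y. ?wt x * poly (?l * ?l) x)" by (rule quad)
    also have "\<dots> = (\<Sum>x\<in>Y. if x = y then ?wt x else 0)"
      using y Y by (intro sum.cong) (auto simp: poly_lagrange_basis)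
    also have "\<dots> = ?wt y" using y Y by simp
    finally have "integ (?l * ?l) = ?wt y" .
    moreover have "?l \<noteq> 0" using poly_lagrange_basis[OF Y(1) y y] by auto
    ultimately show ?thesis using integ_square_pos by metis
  qed
qed

text \<open>
  Let \<open>h(x) = (P\<^sub>n(x) - P\<^sub>n(z)) / (x - z)\<close>. At the Gauss nodes \<open>\<bar>h\<bar>\<close> equals
  \<open>\<bar>P\<^sub>n(z)\<bar> / \<bar>y - z\<bar>\<close>, so the quadrature formula, exact for \<open>\<bar>h\<bar>\<^sup>2\<close>, bounds the norm of
  \<open>h\<close> by a multiple of \<open>\<bar>P\<^sub>n(z)\<bar>\<close>; and \<open>P\<^sub>n(x) = P\<^sub>n(z) + (x - z) h(x)\<close>.
\<close>

lemma P_norm_le_value: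
  assumes \<delta>: "\<delta> > 0" and z: "\<And>x. x \<in> {-1..1} \<Longrightarrow> cmod (z - of_real x) \<ge> \<delta>"
  shows "(l2_norm (P n))\<^sup>2 \<le> 2 * integ 1 * (1 + ((1 + cmod z) / \<delta>)\<^sup>2) * (cmod (cpoly (P n) z))\<^sup>2"
proof -
  let ?p = "cmod (cpoly (P n) z)"
  obtain u v where uv: "\<And>i. i \<ge> n \<Longrightarrow> coeff u i = 0" "\<And>i. i \<ge> n \<Longrightarrow> coeff v i = 0"
    "\<And>x. of_real (poly (P n) x) - cpoly (P n) z = (of_real x - z) * Complex (poly u x) (poly v x)"
    using divided_difference_poly[of "P n" z] by auto
  let ?h = "u * u + v * v"
  have h: "poly ?h x = (cmod (Complex (poly u x) (poly v x)))\<^sup>2" for x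
    by (simp add: cmod_def power2_eq_square)
  obtain Y where Y: "finite Y" "Y \<subseteq> {-1<..<1}" "card Y = n" "P n = root_poly Y"
    using P_eq_root_poly by blast
  obtain wt where wt: "\<And>y. y \<in> Y \<Longrightarrow> wt y > 0"
    "\<And>f. degree f < 2 * n \<Longrightarrow> integ f = (\<Sum>y\<in>Y. wt y * poly f y)"
    using gauss_quadrature[OF Y(1,3,4)] by metis
  have mh: "integ ?h \<le> integ 1 * (?p / \<delta>)\<^sup>2"
  proof (cases "n = 0")
    case True
    then have "u = 0" "v = 0" using uv by (auto intro!: poly_eqI)
    then show ?thesis using integ_nonneg[of 1] by simp
  next
    case False
    have du: "degree u < n" "degree v < n"
      using uv(1,2) False by (metis leading_coeff_0_iff degree_0 not_le gr0I)+
    have "degree ?h < 2 * n"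
      using degree_add_le_max[of "u * u" "v * v"] degree_mult_le[of u u] degree_mult_le[of v v] du
      by linarith
    then have "integ ?h = (\<Sum>y\<in>Y. wt y * poly ?h y)" by (rule wt(2))
    also have "\<dots> \<le> (\<Sum>y\<in>Y. wt y * (?p / \<delta>)\<^sup>2)"
    proof (intro sum_mono mult_left_mono)
      fix y assume y: "y \<in> Y"
      then have yi: "y \<in> {-1..1}" using Y(2) by force
      have "poly (P n) y = 0" using y Y by (simp add: poly_root_poly_eq_0_iff)
      then have "?p = cmod (of_real y - z) * cmod (Complex (poly u y) (poly v y))"
        using uv(3)[of y] by (metis norm_minus_cancel norm_mult diff_0 of_real_0)
      moreover have "cmod (of_real y - z) \<ge> \<delta>" using z[OF yi] by (simp add: norm_minus_commute)
      ultimately have "\<delta> * cmod (Complex (poly u y) (poly v y)) \<le> ?p"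
        by (simp add: mult_right_mono)
      then have "cmod (Complex (poly u y) (poly v y)) \<le> ?p / \<delta>"
        using \<delta> by (simp add: field_simps)
      then show "poly ?h y \<le> (?p / \<delta>)\<^sup>2" unfolding h by (rule power_mono) simp
    qed (use wt(1) in \<open>auto intro: less_imp_le\<close>)
    also have "\<dots> = integ 1 * (?p / \<delta>)\<^sup>2"
      using wt(2)[of 1] False by (simp add: sum_distrib_right)
    finally show ?thesis .
  qed
  have "integ (P n * P n) \<le> integ (smult (2 * ?p\<^sup>2) 1 + smult (2 * (1 + cmod z)\<^sup>2) ?h)"
  proof (rule integ_mono)
    fix x :: real assume x: "x \<in> {-1..1}"
    let ?c = "Complex (poly u x) (poly v x)"
    have "of_real (poly (P n) x) = cpoly (P n) z + (of_real x - z) * ?c"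
      using uv(3)[of x] by (simp add: algebra_simps)
    then have "\<bar>poly (P n) x\<bar> \<le> ?p + cmod (of_real x - z) * cmod ?c"
      by (metis norm_of_real norm_mult norm_triangle_ineq)
    also have "\<dots> \<le> ?p + (1 + cmod z) * cmod ?c"
    proof -
      have "cmod (of_real x - z) \<le> \<bar>x\<bar> + cmod z" by (metis norm_of_real norm_triangle_ineq4)
      then show ?thesis using x by (intro add_left_mono mult_right_mono) auto
    qed
    finally have "\<bar>poly (P n) x\<bar>\<^sup>2 \<le> (?p + (1 + cmod z) * cmod ?c)\<^sup>2"
      by (rule power_mono) simp
    also have "\<dots> \<le> 2 * ?p\<^sup>2 + 2 * ((1 + cmod z) * cmod ?c)\<^sup>2"
      using sum_squares_bound[of ?p "(1 + cmod z) * cmod ?c"] by (simp add: power2_sum)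
    finally have "(poly (P n) x)\<^sup>2 \<le> 2 * ?p\<^sup>2 + 2 * (1 + cmod z)\<^sup>2 * poly ?h x"
      unfolding h by (simp add: power_mult_distrib)
    then show "poly (P n * P n) x \<le> poly (smult (2 * ?p\<^sup>2) 1 + smult (2 * (1 + cmod z)\<^sup>2) ?h) x"
      by (simp add: power2_eq_square algebra_simps)
  qed
  also have "\<dots> = 2 * ?p\<^sup>2 * integ 1 + 2 * (1 + cmod z)\<^sup>2 * integ ?h"
    by (simp only: integ_add integ_smult)
  also have "\<dots> \<le> 2 * ?p\<^sup>2 * integ 1 + 2 * (1 + cmod z)\<^sup>2 * (integ 1 * (?p / \<delta>)\<^sup>2)"
    using mh by (intro add_left_mono mult_left_mono) auto
  also have "\<dots> = 2 * integ 1 * (1 + ((1 + cmod z) / \<delta>)\<^sup>2) * ?p\<^sup>2"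
    by (simp add: power_divide field_simps)
  finally show ?thesis by (simp add: l2_norm_square)
qed

lemma P_norm_le_value_uniform:
  assumes "\<delta> > 0"
  obtains C where "C > 0"
    "\<And>n z. (\<And>x. x \<in> {-1..1} \<Longrightarrow> cmod (z - of_real x) \<ge> \<delta>) \<Longrightarrow> cmod z \<le> R \<Longrightarrow>
      l2_norm (P n) \<le> C * cmod (cpoly (P n) z)"
proof
  let ?B = "2 * integ 1 * (1 + ((1 + \<bar>R\<bar>) / \<delta>)\<^sup>2)"
  have m1: "integ 1 > 0" by (rule integ_pos) auto
  have B: "?B > 0" by (intro mult_pos_pos m1 add_pos_nonneg) auto
  then show "sqrt ?B > 0" by (rule real_sqrt_gt_zero)
  fix n z assume z: "\<And>x. x \<in> {-1..1} \<Longrightarrow> cmod (z - of_real x) \<ge> \<delta>" "cmod z \<le> R"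
  have "(l2_norm (P n))\<^sup>2 \<le> 2 * integ 1 * (1 + ((1 + cmod z) / \<delta>)\<^sup>2) * (cmod (cpoly (P n) z))\<^sup>2"
    using assms z(1) by (rule P_norm_le_value)
  also have "\<dots> \<le> ?B * (cmod (cpoly (P n) z))\<^sup>2"
    using m1 assms z(2)
    by (intro mult_right_mono mult_left_mono add_left_mono power_mono divide_right_mono) auto
  finally have "sqrt ((l2_norm (P n))\<^sup>2) \<le> sqrt (?B * (cmod (cpoly (P n) z))\<^sup>2)"
    by (rule real_sqrt_le_mono)
  then show "l2_norm (P n) \<le> sqrt ?B * cmod (cpoly (P n) z)"
    using l2_norm_nonneg[of "P n"] by (simp add: real_sqrt_mult)
qed

end

section \<open>Growth in terms of the conformal map\<close>

text \<open>For \<open>x = cos \<theta>\<close> the quadratic factors as \<open>(\<zeta> - e\<^sup>i\<^sup>\<theta>) (\<zeta> - e\<^sup>-\<^sup>i\<^sup>\<theta>)\<close>.\<close>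

lemma joukowski_quadratic_bound:
  assumes "x \<in> {-1..1}" "cmod \<zeta> \<le> 1"
  shows "cmod ((\<zeta>\<^sup>2 + 1) / 2 - of_real x * \<zeta>) \<ge> (1 - cmod \<zeta>)\<^sup>2 / 2"
proof -
  define e where "e = Complex x (sqrt (1 - x\<^sup>2))"
  have x: "x\<^sup>2 \<le> 1" using assms(1) by (auto simp: abs_square_le_1)
  then have e: "cmod e = 1" by (simp add: e_def cmod_def)
  have sum: "e + cnj e = of_real (2 * x)" and prod: "e * cnj e = 1"
    using e by (simp_all add: complex_add_cnj e_def complex_norm_square[symmetric])
  have "(\<zeta> - e) * (\<zeta> - cnj e) = \<zeta>\<^sup>2 - (e + cnj e) * \<zeta> + e * cnj e"
    by (simp add: power2_eq_square algebra_simps)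
  also have "\<dots> = 2 * ((\<zeta>\<^sup>2 + 1) / 2 - of_real x * \<zeta>)"
    unfolding sum prod by simp
  finally have "cmod (\<zeta> - e) * cmod (\<zeta> - cnj e) = 2 * cmod ((\<zeta>\<^sup>2 + 1) / 2 - of_real x * \<zeta>)"
    by (metis norm_mult norm_numeral)
  moreover have "1 - cmod \<zeta> \<le> cmod (\<zeta> - e)" "1 - cmod \<zeta> \<le> cmod (\<zeta> - cnj e)"
    using norm_triangle_ineq2[of e \<zeta>] norm_triangle_ineq2[of "cnj e" \<zeta>] e
    by (simp_all add: norm_minus_commute)
  then have "(1 - cmod \<zeta>) * (1 - cmod \<zeta>) \<le> cmod (\<zeta> - e) * cmod (\<zeta> - cnj e)"
    using assms(2) by (intro mult_mono) auto
  ultimately show ?thesis by (simp add: power2_eq_square)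
qed

context interval_measure
begin

text \<open>
  The polynomial \<open>\<zeta>\<^sup>n P\<^sub>n((\<zeta> + 1/\<zeta>)/2)\<close> has no zero in the unit disc, so the maximum principle for its
  reciprocal spreads the lower bound on the circle \<open>\<bar>\<zeta>\<bar> = s\<close> to the disc inside.
\<close>

lemma P_joukowski_lower_bound:
  assumes s: "0 < s" "s < 1"
  obtains C where "C > 0"
    "\<And>n \<zeta>. \<zeta> \<noteq> 0 \<Longrightarrow> cmod \<zeta> \<le> s \<Longrightarrow>
      l2_norm (P n) * s ^ n \<le> C * (cmod \<zeta> ^ n * cmod (cpoly (P n) ((\<zeta> + 1 / \<zeta>) / 2)))"
proof -
  \<comment> \<open>A lower bound for the distance between the interval and the ellipse that corresponds to
    \<open>\<bar>\<zeta>\<bar> = s\<close>.\<close>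
  define \<delta> where "\<delta> = (1 - s)\<^sup>2 / (2 * s)"
  have \<delta>: "\<delta> > 0" using s by (simp add: \<delta>_def)
  obtain C where C: "C > 0"
    "\<And>n z. (\<And>x. x \<in> {-1..1} \<Longrightarrow> cmod (z - of_real x) \<ge> \<delta>) \<Longrightarrow> cmod z \<le> s + 1 / s \<Longrightarrow>
      l2_norm (P n) \<le> C * cmod (cpoly (P n) z)"
    using P_norm_le_value_uniform[OF \<delta>, of "s + 1 / s"] by metis
  have main: "l2_norm (P n) * s ^ n \<le> C * (cmod \<xi> ^ n * cmod (cpoly (P n) ((\<xi> + 1 / \<xi>) / 2)))"
    if \<xi>: "\<xi> \<noteq> 0" "cmod \<xi> \<le> s" for n \<xi>
  proof -
    obtain Y where Y: "finite Y" "Y \<subseteq> {-1<..<1}" "card Y = n" "P n = root_poly Y"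
      using P_eq_root_poly by blast
    define G where "G \<zeta> = (\<Prod>y\<in>Y. (\<zeta>\<^sup>2 + 1) / 2 - of_real y * \<zeta>)" for \<zeta> :: complex
    have G: "\<zeta> ^ n * cpoly (P n) ((\<zeta> + 1 / \<zeta>) / 2) = G \<zeta>" if "\<zeta> \<noteq> 0" for \<zeta>
    proof -
      have "\<zeta> ^ n * cpoly (P n) ((\<zeta> + 1 / \<zeta>) / 2) = (\<Prod>y\<in>Y. \<zeta> * ((\<zeta> + 1 / \<zeta>) / 2 - of_real y))"
        by (simp add: Y(4) cpoly_root_poly prod.distrib Y(3))
      also have "\<dots> = G \<zeta>"
        unfolding G_def using that by (intro prod.cong) (auto simp: field_simps power2_eq_square)
      finally show ?thesis .
    qed
    have G0: "G \<zeta> \<noteq> 0" if "cmod \<zeta> < 1" for \<zeta>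
    proof -
      have "(\<zeta>\<^sup>2 + 1) / 2 - of_real y * \<zeta> \<noteq> 0" if y: "y \<in> Y" for y
      proof -
        have "cmod ((\<zeta>\<^sup>2 + 1) / 2 - of_real y * \<zeta>) \<ge> (1 - cmod \<zeta>)\<^sup>2 / 2"
          using Y(2) y \<open>cmod \<zeta> < 1\<close> by (intro joukowski_quadratic_bound) force+
        moreover have "(1 - cmod \<zeta>)\<^sup>2 / 2 > 0" using \<open>cmod \<zeta> < 1\<close> by simp
        ultimately show ?thesis by (metis norm_zero not_le)
      qed
      then show ?thesis using Y(1) by (simp add: G_def)
    qed
    have circle: "l2_norm (P n) * s ^ n \<le> C * cmod (G \<zeta>)" if "cmod \<zeta> = s" for \<zeta>
    proof -
      have \<zeta>0: "\<zeta> \<noteq> 0" using that s by auto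
      have "l2_norm (P n) \<le> C * cmod (cpoly (P n) ((\<zeta> + 1 / \<zeta>) / 2))"
      proof (rule C(2))
        fix x :: real assume x: "x \<in> {-1..1}"
        have "\<zeta> * ((\<zeta> + 1 / \<zeta>) / 2 - of_real x) = (\<zeta>\<^sup>2 + 1) / 2 - of_real x * \<zeta>"
          using \<zeta>0 by (simp add: field_simps power2_eq_square)
        then have "s * cmod ((\<zeta> + 1 / \<zeta>) / 2 - of_real x) = cmod ((\<zeta>\<^sup>2 + 1) / 2 - of_real x * \<zeta>)"
          using that by (metis norm_mult)
        also have "\<dots> \<ge> (1 - s)\<^sup>2 / 2"
          using joukowski_quadratic_bound[OF x, of \<zeta>] that s by simp
        finally show "\<delta> \<le> cmod ((\<zeta> + 1 / \<zeta>) / 2 - of_real x)"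
          using s by (simp add: \<delta>_def field_simps)
      next
        have "cmod ((\<zeta> + 1 / \<zeta>) / 2) \<le> (s + 1 / s) / 2"
          using norm_triangle_ineq[of \<zeta> "1 / \<zeta>"] that by (simp add: norm_divide)
        also have "\<dots> \<le> s + 1 / s" using divide_right_mono[of 0 "s + 1 / s" 2] s
          by (simp add: field_simps)
        finally show "cmod ((\<zeta> + 1 / \<zeta>) / 2) \<le> s + 1 / s" .
      qed
      from mult_right_mono[OF this, of "s ^ n"]
      have "l2_norm (P n) * s ^ n \<le> C * (s ^ n * cmod (cpoly (P n) ((\<zeta> + 1 / \<zeta>) / 2)))"
        using s by (simp add: mult_ac)
      also have "s ^ n * cmod (cpoly (P n) ((\<zeta> + 1 / \<zeta>) / 2)) = cmod (G \<zeta>)"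
        unfolding G[OF \<zeta>0, symmetric] by (simp add: norm_mult norm_power that)
      finally show ?thesis .
    qed
    have lpos: "l2_norm (P n) * s ^ n > 0" using l2_norm_pos[OF P_nonzero[of n]] s by simp
    have "cmod (inverse (G \<xi>)) \<le> C / (l2_norm (P n) * s ^ n)"
    proof (rule maximum_modulus_frontier[where S = "cball 0 s" and f = "\<lambda>\<zeta>. inverse (G \<zeta>)"])
      have hol: "(\<lambda>\<zeta>. inverse (G \<zeta>)) holomorphic_on ball 0 1"
        using G0 unfolding G_def by (intro holomorphic_intros) (auto simp: G_def)
      show "(\<lambda>\<zeta>. inverse (G \<zeta>)) holomorphic_on interior (cball 0 s)"
        by (rule holomorphic_on_subset[OF hol]) (use s in auto)
      show "continuous_on (closure (cball 0 s)) (\<lambda>\<zeta>. inverse (G \<zeta>))"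
        by (rule holomorphic_on_imp_continuous_on, rule holomorphic_on_subset[OF hol]) (use s in auto)
      show "bounded (cball (0 :: complex) s)" by simp
      show "\<xi> \<in> cball 0 s" using \<xi> by simp
      fix \<zeta> :: complex assume "\<zeta> \<in> frontier (cball 0 s)"
      then have \<zeta>: "cmod \<zeta> = s" using s by (simp add: frontier_cball)
      then have "cmod (G \<zeta>) > 0" using G0 s by simp
      then have "inverse (cmod (G \<zeta>)) \<le> C / (l2_norm (P n) * s ^ n)"
        using circle[OF \<zeta>] lpos by (simp add: field_simps)
      then show "cmod (inverse (G \<zeta>)) \<le> C / (l2_norm (P n) * s ^ n)"
        unfolding norm_inverse .
    qed
    moreover have "cmod (G \<xi>) > 0" using G0 \<xi> s by simp
    ultimately have "l2_norm (P n) * s ^ n \<le> C * cmod (G \<xi>)"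
      using lpos unfolding norm_inverse by (simp add: field_simps)
    then show ?thesis
      unfolding G[OF \<xi>(1), symmetric] by (simp add: norm_mult norm_power)
  qed
  show ?thesis by (rule that[OF C(1) main])
qed

text \<open>
  The recurrence gives \<open>\<parallel>P\<^sub>n\<^sub>+\<^sub>1\<parallel> = a\<^sub>n\<^sub>+\<^sub>1 \<parallel>P\<^sub>n\<parallel>\<close>, and \<open>a\<^sub>n \<rightarrow> 1/2\<close>; hence norms with
  indices that differ by a bounded amount are comparable.
\<close>

lemma nevai_norm_ratio:
  assumes "nevai_class M"
  obtains n0 where "\<And>n k. n \<ge> n0 \<Longrightarrow> l2_norm (P n) \<le> 4 ^ k * l2_norm (P (n + k))"
proof -
  obtain a b :: "nat \<Rightarrow> real" where ab: "\<And>n. P (Suc n) = [:- b n, 1:] * P n -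
      smult ((a n)\<^sup>2) (if n = 0 then 0 else P (n - 1))" "a \<longlonglongrightarrow> 1 / 2"
    using assms unfolding nevai_class_def P_def by blast
  have ratio: "(l2_norm (P (Suc n)))\<^sup>2 = (a (Suc n))\<^sup>2 * (l2_norm (P n))\<^sup>2" for n
  proof -
    have rec: "P (Suc (Suc n)) = [:- b (Suc n), 1:] * P (Suc n) - smult ((a (Suc n))\<^sup>2) (P n)"
      using ab(1)[of "Suc n"] by simp
    have "integ (P n * P (Suc (Suc n))) = 0" by (rule P_orthogonal) simp
    then have 1: "integ (([:- b (Suc n), 1:] * P n) * P (Suc n)) = (a (Suc n))\<^sup>2 * integ (P n * P n)"
    proof -
      have "P n * P (Suc (Suc n)) =
          ([:- b (Suc n), 1:] * P n) * P (Suc n) - smult ((a (Suc n))\<^sup>2) (P n * P n)"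
        unfolding rec right_diff_distrib mult_smult_right by (simp only: mult.left_commute mult.assoc)
      with \<open>integ (P n * P (Suc (Suc n))) = 0\<close> show ?thesis
        by (simp only: integ_diff integ_smult)
    qed
    define g where "g = [:- b (Suc n), 1:] * P n - P (Suc n)"
    have "degree g < Suc n"
    proof -
      have "coeff g (Suc n) = 0"
        by (simp add: g_def coeff_eq_0)
      moreover have "degree g \<le> Suc n"
        unfolding g_def by (rule degree_diff_le)
          (auto intro: order.trans[OF degree_mult_le] simp del: mult_pCons_left)
      ultimately show ?thesis
        by (metis degree_0 leading_coeff_0_iff le_neq_implies_less zero_less_Suc)
    qed
    then have "integ (g * P (Suc n)) = 0" by (rule P_orthogonal)
    then have "integ (([:- b (Suc n), 1:] * P n) * P (Suc n)) = integ (P (Suc n) * P (Suc n))"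
      unfolding g_def left_diff_distrib integ_diff by simp
    with 1 show ?thesis by (simp add: l2_norm_square)
  qed
  have "eventually (\<lambda>n. a n > 1 / 4) sequentially"
    using order_tendstoD(1)[OF ab(2), of "1 / 4"] by simp
  then obtain n0 where n0: "\<And>n. n \<ge> n0 \<Longrightarrow> a n > 1 / 4"
    by (auto simp: eventually_sequentially)
  have step: "l2_norm (P n) \<le> 4 * l2_norm (P (Suc n))" if "n \<ge> n0" for n
  proof -
    have "(1 / 4)\<^sup>2 \<le> (a (Suc n))\<^sup>2" using n0[of "Suc n"] that by (intro power_mono) auto
    then have "(1 / 4)\<^sup>2 * (l2_norm (P n))\<^sup>2 \<le> (l2_norm (P (Suc n)))\<^sup>2"
      unfolding ratio by (intro mult_right_mono) auto
    then have "(l2_norm (P n))\<^sup>2 \<le> (4 * l2_norm (P (Suc n)))\<^sup>2"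
      by (simp add: power_mult_distrib power_divide)
    then show ?thesis by (rule power2_le_imp_le) (simp add: l2_norm_nonneg)
  qed
  have "l2_norm (P n) \<le> 4 ^ k * l2_norm (P (n + k))" if "n \<ge> n0" for n k
  proof (induction k)
    case (Suc k)
    have "4 ^ k * l2_norm (P (n + k)) \<le> 4 ^ k * (4 * l2_norm (P (Suc (n + k))))"
      by (rule mult_left_mono[OF step]) (use that in auto)
    with Suc.IH show ?case by (simp only: add_Suc_right power_Suc mult.assoc mult.left_commute)
  qed simp
  then show ?thesis using that by blast
qed

end

section \<open>Comparing Sobolev and standard orthogonal polynomials\<close>

lemma poly_bounded_on_interval:
  fixes p :: "real poly"
  obtains B where "B > 0" "\<And>x. x \<in> {-1..1} \<Longrightarrow> \<bar>poly p x\<bar> \<le> B"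
proof -
  have "bounded (poly p ` {-1..1})"
    by (intro compact_imp_bounded compact_continuous_image continuous_intros) auto
  then obtain B where "B > 0" "\<forall>y \<in> poly p ` {-1..1}. norm y \<le> B"
    using bounded_pos by metis
  then show ?thesis using that by auto
qed

lemma root_poly_signed_nonneg:
  assumes "\<And>t. t \<in> A \<Longrightarrow> x \<le> t"
  shows "(-1) ^ card A * poly (root_poly A) x \<ge> 0"
proof -
  have "(-1) ^ card A * poly (root_poly A) x = (\<Prod>t\<in>A. t - x)"
    by (simp add: poly_root_poly prod_uminus[symmetric])
  also have "\<dots> \<ge> 0" using assms by (intro prod_nonneg) auto
  finally show ?thesis .
qed

lemma root_poly_nonneg: "(\<And>t. t \<in> A \<Longrightarrow> t \<le> x) \<Longrightarrow> poly (root_poly A) x \<ge> 0"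
  unfolding poly_root_poly by (intro prod_nonneg) auto

context interval_measure
begin

lemma abs_integ_mult_le:
  assumes "p \<noteq> 0" "q \<noteq> 0"
  shows "\<bar>integ (p * q)\<bar> \<le> l2_norm p * l2_norm q"
proof -
  have "integ (p * q) \<le> (LINT x:{-1..1}|M. \<bar>poly p x * poly q x\<bar>)"
    unfolding integ_def by (intro set_integral_mono_continuous continuous_intros) auto
  moreover have "integ (smult (-1) (p * q)) \<le> (LINT x:{-1..1}|M. \<bar>poly p x * poly q x\<bar>)"
    unfolding integ_def by (intro set_integral_mono_continuous continuous_intros) auto
  ultimately show ?thesis
    using set_integral_abs_mult_le[OF assms] unfolding integ_smult by simp
qed

lemma l2_norm_mult_le:
  assumes "\<And>x. x \<in> {-1..1} \<Longrightarrow> \<bar>poly p x\<bar> \<le> B"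
  shows "l2_norm (p * q) \<le> B * l2_norm q"
proof -
  have "\<bar>poly p 0\<bar> \<le> B" by (rule assms) simp
  then have B: "B \<ge> 0" by simp
  have "integ ((p * q) * (p * q)) \<le> integ (smult (B\<^sup>2) (q * q))"
  proof (rule integ_mono)
    fix x :: real assume "x \<in> {-1..1}"
    then have "(\<bar>poly p x\<bar> * \<bar>poly q x\<bar>)\<^sup>2 \<le> (B * \<bar>poly q x\<bar>)\<^sup>2"
      using assms by (intro power_mono mult_right_mono) auto
    then show "poly ((p * q) * (p * q)) x \<le> poly (smult (B\<^sup>2) (q * q)) x"
      by (simp add: power2_eq_square mult_ac)
  qed
  then have "(l2_norm (p * q))\<^sup>2 \<le> (B * l2_norm q)\<^sup>2"
    unfolding integ_smult by (simp add: l2_norm_square power_mult_distrib)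
  then show ?thesis by (rule power2_le_imp_le) (simp add: B l2_norm_nonneg)
qed

end

locale nevai_sobolev = discrete_sobolev +
  assumes nevai: "nevai_class M"
begin

definition D :: nat where
  "D = (\<Sum>j=1..N. d j + 1)"

text \<open>Signs are chosen such that the factors are positive on the interval.\<close>

definition mass_factor :: "nat \<Rightarrow> real poly" where
  "mass_factor j = (if c j < -1 then [:- c j, 1:] else [:c j, -1:])"

definition rho_poly :: "real poly" where
  "rho_poly = (\<Prod>j=1..N. mass_factor j ^ (d j + 1))"

lemma c_cases: "j \<in> {1..N} \<Longrightarrow> c j < -1 \<or> c j > 1"
  using c[of j] by auto

lemma N_le_D: "N \<le> D"
  unfolding D_def using sum_mono[of "{1..N}" "\<lambda>_. 1" "\<lambda>j. d j + 1"] by simp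

lemma poly_rho_poly: "poly rho_poly x = rho N c d x"
proof -
  have "{1..N} = {j\<in>{1..N}. c j < -1} \<union> {j\<in>{1..N}. c j > 1}"
    using c_cases by blast
  note split = this
  have "poly rho_poly x = (\<Prod>j\<in>{1..N}. poly (mass_factor j) x ^ (d j + 1))"
    by (simp add: rho_poly_def poly_prod poly_power)
  also have "\<dots> = (\<Prod>j\<in>{j\<in>{1..N}. c j < -1} \<union> {j\<in>{1..N}. c j > 1}. poly (mass_factor j) x ^ (d j + 1))"
    by (rule prod.cong[OF split refl])
  also have "\<dots> = (\<Prod>j\<in>{j\<in>{1..N}. c j < -1}. poly (mass_factor j) x ^ (d j + 1)) *
      (\<Prod>j\<in>{j\<in>{1..N}. c j > 1}. poly (mass_factor j) x ^ (d j + 1))"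
    by (rule prod.union_disjoint) auto
  also have "\<dots> = rho N c d x"
    unfolding rho_def by (intro arg_cong2[of _ _ _ _ "(*)"] prod.cong) (auto simp: mass_factor_def)
  finally show ?thesis .
qed

lemma rho_pos:
  assumes "x \<in> {-1..1}"
  shows "rho N c d x > 0"
  unfolding rho_def using assms by (intro mult_pos_pos prod_pos zero_less_power ballI) auto

lemma mass_factor_nonzero [simp]: "mass_factor j \<noteq> 0"
  by (simp add: mass_factor_def)

lemma rho_poly_nonzero [simp]: "rho_poly \<noteq> 0"
  by (simp add: rho_poly_def)

lemma degree_rho_poly: "degree rho_poly = D"
proof -
  have "degree (mass_factor j ^ (d j + 1)) = d j + 1" for j
    by (subst degree_power_eq) (auto simp: mass_factor_def)
  then show ?thesis
    unfolding rho_poly_def D_def by (subst degree_prod_eq_sum_degree) auto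
qed

lemma lead_coeff_rho_poly: "lead_coeff rho_poly \<noteq> 0" "\<bar>lead_coeff rho_poly\<bar> = 1"
proof -
  have "\<bar>lead_coeff (mass_factor j)\<bar> = 1" for j by (simp add: mass_factor_def)
  then have "\<bar>lead_coeff (mass_factor j ^ n)\<bar> = 1" for j n by (simp add: lead_coeff_power power_abs)
  then show "\<bar>lead_coeff rho_poly\<bar> = 1"
    unfolding rho_poly_def lead_coeff_prod abs_prod by (intro prod.neutral) blast
qed simp

lemma linear_power_dvd_rho_poly:
  assumes "j \<in> {1..N}"
  shows "[:- c j, 1:] ^ Suc (d j) dvd rho_poly"
proof -
  have "[:- c j, 1:] dvd mass_factor j"
    by (auto simp: mass_factor_def poly_eq_0_iff_dvd[symmetric])
  then have "[:- c j, 1:] ^ Suc (d j) dvd mass_factor j ^ (d j + 1)"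
    by (metis Suc_eq_plus1 dvd_power_same)
  also have "\<dots> dvd rho_poly" unfolding rho_poly_def using assms by (intro dvd_prodI) auto
  finally show ?thesis .
qed

lemma discrete_part_vanishes:
  "j \<in> {1..N} \<Longrightarrow> poly ((pderiv ^^ d j) (rho_poly * p)) (c j) = 0"
  using linear_power_dvd_rho_poly by (intro poly_higher_pderiv_eq_0) (rule dvd_mult2)

lemma S_quasi_orthogonal:
  assumes "degree p + D < n"
  shows "integ (rho_poly * p * S n) = 0"
proof -
  have "degree (rho_poly * p) < n"
    using degree_mult_le[of rho_poly p] assms by (simp add: degree_rho_poly)
  then have "sobolev (rho_poly * p) (S n) = 0" by (rule S_orthogonal)
  then show ?thesis by (simp add: sobolev_eq discrete_part_vanishes)
qed

text \<open>Extremality of \<open>S\<^sub>n\<close>, tested against the product of \<open>\<rho>\<close> with \<open>P\<^sub>n\<^sub>-\<^sub>D\<close>.\<close>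

lemma S_norm_le:
  obtains C n0 where "C > 0" "\<And>n. n \<ge> n0 \<Longrightarrow> l2_norm (S n) \<le> C * l2_norm (P n)"
proof -
  obtain B where B: "B > 0" "\<And>x. x \<in> {-1..1} \<Longrightarrow> \<bar>poly rho_poly x\<bar> \<le> B"
    using poly_bounded_on_interval[of rho_poly] by metis
  obtain n0 where n0: "\<And>n k. n \<ge> n0 \<Longrightarrow> l2_norm (P n) \<le> 4 ^ k * l2_norm (P (n + k))"
    using nevai_norm_ratio[OF nevai] by metis
  have "l2_norm (S n) \<le> (B * 4 ^ D) * l2_norm (P n)" if n: "n \<ge> n0 + D" for n
  proof -
    define f where "f = smult (1 / lead_coeff rho_poly) (rho_poly * P (n - D))"
    have deg: "degree (rho_poly * P (n - D)) = n"
      using n by (simp add: degree_mult_eq degree_rho_poly)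
    have "degree f = n" "lead_coeff f = 1"
    proof -
      show df: "degree f = n" using lead_coeff_rho_poly(1) by (simp add: f_def deg)
      have "lead_coeff f = 1 / lead_coeff rho_poly * (lead_coeff rho_poly * lead_coeff (P (n - D)))"
        unfolding f_def lead_coeff_smult lead_coeff_mult ..
      then show "lead_coeff f = 1" using lead_coeff_rho_poly(1) by simp
    qed
    then have "sobolev (S n) (S n) \<le> sobolev f f" unfolding S_eq_monic_orth
      by (rule sobolev.monic_orth_minimal)
    moreover have "integ (S n * S n) \<le> sobolev (S n) (S n)"
      unfolding sobolev_eq using eta by (auto intro!: sum_nonneg simp: mult.assoc less_imp_le)
    moreover have "sobolev f f = integ (f * f)"
      using discrete_part_vanishes[of _ "P (n - D)"]
      by (simp add: sobolev_eq f_def higher_pderiv_smult)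
    ultimately have "(l2_norm (S n))\<^sup>2 \<le> (l2_norm f)\<^sup>2" by (simp add: l2_norm_square)
    then have "l2_norm (S n) \<le> l2_norm f" using l2_norm_nonneg by (rule power2_le_imp_le)
    also have "f = smult (1 / lead_coeff rho_poly) rho_poly * P (n - D)" by (simp add: f_def)
    also have "l2_norm \<dots> \<le> B * l2_norm (P (n - D))"
      using B(2) lead_coeff_rho_poly(2) by (intro l2_norm_mult_le) (simp add: abs_mult)
    also have "\<dots> \<le> B * (4 ^ D * l2_norm (P n))"
      using n0[of "n - D" D] n B(1) by (intro mult_left_mono) auto
    finally show ?thesis by simp
  qed
  moreover have "B * 4 ^ D > 0" using B(1) by simp
  ultimately show ?thesis using that by blast
qed

text \<open>
  The form of \<open>S\<^sub>n\<close> provided by the sign changes. The cofactor \<open>w\<close> has degree at most \<open>N\<close>; its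
  zeros will turn out to approach the mass points.
\<close>

definition S_splits :: "nat \<Rightarrow> real set \<Rightarrow> real poly \<Rightarrow> bool" where
  "S_splits n Z w \<longleftrightarrow> finite Z \<and> Z \<subseteq> {-1<..<1} \<and> S n = root_poly Z * w \<and>
     ((\<forall>x\<in>{-1..1}. poly w x \<ge> 0) \<or> (\<forall>x\<in>{-1..1}. poly w x \<le> 0)) \<and>
     n \<le> card Z + N \<and> lead_coeff w = 1 \<and> card Z + degree w = n"

lemma S_splits_exists: "\<exists>Z w. S_splits n Z w"
  unfolding S_splits_def using S_sign_changes[of n] by metis

lemma S_splits_degree: "S_splits n Z w \<Longrightarrow> degree w \<le> N"
  by (auto simp: S_splits_def)

text \<open>
  Quasi-orthogonality in terms of the Gauss rule says that \<open>\<Sum>\<^sub>y \<lambda>\<^sub>y \<rho>(y) p(y) S\<^sub>n(y) = 0\<close> for all \<open>p\<close>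
  of degree below \<open>n - D\<close>. If \<open>A\<close> contained more than \<open>card B + D\<close> nodes, some such \<open>p\<close> would vanish
  at the nodes outside \<open>A\<close> and follow the sign of \<open>S\<^sub>n\<close> on \<open>A\<close>. Nor can \<open>S\<^sub>n\<close> vanish on all of \<open>A\<close>,
  because the cofactor has at most \<open>N \<le> D\<close> zeros.
\<close>

lemma gauss_nodes_vs_zeros:
  assumes Y: "finite Y" "Y \<subseteq> {-1<..<1}" "card Y = n" "P n = root_poly Y"
    and split: "S_splits n Z w"
    and A: "A \<subseteq> Y" and B: "B \<subseteq> Z" and AB: "A \<inter> Z \<subseteq> B"
    and sign: "\<sigma> \<noteq> 0" "\<And>y. y \<in> A \<Longrightarrow> \<sigma> * poly (root_poly (Y - A) * root_poly (Z - B)) y \<ge> 0"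
  shows "card A \<le> card B + D"
proof (rule ccontr)
  assume less: "\<not> card A \<le> card B + D"
  have Z: "finite Z" "Z \<subseteq> {-1<..<1}" and S: "S n = root_poly Z * w"
    and w: "(\<forall>x\<in>{-1..1}. poly w x \<ge> 0) \<or> (\<forall>x\<in>{-1..1}. poly w x \<le> 0)"
    and degw: "degree w \<le> N" and lcw: "lead_coeff w = 1"
    using split S_splits_degree by (auto simp: S_splits_def)
  have w0: "w \<noteq> 0" using lcw by auto
  have fin: "finite A" "finite B" "card A \<le> n"
    using A B Y Z finite_subset card_mono[OF Y(1) A] by auto
  define p where "p = root_poly (Y - A) * root_poly B"
  let ?f = "rho_poly * p * S n"
  have degp: "degree p = n - card A + card B"
    using Y(3) card_Diff_subset[OF fin(1) A] by (simp add: p_def degree_mult_eq degree_root_poly)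
  have "integ ?f = 0"
    using degp less fin(3) by (intro S_quasi_orthogonal) linarith
  moreover obtain wt where wt: "\<And>y. y \<in> Y \<Longrightarrow> wt y > 0"
    "\<And>f. degree f < 2 * n \<Longrightarrow> integ f = (\<Sum>y\<in>Y. wt y * poly f y)"
    using gauss_quadrature[OF Y(1,3,4)] by metis
  moreover have "degree ?f < 2 * n"
    using degree_mult_le[of "rho_poly * p" "S n"] degree_mult_le[of rho_poly p] degp less fin(3)
    unfolding degree_rho_poly degree_S by linarith
  ultimately have "(\<Sum>y\<in>Y. wt y * poly ?f y) = 0" by simp
  moreover have "(\<Sum>y\<in>Y. wt y * poly ?f y) = (\<Sum>y\<in>A. wt y * poly ?f y)"
  proof (rule sum.mono_neutral_right[OF Y(1) A], rule ballI)
    fix y assume "y \<in> Y - A"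
    then have "poly (root_poly (Y - A)) y = 0" using Y(1) by (simp add: poly_root_poly_eq_0_iff)
    then show "wt y * poly ?f y = 0" by (simp add: p_def)
  qed
  ultimately have sum0: "(\<Sum>y\<in>A. wt y * poly ?f y) = 0" by simp
  have eq: "poly ?f y = rho N c d y * (poly (root_poly B) y)\<^sup>2 *
      poly (root_poly (Y - A) * root_poly (Z - B)) y * poly w y" for y
  proof -
    have "root_poly Z = root_poly B * root_poly (Z - B)"
      using root_poly_union_disjoint[of B "Z - B"] Z(1) B fin by (simp add: Un_absorb1 Un_Diff_cancel)
    then show ?thesis
      by (simp add: S p_def poly_rho_poly power2_eq_square mult_ac)
  qed
  obtain \<tau> where \<tau>: "\<tau> \<noteq> 0" "\<And>x. x \<in> {-1..1} \<Longrightarrow> \<tau> * poly w x \<ge> 0"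
    using w by (metis mult_1 neg_0_le_iff_le mult_minus1 zero_neq_neg_one zero_neq_one)
  have in_int: "y \<in> {-1..1}" if "y \<in> A" for y using that A Y(2) by force
  have nonneg: "0 \<le> \<sigma> * \<tau> * (wt y * poly ?f y)" if y: "y \<in> A" for y
  proof -
    have "0 \<le> (wt y * (rho N c d y * (poly (root_poly B) y)\<^sup>2)) *
        ((\<sigma> * poly (root_poly (Y - A) * root_poly (Z - B)) y) * (\<tau> * poly w y))"
      using y A wt(1)[of y] rho_pos[OF in_int[OF y]] sign(2)[OF y] \<tau>(2)[OF in_int[OF y]]
      by (intro mult_nonneg_nonneg[of "_ * (_ * _)"] mult_nonneg_nonneg[of "_ * poly _ _"]
          mult_nonneg_nonneg[of "wt y"] mult_nonneg_nonneg[of "rho N c d y"]) (auto simp: less_imp_le)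
    also have "\<dots> = \<sigma> * \<tau> * (wt y * poly ?f y)" unfolding eq by (simp only: mult_ac)
    finally show ?thesis .
  qed
  have "(\<Sum>y\<in>A. \<sigma> * \<tau> * (wt y * poly ?f y)) = 0"
    using sum0 by (simp add: sum_distrib_left[symmetric])
  then have zero: "\<sigma> * \<tau> * (wt y * poly ?f y) = 0" if "y \<in> A" for y
    using sum_nonneg_eq_0_iff[OF fin(1), of "\<lambda>y. \<sigma> * \<tau> * (wt y * poly ?f y)"] nonneg that
    by blast
  have "A \<subseteq> B \<union> {x. poly w x = 0}"
  proof
    fix y assume y: "y \<in> A"
    have "poly ?f y = 0"
      using zero[OF y] sign(1) \<tau>(1) wt(1)[of y] A y by auto
    moreover have "poly (root_poly (Y - A)) y \<noteq> 0" using y Y(1) by (simp add: poly_root_poly_eq_0_iff)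
    moreover have "rho N c d y \<noteq> 0" using rho_pos[OF in_int[OF y]] by simp
    ultimately have "y \<in> B \<or> y \<in> Z - B \<or> poly w y = 0"
      unfolding eq using Z(1) fin(2) by (simp add: poly_root_poly_eq_0_iff)
    then show "y \<in> B \<union> {x. poly w x = 0}" using AB y by auto
  qed
  then have "card A \<le> card (B \<union> {x. poly w x = 0})"
    using fin poly_roots_finite[OF w0] by (intro card_mono) auto
  also have "\<dots> \<le> card B + card {x. poly w x = 0}" by (rule card_Un_le)
  also have "card {x. poly w x = 0} \<le> degree w" by (rule card_poly_roots_bound[OF w0])
  finally show False using less degw N_le_D by linarith
qed

text \<open>
  Applying the previous lemma to the nodes on either side of a given node yields the counting
  hypotheses of \<open>root_poly_almost_interlacing\<close>.
\<close>

lemma P_le_root_poly_factor: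
  assumes split: "S_splits n Z w"
    and \<delta>: "\<delta> > 0" and z: "\<And>x. x \<in> {-1..1} \<Longrightarrow> cmod (z - of_real x) \<ge> \<delta>"
  shows "cmod (cpoly (P n) z) \<le>
    exp (4 * real D / \<delta>) * (1 + cmod z) ^ N * cmod (cpoly (root_poly Z) z)"
proof -
  obtain Y where Y: "finite Y" "Y \<subseteq> {-1<..<1}" "card Y = n" "P n = root_poly Y"
    using P_eq_root_poly by blast
  have Z: "finite Z" "Z \<subseteq> {-1<..<1}" "card Z \<le> n" "n \<le> card Z + N"
    using split by (auto simp: S_splits_def)
  have "cmod (cpoly (root_poly Y) z) \<le>
      exp (4 * real D / \<delta>) * (1 + cmod z) ^ (card Y - card Z) * cmod (cpoly (root_poly Z) z)"
  proof (rule root_poly_almost_interlacing[OF Y(1,2) Z(1,2) _ _ _ \<delta> z])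
    show "card Z \<le> card Y" using Y Z by simp
    fix y assume y: "y \<in> Y"
    show "card {y' \<in> Y. y' \<le> y} \<le> card {t \<in> Z. t \<le> y} + D"
    proof (rule gauss_nodes_vs_zeros[OF Y split])
      let ?X = "Y - {y' \<in> Y. y' \<le> y}" and ?X' = "Z - {t \<in> Z. t \<le> y}"
      show "(-1 :: real) ^ card ?X * (-1) ^ card ?X' \<noteq> 0" by simp
      fix x assume x: "x \<in> {y' \<in> Y. y' \<le> y}"
      have "0 \<le> ((-1) ^ card ?X * poly (root_poly ?X) x) * ((-1) ^ card ?X' * poly (root_poly ?X') x)"
        using x by (intro mult_nonneg_nonneg[of "_ * _" "_ * _"] root_poly_signed_nonneg) auto
      then show "0 \<le> (-1) ^ card ?X * (-1) ^ card ?X' * poly (root_poly ?X * root_poly ?X') x"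
        by (simp only: poly_mult mult_ac)
    qed auto
    show "card {y' \<in> Y. y' \<ge> y} \<le> card {t \<in> Z. t \<ge> y} + D"
    proof (rule gauss_nodes_vs_zeros[OF Y split, where \<sigma> = 1])
      fix x assume x: "x \<in> {y' \<in> Y. y' \<ge> y}"
      then show "0 \<le> 1 * poly (root_poly (Y - {y' \<in> Y. y' \<ge> y}) * root_poly (Z - {t \<in> Z. t \<ge> y})) x"
        unfolding mult_1 poly_mult by (intro mult_nonneg_nonneg root_poly_nonneg) auto
    qed auto
  qed
  also have "\<dots> \<le> exp (4 * real D / \<delta>) * (1 + cmod z) ^ N * cmod (cpoly (root_poly Z) z)"
    using Y Z by (intro mult_right_mono mult_left_mono power_increasing) auto
  finally show ?thesis using Y(4) by simp
qed

section \<open>The mass points attract the remaining zeros\<close>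

lemma c_inj: "inj_on c {1..N}"
proof -
  obtain \<sigma> where \<sigma>: "bij_betw \<sigma> {1..N} {1..N}"
    "\<And>k. k \<in> {1..N} \<Longrightarrow> c (\<sigma> k) \<notin> convex hull ({-1<..<1} \<union> (\<lambda>i. c (\<sigma> i)) ` {1..<k})"
    using ordered unfolding sequentially_ordered_def by metis
  have "inj_on (c \<circ> \<sigma>) {1..N}"
  proof (rule linorder_inj_onI)
    fix i j assume "i < j" "i \<in> {1..N}" "j \<in> {1..N}"
    then have "c (\<sigma> i) \<in> convex hull ({-1<..<1} \<union> (\<lambda>i. c (\<sigma> i)) ` {1..<j})"
      by (intro hull_inc) auto
    then show "(c \<circ> \<sigma>) i \<noteq> (c \<circ> \<sigma>) j" using \<sigma>(2)[OF \<open>j \<in> {1..N}\<close>] by auto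
  qed auto
  then show ?thesis using \<sigma>(1) by (metis bij_betw_def inj_on_imageI)
qed

text \<open>
  Orthogonality to a polynomial of degree \<open>n - 1\<close> that sees only the mass at \<open>c\<^sub>j\<close>; its factor
  \<open>x\<^sup>n\<^sup>-\<^sup>D\<close> is bounded on the interval but large at \<open>c\<^sub>j\<close>.
\<close>

lemma S_derivative_at_mass_point:
  assumes j: "j \<in> {1..N}"
  obtains C where "C > 0"
    "\<And>n. n \<ge> D \<Longrightarrow> \<bar>poly ((pderiv ^^ d j) (S n)) (c j)\<bar> \<le> C * l2_norm (S n) / \<bar>c j\<bar> ^ (n - D)"
proof -
  define g where "g = (\<Prod>i\<in>{1..N} - {j}. [:- c i, 1:] ^ (d i + 1))"
  define h where "h = [:- c j, 1:] ^ d j * g"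
  have nz: "[:- c i, 1:] ^ (d i + 1) \<noteq> 0" for i by (rule power_not_zero) simp
  have degg: "degree g = (\<Sum>i\<in>{1..N} - {j}. d i + 1)"
  proof -
    have "degree ([:- c i, 1:] ^ (d i + 1)) = d i + 1" for i
      by (subst degree_power_eq) auto
    then show ?thesis
      unfolding g_def by (subst degree_prod_eq_sum_degree) (use nz in blast, simp only:)
  qed
  have "D = (d j + 1) + (\<Sum>i\<in>{1..N} - {j}. d i + 1)"
    unfolding D_def using j by (subst sum.remove[of _ j]) auto
  moreover have g0: "g \<noteq> 0"
    unfolding g_def using nz by (subst prod_zero_iff) blast+
  ultimately have degh: "degree h + 1 = D"
    by (simp add: h_def degree_mult_eq degree_power_eq degg)
  have h0: "h \<noteq> 0" using g0 by (simp add: h_def)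
  have gc: "poly g (c j) \<noteq> 0"
  proof -
    have "c j \<noteq> c i" if "i \<in> {1..N} - {j}" for i
      using c_inj j that unfolding inj_on_def by blast
    then have "poly ([:- c i, 1:] ^ (d i + 1)) (c j) \<noteq> 0" if "i \<in> {1..N} - {j}" for i
      using that unfolding poly_power by (intro power_not_zero) simp
    then show ?thesis unfolding g_def poly_prod by (subst prod_zero_iff) blast+
  qed
  obtain B where B: "B > 0" "\<And>x. x \<in> {-1..1} \<Longrightarrow> \<bar>poly h x\<bar> \<le> B"
    using poly_bounded_on_interval[of h] by metis
  define K where "K = eta j * (fact (d j) * \<bar>poly g (c j)\<bar>)"
  have K: "K > 0" using eta[OF j] gc by (simp add: K_def)
  have cj: "\<bar>c j\<bar> > 1" using c_cases[OF j] by auto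
  have "\<bar>poly ((pderiv ^^ d j) (S n)) (c j)\<bar> \<le> (B * l2_norm 1 / K) * l2_norm (S n) / \<bar>c j\<bar> ^ (n - D)"
    if n: "n \<ge> D" for n
  proof -
    define f where "f = monom 1 (n - D) * h"
    have f0: "f \<noteq> 0" using h0 by (simp add: f_def monom_eq_0_iff)
    have "degree f < n"
      using degh n h0 by (simp add: f_def degree_mult_eq monom_eq_0_iff degree_monom_eq)
    then have orth: "sobolev f (S n) = 0" by (rule S_orthogonal)
    have zero: "poly ((pderiv ^^ d i) f) (c i) = 0" if "i \<in> {1..N} - {j}" for i
    proof (rule poly_higher_pderiv_eq_0)
      have "[:- c i, 1:] ^ (d i + 1) dvd g" unfolding g_def using that by (intro dvd_prodI) auto
      then show "[:- c i, 1:] ^ Suc (d i) dvd f" by (simp add: f_def h_def dvd_mult)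
    qed
    have fj: "poly ((pderiv ^^ d j) f) (c j) = fact (d j) * (c j ^ (n - D) * poly g (c j))"
      using higher_pderiv_power_linear_mult[of "d j" "c j" 0 "monom 1 (n - D) * g"]
      by (simp add: f_def h_def poly_monom mult_ac)
    have "sobolev f (S n) = integ (f * S n) +
        eta j * poly ((pderiv ^^ d j) f) (c j) * poly ((pderiv ^^ d j) (S n)) (c j)"
      unfolding sobolev_eq using j zero by (subst sum.remove[of _ j]) auto
    then have "eta j * poly ((pderiv ^^ d j) f) (c j) * poly ((pderiv ^^ d j) (S n)) (c j) =
      - integ (f * S n)"
      using orth by linarith
    then have "\<bar>eta j * poly ((pderiv ^^ d j) f) (c j) * poly ((pderiv ^^ d j) (S n)) (c j)\<bar> =
      \<bar>integ (f * S n)\<bar>"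
      by simp
    then have "K * \<bar>c j\<bar> ^ (n - D) * \<bar>poly ((pderiv ^^ d j) (S n)) (c j)\<bar> = \<bar>integ (f * S n)\<bar>"
      unfolding fj using eta[OF j] by (simp add: K_def abs_mult power_abs mult_ac)
    also have "\<dots> \<le> l2_norm f * l2_norm (S n)" by (rule abs_integ_mult_le) (auto simp: f0)
    also have "l2_norm f \<le> B * l2_norm 1"
    proof -
      have "l2_norm (f * 1) \<le> B * l2_norm 1"
      proof (rule l2_norm_mult_le)
        fix x :: real assume x: "x \<in> {-1..1}"
        then have "\<bar>x\<bar> ^ (n - D) * \<bar>poly h x\<bar> \<le> 1 * B"
          using B by (intro mult_mono power_le_one) auto
        then show "\<bar>poly f x\<bar> \<le> B" by (simp add: f_def poly_monom abs_mult power_abs)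
      qed
      then show ?thesis by simp
    qed
    finally have "K * \<bar>c j\<bar> ^ (n - D) * \<bar>poly ((pderiv ^^ d j) (S n)) (c j)\<bar> \<le>
      B * l2_norm 1 * l2_norm (S n)"
      using l2_norm_nonneg by (simp add: mult_right_mono)
    moreover have "K * \<bar>c j\<bar> ^ (n - D) > 0" using K cj by (intro mult_pos_pos zero_less_power) auto
    ultimately show ?thesis
      by (simp add: pos_le_divide_eq field_simps)
  qed
  moreover have "B * l2_norm 1 / K > 0" using B K l2_norm_pos[of 1] by simp
  ultimately show ?thesis using that by blast
qed

end

context nevai_sobolev
begin

text \<open>
  In the Leibniz expansion of the \<open>d\<^sub>j\<close>-th derivative of \<open>S\<^sub>n = q w\<close> at \<open>c\<^sub>j\<close>, one term has all the
  derivatives on \<open>q\<close>, and there the derivative of \<open>q\<close> exceeds those in the other terms by a factor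
  of order at least \<open>n\<close>. Since the sum is negligible against \<open>q(c\<^sub>j)\<close>, the value \<open>w(c\<^sub>j)\<close> is
  small relative to the coefficients of \<open>w\<close>.
\<close>

lemma cofactor_small_at_mass_point:
  assumes j: "j \<in> {1..N}" and \<epsilon>: "\<epsilon> > 0"
  obtains n0 where "\<And>n Z w. n \<ge> n0 \<Longrightarrow> S_splits n Z w \<Longrightarrow> \<bar>poly w (c j)\<bar> \<le> \<epsilon> * coeff_norm N w"
proof -
  let ?c = "c j" and ?\<nu> = "d j"
  have cj: "\<bar>?c\<bar> > 1" using c_cases[OF j] by auto
  have "\<exists>L. \<forall>i. L i \<ge> 0 \<and> (\<forall>w. degree w \<le> N \<longrightarrow> \<bar>poly ((pderiv ^^ i) w) ?c\<bar> \<le> L i * coeff_norm N w)"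
  proof (rule choice, rule allI)
    fix i
    show "\<exists>L. L \<ge> 0 \<and> (\<forall>w. degree w \<le> N \<longrightarrow> \<bar>poly ((pderiv ^^ i) w) ?c\<bar> \<le> L * coeff_norm N w)"
      using linear_functional_bound[of "\<lambda>w. poly ((pderiv ^^ i) w) ?c" N]
      by (simp add: higher_pderiv_add higher_pderiv_smult) metis
  qed
  then obtain L where L: "\<And>i. L i \<ge> 0"
    "\<And>i w. degree w \<le> N \<Longrightarrow> \<bar>poly ((pderiv ^^ i) w) ?c\<bar> \<le> L i * coeff_norm N w"
    by blast
  define K where "K = (\<Sum>i\<in>{1..?\<nu>}. real (?\<nu> choose i) * L i)"
  have K: "K \<ge> 0" unfolding K_def by (intro sum_nonneg mult_nonneg_nonneg) (auto simp: L)
  \<comment> \<open>For large \<open>n\<close> every differentiation of \<open>q\<close> gains a factor of at least \<open>T\<close>; the lower-order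
    terms of the Leibniz expansion then contribute at most \<open>K / T\<close>.\<close>
  define T where "T = 2 * K / \<epsilon> + 1"
  have T: "T \<ge> 1" "K / T \<le> \<epsilon> / 2"
    using K \<epsilon> by (auto simp: T_def field_simps)
  obtain C1 where C1: "C1 > 0"
    "\<And>n. n \<ge> D \<Longrightarrow> \<bar>poly ((pderiv ^^ ?\<nu>) (S n)) ?c\<bar> \<le> C1 * l2_norm (S n) / \<bar>?c\<bar> ^ (n - D)"
    using S_derivative_at_mass_point[OF j] by metis
  obtain C2 n2 where C2: "C2 > 0" "\<And>n. n \<ge> n2 \<Longrightarrow> l2_norm (S n) \<le> C2 * l2_norm (P n)"
    using S_norm_le by metis
  define \<delta> where "\<delta> = \<bar>?c\<bar> - 1"
  have \<delta>: "\<delta> > 0" using cj by (simp add: \<delta>_def)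
  have dist: "cmod (of_real ?c - of_real x) \<ge> \<delta>" if "x \<in> {-1..1}" for x
  proof -
    have "cmod (of_real ?c - of_real x) = \<bar>?c - x\<bar>" by (metis norm_of_real of_real_diff)
    then show ?thesis using that by (auto simp: \<delta>_def)
  qed
  obtain C3 where C3: "C3 > 0"
    "\<And>n z. (\<And>x. x \<in> {-1..1} \<Longrightarrow> cmod (z - of_real x) \<ge> \<delta>) \<Longrightarrow> cmod z \<le> \<bar>?c\<bar> \<Longrightarrow>
      l2_norm (P n) \<le> C3 * cmod (cpoly (P n) z)"
    using P_norm_le_value_uniform[OF \<delta>, of "\<bar>?c\<bar>"] by metis
  define E where "E = exp (4 * real D / \<delta>) * (1 + \<bar>?c\<bar>) ^ N"
  have E: "E > 0" using cj by (simp add: E_def)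
  define C4 where "C4 = C1 * (C2 * (C3 * E))"
  have C4: "C4 > 0" using C1 C2 C3 E by (simp add: C4_def)
  have "(\<lambda>n. C4 * (1 / \<bar>?c\<bar>) ^ n) \<longlonglongrightarrow> C4 * 0"
    using cj by (intro tendsto_mult_left LIMSEQ_realpow_zero) auto
  then have "eventually (\<lambda>n. C4 * (1 / \<bar>?c\<bar>) ^ n < \<epsilon> / 2) sequentially"
    using \<epsilon> by (intro order_tendstoD(2)[of _ 0]) auto
  then obtain n4 where n4: "\<And>n. n \<ge> n4 \<Longrightarrow> C4 * (1 / \<bar>?c\<bar>) ^ n < \<epsilon> / 2"
    by (auto simp: eventually_sequentially)
  obtain n5 :: nat where n5: "real n5 \<ge> T * (\<bar>?c\<bar> + 1)" using real_arch_simple by blast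
  have "\<bar>poly w ?c\<bar> \<le> \<epsilon> * coeff_norm N w"
    if n: "n \<ge> n2 + n4 + D + N + ?\<nu> + n5" and split: "S_splits n Z w" for n Z w
  proof -
    have Z: "finite Z" "Z \<subseteq> {-1<..<1}" and S: "S n = root_poly Z * w" "n \<le> card Z + N"
      and w: "degree w \<le> N" "lead_coeff w = 1"
      using split S_splits_degree by (auto simp: S_splits_def)
    define q where "q i = \<bar>poly ((pderiv ^^ i) (root_poly Z)) ?c\<bar>" for i
    have q0: "q i \<ge> 0" for i by (simp add: q_def)
    have step: "T * q i \<le> q (Suc i)" if i: "i < ?\<nu>" for i
    proof -
      have "T * (\<bar>?c\<bar> + 1) \<le> real (card Z) - real i"
        using n S(2) n5 i by linarith
      then have "T * (\<bar>?c\<bar> + 1) * q i \<le> (real (card Z) - real i) * q i"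
        using q0 by (intro mult_right_mono) auto
      also have "\<dots> \<le> (\<bar>?c\<bar> + 1) * q (Suc i)"
        unfolding q_def by (rule root_poly_higher_pderiv_growth[OF Z cj])
      finally show ?thesis using cj by (simp add: mult_ac)
    qed
    have mono: "q i \<le> q k" if "i \<le> k" "k \<le> ?\<nu>" for i k
      using that
    proof (induction k rule: dec_induct)
      case (step k)
      have "q k \<le> T * q k" using T(1) q0[of k] mult_right_mono[of 1 T "q k"] by simp
      also have "\<dots> \<le> q (Suc k)" using \<open>\<And>i. i < ?\<nu> \<Longrightarrow> T * q i \<le> q (Suc i)\<close> step by auto
      finally show ?case using step by simp
    qed simp
    have lower: "q i \<le> q ?\<nu> / T" if "i < ?\<nu>" for i
    proof -
      have "T * q i \<le> q (Suc i)" by (rule step[OF that])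
      also have "\<dots> \<le> q ?\<nu>" using that by (intro mono) auto
      finally show ?thesis using T(1) by (simp add: field_simps)
    qed
    have "?c \<notin> Z"
    proof
      assume "?c \<in> Z"
      then have "?c \<in> {-1<..<1}" using Z(2) by blast
      then show False using cj by auto
    qed
    then have "poly (root_poly Z) ?c \<noteq> 0" using Z(1) by (simp add: poly_root_poly_eq_0_iff)
    then have "q 0 > 0" by (simp add: q_def)
    then have q\<nu>: "q ?\<nu> > 0" using mono[of 0 ?\<nu>] by simp
    have cn: "coeff_norm N w \<ge> 1" using w by (intro coeff_norm_monic)
    let ?t = "\<lambda>i. real (?\<nu> choose i) *
      (poly ((pderiv ^^ (?\<nu> - i)) (root_poly Z)) ?c * poly ((pderiv ^^ i) w) ?c)"
    have "poly ((pderiv ^^ ?\<nu>) (S n)) ?c = (\<Sum>i\<le>?\<nu>. ?t i)"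
      unfolding S(1) higher_pderiv_mult poly_sum by simp
    also have "\<dots> = ?t 0 + (\<Sum>i\<in>{1..?\<nu>}. ?t i)"
      by (simp add: sum.atMost_shift atLeast0AtMost[symmetric] sum.atLeast_Suc_atMost)
    finally have "poly ((pderiv ^^ ?\<nu>) (root_poly Z)) ?c * poly w ?c =
        poly ((pderiv ^^ ?\<nu>) (S n)) ?c - (\<Sum>i\<in>{1..?\<nu>}. ?t i)" by simp
    then have "q ?\<nu> * \<bar>poly w ?c\<bar> = \<bar>poly ((pderiv ^^ ?\<nu>) (S n)) ?c - (\<Sum>i\<in>{1..?\<nu>}. ?t i)\<bar>"
      unfolding q_def by (simp add: abs_mult[symmetric])
    also have "\<dots> \<le> \<bar>poly ((pderiv ^^ ?\<nu>) (S n)) ?c\<bar> + (\<Sum>i\<in>{1..?\<nu>}. \<bar>?t i\<bar>)"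
      using sum_abs[of ?t "{1..?\<nu>}"] by linarith
    also have "(\<Sum>i\<in>{1..?\<nu>}. \<bar>?t i\<bar>) \<le>
      (\<Sum>i\<in>{1..?\<nu>}. real (?\<nu> choose i) * (q ?\<nu> / T * (L i * coeff_norm N w)))"
    proof (rule sum_mono)
      fix i assume i: "i \<in> {1..?\<nu>}"
      have "q (?\<nu> - i) * \<bar>poly ((pderiv ^^ i) w) ?c\<bar> \<le> q ?\<nu> / T * (L i * coeff_norm N w)"
        using i by (intro mult_mono lower L(2) w(1)) (use q\<nu> T(1) in auto)
      from mult_left_mono[OF this, of "real (?\<nu> choose i)"]
      show "\<bar>?t i\<bar> \<le> real (?\<nu> choose i) * (q ?\<nu> / T * (L i * coeff_norm N w))"
        by (simp add: abs_mult q_def)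
    qed
    also have "\<dots> = q ?\<nu> * (K / T * coeff_norm N w)"
      by (simp add: K_def sum_distrib_left sum_distrib_right sum_divide_distrib mult_ac)
    also have "\<bar>poly ((pderiv ^^ ?\<nu>) (S n)) ?c\<bar> \<le> q ?\<nu> * (\<epsilon> / 2)"
    proof -
      have "l2_norm (P n) \<le> C3 * cmod (cpoly (P n) (of_real ?c))"
        by (rule C3(2)[OF dist]) auto
      also have "cmod (cpoly (P n) (of_real ?c)) \<le>
        exp (4 * real D / \<delta>) * (1 + cmod (of_real ?c)) ^ N * cmod (cpoly (root_poly Z) (of_real ?c))"
        by (rule P_le_root_poly_factor[OF split \<delta> dist])
      also have "\<dots> = E * q 0" by (simp add: E_def cpoly_of_real q_def)
      also have "E * q 0 \<le> E * q ?\<nu>" using E mono[of 0 ?\<nu>] by simp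
      finally have "l2_norm (P n) \<le> C3 * (E * q ?\<nu>)" using C3(1) by (simp add: mult_left_mono)
      then have SP: "l2_norm (S n) \<le> C2 * (C3 * (E * q ?\<nu>))"
        using C2(2)[of n] n C2(1) by (smt (verit) add_leD1 mult_left_mono)
      have "\<bar>poly ((pderiv ^^ ?\<nu>) (S n)) ?c\<bar> \<le> C1 * l2_norm (S n) / \<bar>?c\<bar> ^ (n - D)"
        using n by (intro C1(2)) simp
      also have "\<dots> \<le> C1 * (C2 * (C3 * (E * q ?\<nu>))) / \<bar>?c\<bar> ^ (n - D)"
        using SP C1(1) by (intro divide_right_mono mult_left_mono) auto
      also have "\<dots> = q ?\<nu> * (C4 * (1 / \<bar>?c\<bar>) ^ (n - D))"
        by (simp add: C4_def power_divide)
      also have "\<dots> \<le> q ?\<nu> * (\<epsilon> / 2)"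
      proof -
        have "n - D \<ge> n4" using n by linarith
        then show ?thesis using n4[of "n - D"] q\<nu> by (intro mult_left_mono) auto
      qed
      finally show ?thesis .
    qed
    finally have "q ?\<nu> * \<bar>poly w ?c\<bar> \<le> q ?\<nu> * (\<epsilon> / 2 + K / T * coeff_norm N w)"
      by (simp add: distrib_left)
    then have "\<bar>poly w ?c\<bar> \<le> \<epsilon> / 2 + K / T * coeff_norm N w" using q\<nu> by simp
    also have "\<dots> \<le> \<epsilon> / 2 * coeff_norm N w + \<epsilon> / 2 * coeff_norm N w"
    proof (rule add_mono)
      show "\<epsilon> / 2 \<le> \<epsilon> / 2 * coeff_norm N w"
        using mult_left_mono[OF cn, of "\<epsilon> / 2"] \<epsilon> by simp
      show "K / T * coeff_norm N w \<le> \<epsilon> / 2 * coeff_norm N w"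
        by (rule mult_right_mono[OF T(2) coeff_norm_nonneg])
    qed
    finally show ?thesis by simp
  qed
  then show ?thesis using that by blast
qed

text \<open>Small values at the mass points force \<open>w\<close> to be close to \<open>\<Prod>\<^sub>j (x - c\<^sub>j)\<close>, coefficientwise.\<close>

lemma cofactor_lower_bound:
  assumes \<delta>: "\<delta> > 0"
  obtains \<kappa> n0 where "\<kappa> > 0"
    "\<And>n Z w z. n \<ge> n0 \<Longrightarrow> S_splits n Z w \<Longrightarrow>
      (\<And>j. j \<in> {1..N} \<Longrightarrow> cmod (z - of_real (c j)) \<ge> \<delta>) \<Longrightarrow>
      cmod (cpoly w z) \<ge> \<kappa> * (1 + cmod z) ^ N"
proof -
  let ?X = "c ` {1..N}"
  have cardX: "card ?X = N" using card_image[OF c_inj] by simp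
  define R where "R = (\<Sum>j=1..N. \<bar>c j\<bar>)"
  have R: "\<bar>c j\<bar> \<le> R" if "j \<in> {1..N}" for j
    unfolding R_def using that by (intro member_le_sum) auto
  have R0: "R \<ge> 0" by (simp add: R_def sum_nonneg)
  define \<kappa>1 where "\<kappa>1 = 1 / ((1 + R) / \<delta> + 1)"
  have \<kappa>1: "\<kappa>1 > 0" using R0 \<delta> by (simp add: \<kappa>1_def add_nonneg_pos)
  define \<eta> where "\<eta> = \<kappa>1 ^ N / 2"
  have \<eta>: "\<eta> > 0" using \<kappa>1 by (simp add: \<eta>_def)
  obtain \<epsilon> where \<epsilon>: "\<epsilon> > 0"
    "\<And>w. lead_coeff w = 1 \<Longrightarrow> degree w \<le> N \<Longrightarrow>
       (\<And>x. x \<in> ?X \<Longrightarrow> \<bar>poly w x\<bar> \<le> \<epsilon> * coeff_norm N w) \<Longrightarrow>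
       degree w = N \<and> coeff_norm N (w - root_poly ?X) \<le> \<eta>"
    using monic_almost_vanishing[of ?X \<eta>] \<eta> unfolding cardX by blast
  have "\<exists>n0. \<forall>j\<in>{1..N}. \<forall>n Z w. n \<ge> n0 j \<longrightarrow> S_splits n Z w \<longrightarrow> \<bar>poly w (c j)\<bar> \<le> \<epsilon> * coeff_norm N w"
    by (rule bchoice) (use cofactor_small_at_mass_point[OF _ \<epsilon>(1)] in metis)
  then obtain n0 where n0: "\<And>j n Z w. j \<in> {1..N} \<Longrightarrow> n \<ge> n0 j \<Longrightarrow> S_splits n Z w \<Longrightarrow>
      \<bar>poly w (c j)\<bar> \<le> \<epsilon> * coeff_norm N w" by blast
  define n1 where "n1 = (\<Sum>j=1..N. n0 j)"
  have n1: "n0 j \<le> n1" if "j \<in> {1..N}" for j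
    unfolding n1_def using that by (intro member_le_sum) auto
  have "cmod (cpoly w z) \<ge> \<eta> * (1 + cmod z) ^ N"
    if n: "n \<ge> n1" and split: "S_splits n Z w"
      and z: "\<And>j. j \<in> {1..N} \<Longrightarrow> cmod (z - of_real (c j)) \<ge> \<delta>" for n Z w z
  proof -
    have w: "degree w \<le> N" "lead_coeff w = 1"
      using split S_splits_degree by (auto simp: S_splits_def)
    have "degree w = N \<and> coeff_norm N (w - root_poly ?X) \<le> \<eta>"
    proof (rule \<epsilon>(2)[OF w(2,1)])
      fix x assume "x \<in> ?X"
      then obtain j where j: "j \<in> {1..N}" "x = c j" by blast
      then show "\<bar>poly w x\<bar> \<le> \<epsilon> * coeff_norm N w"
        using n0[OF j(1) order.trans[OF n1[OF j(1)] n] split] by simp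
    qed
    moreover have "degree (w - root_poly ?X) \<le> N"
      by (rule degree_diff_le[OF w(1)]) (simp only: degree_root_poly cardX order_refl)
    ultimately have near: "cmod (cpoly (w - root_poly ?X) z) \<le> \<eta> * (1 + cmod z) ^ N"
      by (meson cmod_cpoly_le mult_right_mono norm_ge_zero order.trans zero_le_power add_nonneg_nonneg
        zero_le_one)
    have "(\<kappa>1 * (1 + cmod z)) ^ N = (\<Prod>x\<in>?X. \<kappa>1 * (1 + cmod z))"
      unfolding prod_constant cardX ..
    also have "\<dots> \<le> (\<Prod>x\<in>?X. cmod (z - of_real x))"
    proof (rule prod_mono)
      fix x assume "x \<in> ?X"
      then obtain j where j: "j \<in> {1..N}" "x = c j" by blast
      have "cmod z \<le> cmod (z - of_real x) + \<bar>x\<bar>"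
        using norm_triangle_ineq[of "z - of_real x" "of_real x"] by simp
      then have "1 + cmod z \<le> (1 + R) + cmod (z - of_real x)" using R[OF j(1)] j(2) by simp
      also have "1 + R \<le> (1 + R) / \<delta> * cmod (z - of_real x)"
        using mult_left_mono[OF z[OF j(1)], of "(1 + R) / \<delta>"] R0 \<delta> j(2) by simp
      finally have "1 + cmod z \<le> ((1 + R) / \<delta> + 1) * cmod (z - of_real x)"
        by (simp add: distrib_right)
      moreover have "(1 + R) / \<delta> + 1 > 0" using R0 \<delta> by (simp add: add_nonneg_pos)
      ultimately have "\<kappa>1 * (1 + cmod z) \<le> cmod (z - of_real x)"
        unfolding \<kappa>1_def by (simp add: pos_divide_le_eq mult.commute)
      then show "0 \<le> \<kappa>1 * (1 + cmod z) \<and> \<kappa>1 * (1 + cmod z) \<le> cmod (z - of_real x)"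
        using \<kappa>1 by simp
    qed
    also have "\<dots> = cmod (cpoly (root_poly ?X) z)" by (simp add: cmod_cpoly_root_poly)
    also have "\<dots> \<le> cmod (cpoly w z) + cmod (cpoly (w - root_poly ?X) z)"
      unfolding cpoly_diff using
        norm_triangle_ineq4[of "cpoly w z" "cpoly w z - cpoly (root_poly ?X) z"]
      by simp
    finally show ?thesis using near by (simp add: power_mult_distrib \<eta>_def)
  qed
  then show ?thesis using that \<eta> by blast
qed

end

section \<open>The conformal map of the exterior of the interval\<close>

lemma phi_altdef:
  defines "a \<equiv> \<lambda>z. csqrt (z - 1)" and "b \<equiv> \<lambda>z. csqrt (z + 1)"
  shows "phi z = (a z + b z)\<^sup>2 / 2" "1 / phi z = (a z - b z)\<^sup>2 / 2" "phi z \<noteq> 0"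
proof -
  have ab: "(a z)\<^sup>2 = z - 1" "(b z)\<^sup>2 = z + 1" by (simp_all add: a_def b_def)
  show 1: "phi z = (a z + b z)\<^sup>2 / 2"
    unfolding power2_sum ab by (simp add: phi_def a_def b_def field_simps)
  have "phi z * ((a z - b z)\<^sup>2 / 2) = ((b z)\<^sup>2 - (a z)\<^sup>2)\<^sup>2 / 4"
    unfolding 1 by (simp add: power2_eq_square field_simps)
  also have "\<dots> = 1" unfolding ab by (simp add: power2_eq_square)
  finally have *: "phi z * ((a z - b z)\<^sup>2 / 2) = 1" .
  then show "phi z \<noteq> 0" by auto
  then show "1 / phi z = (a z - b z)\<^sup>2 / 2" using * by (simp add: field_simps)
qed

lemma phi_nonzero [simp]: "phi z \<noteq> 0"
  by (rule phi_altdef)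

lemma phi_joukowski: "phi z + 1 / phi z = 2 * z"
proof -
  have "1 / phi z = z - csqrt (z - 1) * csqrt (z + 1)"
    unfolding phi_altdef(2) by (simp add: power2_diff field_simps)
  then show ?thesis by (simp add: phi_def)
qed

text \<open>
  Both square roots lie in the same closed quadrant, so their sum is not shorter than their
  difference.
\<close>

lemma cmod_phi_ge_1: "cmod (phi z) \<ge> 1"
proof -
  let ?a = "csqrt (z - 1)" and ?b = "csqrt (z + 1)"
  have "Re ?a * Re ?b \<ge> 0"
    using csqrt_principal[of "z - 1"] csqrt_principal[of "z + 1"]
    by (intro mult_nonneg_nonneg) linarith+
  moreover have "Im ?a * Im ?b \<ge> 0"
  proof -
    define g :: real where "g = (if Im z = 0 then 1 else sgn (Im z))"
    have "Im ?a * Im ?b = g\<^sup>2 *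
      (sqrt ((cmod (z - 1) - Re (z - 1)) / 2) * sqrt ((cmod (z + 1) - Re (z + 1)) / 2))"
      by (simp add: g_def power2_eq_square)
    also have "\<dots> \<ge> 0"
      using complex_Re_le_cmod[of "z - 1"] complex_Re_le_cmod[of "z + 1"]
      by (intro mult_nonneg_nonneg real_sqrt_ge_zero)
        (simp_all del: minus_complex.sel plus_complex.sel)
    finally show ?thesis .
  qed
  ultimately have "(cmod (?a - ?b))\<^sup>2 \<le> (cmod (?a + ?b))\<^sup>2"
    unfolding cmod_power2 by (simp add: power2_eq_square algebra_simps)
  moreover have "cmod (1 / phi z) = (cmod (?a - ?b))\<^sup>2 / 2"
    unfolding phi_altdef(2) by (simp add: norm_divide norm_power)
  moreover have "cmod (phi z) = (cmod (?a + ?b))\<^sup>2 / 2"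
    unfolding phi_altdef(1) by (simp add: norm_divide norm_power)
  ultimately have "cmod (1 / phi z) \<le> cmod (phi z)" by linarith
  then have "1 \<le> (cmod (phi z))\<^sup>2"
    by (simp add: norm_divide power2_eq_square pos_divide_le_eq)
  then show ?thesis using power2_le_imp_le[of 1 "cmod (phi z)"] by simp
qed

text \<open>Moving \<open>\<phi>(z)\<close> radially to the unit circle moves \<open>z\<close> to a point of the interval.\<close>

lemma cmod_phi_ge_dist:
  assumes "\<And>x. x \<in> {-1..1} \<Longrightarrow> cmod (z - of_real x) \<ge> \<delta>"
  shows "cmod (phi z) \<ge> 1 + \<delta>"
proof -
  let ?r = "cmod (phi z)"
  define u where "u = phi z / of_real ?r"
  have r: "?r \<ge> 1" by (rule cmod_phi_ge_1)
  then have pu: "phi z = of_real ?r * u" and u: "cmod u = 1"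
    by (auto simp: u_def norm_divide)
  have "u * cnj u = 1" using u by (simp add: complex_norm_square[symmetric])
  then have inv: "1 / phi z = of_real (1 / ?r) * cnj u"
  proof -
    have "u \<noteq> 0" using u by auto
    then have "1 / u = cnj u" using \<open>u * cnj u = 1\<close> by (simp add: divide_eq_eq mult.commute)
    then show ?thesis by (subst pu)
      (metis divide_divide_eq_left of_real_1 of_real_divide times_divide_times_eq mult_1)
  qed
  define x where "x = Re u"
  have x: "x \<in> {-1..1}" using abs_Re_le_cmod[of u] u by (auto simp: x_def abs_le_iff)
  have "2 * (z - of_real x) = of_real (?r - 1) * u + of_real (1 / ?r - 1) * cnj u"
    using phi_joukowski[of z] complex_add_cnj[of u] pu inv by (simp add: x_def algebra_simps)
  then have "2 * cmod (z - of_real x) \<le> \<bar>?r - 1\<bar> + \<bar>1 / ?r - 1\<bar>"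
    using u norm_triangle_ineq[of "of_real (?r - 1) * u" "of_real (1 / ?r - 1) * cnj u"]
    by (metis complex_mod_cnj mult.right_neutral norm_mult norm_numeral norm_of_real)
  also have "\<bar>1 / ?r - 1\<bar> = (?r - 1) / ?r" using r by (simp add: abs_if field_simps)
  also have "(?r - 1) / ?r \<le> (?r - 1) / 1" using r by (intro divide_left_mono) auto
  finally have "cmod (z - of_real x) \<le> ?r - 1" using r by simp
  then show ?thesis using assms[OF x] by simp
qed

lemma cmod_inverse_phi_le:
  assumes "\<delta> > 0" "\<And>x. x \<in> {-1..1} \<Longrightarrow> cmod (z - of_real x) \<ge> \<delta>"
  shows "cmod (1 / phi z) \<le> 1 / (1 + \<delta>)"
  using cmod_phi_ge_dist[OF assms(2)] assms(1)
  unfolding norm_divide norm_one by (intro divide_left_mono) auto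

lemma dist_pos_imp_off_interval:
  assumes "\<delta> > 0" "\<And>x. x \<in> {-1..1} \<Longrightarrow> cmod (z - of_real x) \<ge> \<delta>"
  shows "z \<notin> of_real ` {-1..1}"
  using assms(1) assms(2)[of "Re z"] by auto

lemma off_interval_dist:
  assumes "z \<notin> of_real ` {-1..1}"
  obtains \<delta> where "\<delta> > 0" "\<And>x. x \<in> {-1..1} \<Longrightarrow> cmod (z - of_real x) \<ge> \<delta>"
proof -
  have "compact (complex_of_real ` {-1..1})"
    by (intro compact_continuous_image continuous_intros) auto
  then obtain \<delta> where "\<delta> > 0" "\<forall>x\<in>{z}. \<forall>y\<in>complex_of_real ` {-1..1}. \<delta> \<le> dist x y"
    using separate_closed_compact[of "{z}" "complex_of_real ` {-1..1}"] assms by auto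
  then show ?thesis using that by (auto simp: dist_norm)
qed

lemma cmod_phi_gt_1:
  assumes "z \<notin> of_real ` {-1..1}"
  shows "cmod (phi z) > 1"
proof -
  obtain \<delta> where "\<delta> > 0" "\<And>x. x \<in> {-1..1} \<Longrightarrow> cmod (z - of_real x) \<ge> \<delta>"
    by (rule off_interval_dist[OF assms]) (rule that)
  then show ?thesis using cmod_phi_ge_dist[of \<delta> z] by simp
qed

lemma phi_uminus:
  assumes "z \<notin> of_real ` {-1..1}"
  shows "phi (- z) = - phi z"
proof -
  have "- z \<notin> of_real ` {-1..1}"
  proof
    assume "- z \<in> of_real ` {-1..1}"
    then obtain x where x: "x \<in> {-1..1}" "- z = of_real x" by blast
    then have "z = of_real (- x)" by (metis add.inverse_inverse of_real_minus)
    then show False using assms x(1) by (metis atLeastAtMost_iff imageI minus_le_iff neg_le_iff_le)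
  qed
  then have gt: "cmod (phi z) > 1" "cmod (phi (- z)) > 1" using assms cmod_phi_gt_1 by auto
  have "phi z + 1 / phi z + (phi (- z) + 1 / phi (- z)) = 0"
    by (simp only: phi_joukowski) simp
  then have "(phi z + phi (- z)) * (phi z * phi (- z) + 1) = 0"
    by (simp add: field_simps)
  moreover have "phi z * phi (- z) + 1 \<noteq> 0"
  proof
    assume "phi z * phi (- z) + 1 = 0"
    then have "phi z * phi (- z) = -1" by (rule eq_neg_iff_add_eq_0[THEN iffD2])
    then have "cmod (phi z) * cmod (phi (- z)) = 1" by (metis norm_minus_cancel norm_mult norm_one)
    then show False using gt less_1_mult[of "cmod (phi z)" "cmod (phi (- z))"] by simp
  qed
  ultimately show ?thesis by (simp add: add_eq_0_iff)
qed

lemma closed_interval_complex: "closed (complex_of_real ` {-1..1})"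
  by (intro compact_imp_closed compact_continuous_image continuous_intros) auto

lemma isCont_phi:
  assumes z: "z \<notin> of_real ` {-1..1}"
  shows "isCont phi z"
proof -
  have right: "isCont phi z" if "z \<notin> of_real ` {..1}" for z
  proof -
    have "z - 1 \<notin> \<real>\<^sub>\<le>\<^sub>0" "z + 1 \<notin> \<real>\<^sub>\<le>\<^sub>0"
    proof -
      have "z = of_real (Re z)" if "Im z = 0" using that by (simp add: complex_eq_iff)
      then have "Im z \<noteq> 0 \<or> Re z > 1"
        using \<open>z \<notin> of_real ` {..1}\<close> by (metis atMost_iff imageI not_le)
      then show "z - 1 \<notin> \<real>\<^sub>\<le>\<^sub>0" "z + 1 \<notin> \<real>\<^sub>\<le>\<^sub>0" by (auto simp: complex_nonpos_Reals_iff)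
    qed
    then show ?thesis
      unfolding phi_def[abs_def] by (intro continuous_intros isCont_o2[OF _ continuous_at_csqrt]) auto
  qed
  show ?thesis
  proof (cases "z \<in> of_real ` {..1}")
    case False
    then show ?thesis by (rule right)
  next
    case True
    \<comment> \<open>On the ray to the left of \<open>-1\<close> both square roots jump; the symmetry \<open>\<phi>(-z) = -\<phi>(z)\<close>
      carries continuity over from the right.\<close>
    then obtain x where x: "x \<le> 1" "z = of_real x" by blast
    with z have "x \<notin> {-1..1}" by blast
    with x have x: "z = of_real x" "x < -1" by auto
    have "- z \<notin> of_real ` {..1}"
    proof
      assume "- z \<in> of_real ` {..1}"
      then obtain y where "y \<le> 1" "- of_real x = complex_of_real y" using x by auto
      then have "- x = y" by (metis of_real_eq_iff of_real_minus)
      then show False using x \<open>y \<le> 1\<close> by simp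
    qed
    then have "isCont phi (- z)" by (rule right)
    then have "isCont (\<lambda>w. phi (- w)) z"
      by (rule isCont_o2[rotated]) (intro continuous_intros)
    then have "isCont (\<lambda>w. - phi (- w)) z" by (rule continuous_minus)
    note cont = this
    have ev: "eventually (\<lambda>w. - phi (- w) = phi w) (nhds z)"
    proof -
      have "eventually (\<lambda>w. w \<in> - complex_of_real ` {-1..1}) (nhds z)"
        using z closed_interval_complex by (intro eventually_nhds_in_open) auto
      then show ?thesis by eventually_elim (simp add: phi_uminus)
    qed
    show ?thesis by (rule iffD1[OF isCont_cong[OF ev] cont])
  qed
qed

lemma inverse_phi_at_infinity: "((\<lambda>z. 1 / phi z) \<longlongrightarrow> 0) at_infinity"
proof (rule Lim_null_comparison)
  have "filterlim (\<lambda>z::complex. -1 + norm z) at_top at_infinity"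
    by (rule filterlim_tendsto_add_at_top[OF tendsto_const filterlim_norm_at_top])
  then have "filterlim (\<lambda>z::complex. norm z - 1) at_top at_infinity"
    by (simp only: uminus_add_conv_diff)
  then show "((\<lambda>z::complex. inverse (norm z - 1)) \<longlongrightarrow> 0) at_infinity"
    by (rule tendsto_inverse_0_at_top)
  have "eventually (\<lambda>z::complex. norm z \<ge> 2) at_infinity"
    unfolding eventually_at_infinity by (rule exI[of _ 2]) auto
  then show "eventually (\<lambda>z. norm (1 / phi z) \<le> inverse (norm z - 1)) at_infinity"
  proof eventually_elim
    case (elim z)
    have "cmod (phi z) \<ge> 1 + (norm z - 1)"
    proof (rule cmod_phi_ge_dist)
      fix x :: real assume "x \<in> {-1..1}"
      then have "cmod (of_real x) \<le> 1" by auto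
      then show "norm z - 1 \<le> cmod (z - of_real x)"
        using norm_triangle_ineq2[of z "of_real x"] by linarith
    qed
    then show ?case using elim by (simp add: norm_divide inverse_eq_divide frac_le)
  qed
qed

section \<open>The approximation error\<close>

context interval_measure
begin

definition cauchy_transform :: "real poly \<Rightarrow> complex \<Rightarrow> complex" where
  "cauchy_transform p z = (LINT x:{-1..1}|M. of_real (poly p x) / (z - of_real x))"

lemma continuous_on_cauchy_kernel:
  fixes z :: complex
  assumes "z \<notin> of_real ` {-1..1}"
  shows "continuous_on {-1..1} (\<lambda>x. of_real (poly p x) / (z - of_real x))"
  using assms by (intro continuous_intros) auto

lemma cmod_set_integral_le:
  fixes f :: "real \<Rightarrow> complex"
  assumes "continuous_on {-1..1} f" "continuous_on {-1..1} g" "\<And>x. x \<in> {-1..1} \<Longrightarrow> cmod (f x) \<le> g x"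
  shows "cmod (LINT x:{-1..1}|M. f x) \<le> (LINT x:{-1..1}|M. g x)"
  unfolding set_lebesgue_integral_def
  by (rule Bochner_Integration.integral_norm_bound_integral)
     (use set_integrable_continuous[OF assms(1)] set_integrable_continuous[OF assms(2)] assms(3)
       in \<open>auto simp: set_integrable_def indicator_def\<close>)

lemma isCont_cauchy_transform:
  assumes z: "z \<notin> of_real ` {-1..1}"
  shows "isCont (cauchy_transform p) z"
proof -
  let ?k = "\<lambda>w x. complex_of_real (poly p x) / (w - of_real x)"
  obtain \<delta> where \<delta>: "\<delta> > 0" "\<And>x. x \<in> {-1..1} \<Longrightarrow> cmod (z - of_real x) \<ge> \<delta>"
    by (rule off_interval_dist[OF z]) (rule that)
  obtain B where B: "B > 0" "\<And>x. x \<in> {-1..1} \<Longrightarrow> \<bar>poly p x\<bar> \<le> B"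
    using poly_bounded_on_interval[of p] by metis
  define K where "K = (LINT x:{-1..1}|M. B * 2 / \<delta>\<^sup>2)"
  have lip: "cmod (cauchy_transform p w - cauchy_transform p z) \<le> cmod (w - z) * K"
    if w: "cmod (w - z) < \<delta> / 2" for w
  proof -
    have wx: "cmod (w - of_real x) \<ge> \<delta> / 2" if "x \<in> {-1..1}" for x
    proof -
      have "cmod (z - of_real x) \<le> cmod (w - of_real x) + cmod (w - z)"
        using norm_triangle_ineq4[of "w - of_real x" "w - z"] by simp
      then show ?thesis using \<delta>(2)[OF that] w by simp
    qed
    have w': "w \<notin> of_real ` {-1..1}"
      using \<delta>(1) wx by (intro dist_pos_imp_off_interval[of "\<delta> / 2"]) auto
    have "cauchy_transform p w - cauchy_transform p z =
        (LINT x:{-1..1}|M. ?k w x - ?k z x)"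
      unfolding cauchy_transform_def
      by (rule set_integral_diff(2)[symmetric])
         (intro set_integrable_continuous continuous_on_cauchy_kernel w' z)+
    also have "cmod \<dots> \<le> (LINT x:{-1..1}|M. cmod (w - z) * (B * 2 / \<delta>\<^sup>2))"
    proof (rule cmod_set_integral_le)
      show "continuous_on {-1..1} (\<lambda>x. ?k w x - ?k z x)"
        by (intro continuous_on_diff continuous_on_cauchy_kernel w' z)
      fix x :: real assume x: "x \<in> {-1..1}"
      have nz: "w - of_real x \<noteq> 0" "z - of_real x \<noteq> 0" using w' z x by auto
      have "?k w x - ?k z x =
          of_real (poly p x) * (z - w) / ((w - of_real x) * (z - of_real x))"
        using nz by (simp add: field_simps)
      then have "cmod (?k w x - ?k z x) =
          \<bar>poly p x\<bar> * cmod (w - z) / (cmod (w - of_real x) * cmod (z - of_real x))"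
        by (simp add: norm_divide norm_mult norm_minus_commute)
      also have "\<dots> \<le> (B * cmod (w - z)) / ((\<delta> / 2) * \<delta>)"
        using B x wx[OF x] \<delta> by (intro frac_le mult_mono mult_right_mono) auto
      also have "\<dots> = cmod (w - z) * (B * 2 / \<delta>\<^sup>2)" by (simp add: power2_eq_square field_simps)
      finally show "cmod (?k w x - ?k z x)
          \<le> cmod (w - z) * (B * 2 / \<delta>\<^sup>2)" .
    qed (intro continuous_intros)
    also have "\<dots> = cmod (w - z) * K" unfolding K_def by (rule set_integral_mult_right)
    finally show ?thesis .
  qed
  have "((\<lambda>w. cauchy_transform p w - cauchy_transform p z) \<longlongrightarrow> 0) (at z)"
  proof (rule Lim_null_comparison)
    show "eventually (\<lambda>w. norm (cauchy_transform p w - cauchy_transform p z) \<le> cmod (w - z) * K)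
      (at z)"
      using \<delta>(1) lip by (auto simp: eventually_at dist_norm intro!: exI[of _ "\<delta> / 2"])
    have "((\<lambda>w. cmod (w - z) * K) \<longlongrightarrow> cmod (z - z) * K) (at z)" by (intro tendsto_intros)
    then show "((\<lambda>w. cmod (w - z) * K) \<longlongrightarrow> 0) (at z)" by simp
  qed
  then show ?thesis unfolding isCont_def by (subst Lim_null)
qed

end

context nevai_sobolev
begin

lemma set_integral_mu_rho:
  fixes f :: "real \<Rightarrow> complex"
  assumes f: "continuous_on {-1..1} f"
  shows "(LINT x:{-1..1}|mu_rho M N c d. f x) = (LINT x:{-1..1}|M. of_real (rho N c d x) * f x)"
proof -
  have "(LINT x:{-1..1}|mu_rho M N c d. f x) =
    (LINT x|M. rho N c d x *\<^sub>R (indicator {-1..1} x *\<^sub>R f x))"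
    unfolding set_lebesgue_integral_def mu_rho_def
  proof (rule integral_density)
    show "(\<lambda>x. indicator {-1..1} x *\<^sub>R f x) \<in> borel_measurable M"
      using borel_measurable_continuous_on_indicator[OF _ f] measurable_cong_sets[OF sets_M refl]
      by auto
    have "rho N c d = poly rho_poly" by (simp add: fun_eq_iff poly_rho_poly)
    moreover have "poly rho_poly \<in> borel_measurable borel"
      by (intro borel_measurable_continuous_onI continuous_intros)
    ultimately show "rho N c d \<in> borel_measurable M"
      using measurable_cong_sets[OF sets_M refl] by auto
    show "AE x in M. 0 \<le> rho N c d x"
      using AE_in_interval by eventually_elim (use rho_pos in \<open>force intro: less_imp_le\<close>)
  qed
  also have "\<dots> = (LINT x:{-1..1}|M. of_real (rho N c d x) * f x)"
    unfolding set_lebesgue_integral_def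
    by (rule Bochner_Integration.integral_cong) (auto simp: scaleR_conv_of_real)
  finally show ?thesis .
qed

lemma mu_hat_eq:
  assumes z: "z \<notin> of_real ` {-1..1}"
  shows "mu_hat M N c d k z = cauchy_transform (Q_poly M N c d (k - 1) * rho_poly) z"
  unfolding mu_hat_def set_integral_mu_rho[OF continuous_on_cauchy_kernel[OF z]] cauchy_transform_def
  by (simp add: poly_rho_poly mult_ac)

lemma S_assoc_eq:
  assumes z: "z \<notin> of_real ` {-1..1}"
  shows "S_assoc M N c d eta k n z = cpoly (S (n + k)) z * mu_hat M N c d k z -
    cauchy_transform (S (n + k) * (Q_poly M N c d (k - 1) * rho_poly)) z"
proof -
  let ?S = "S (n + k)" and ?Q = "Q_poly M N c d (k - 1)"
  let ?f = "\<lambda>x. cpoly ?S z * (of_real (poly ?Q x) / (z - of_real x)) -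
    of_real (poly (?S * ?Q) x) / (z - of_real x)"
  have f: "continuous_on {-1..1} ?f"
    by (intro continuous_on_diff continuous_on_mult continuous_on_const continuous_on_cauchy_kernel z)
  have "S_assoc M N c d eta k n z = (LINT x:{-1..1}|mu_rho M N c d. ?f x)"
    unfolding S_assoc_def
  proof (rule set_lebesgue_integral_cong)
    show "{-1..1} \<in> sets (mu_rho M N c d)" by (simp add: mu_rho_def sets_M)
    show "\<forall>x. x \<in> {-1..1} \<longrightarrow> diff_quot ?S z (of_real x) * of_real (poly ?Q x) = ?f x"
    proof (intro allI impI)
      fix x :: real assume "x \<in> {-1..1}"
      then have "z \<noteq> of_real x" using z by blast
      then show "diff_quot ?S z (of_real x) * of_real (poly ?Q x) = ?f x"
        by (simp add: diff_quot_def cpoly_of_real diff_divide_distrib left_diff_distrib)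
    qed
  qed
  also have "\<dots> = (LINT x:{-1..1}|M. of_real (rho N c d x) * ?f x)" by (rule set_integral_mu_rho[OF f])
  also have "\<dots> = (LINT x:{-1..1}|M. cpoly ?S z *
    (of_real (poly (?Q * rho_poly) x) / (z - of_real x)) -
      of_real (poly (?S * (?Q * rho_poly)) x) / (z - of_real x))"
    by (simp add: poly_rho_poly algebra_simps)
  also have "\<dots> = (LINT x:{-1..1}|M. cpoly ?S z *
    (of_real (poly (?Q * rho_poly) x) / (z - of_real x))) -
      cauchy_transform (?S * (?Q * rho_poly)) z"
    unfolding cauchy_transform_def
    by (rule set_integral_diff(2))
       (intro set_integrable_continuous continuous_on_mult continuous_on_const
         continuous_on_cauchy_kernel z)+
  also have "(LINT x:{-1..1}|M. cpoly ?S z * (of_real (poly (?Q * rho_poly) x) / (z - of_real x))) =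
      cpoly ?S z * mu_hat M N c d k z"
    unfolding mu_hat_eq[OF z] cauchy_transform_def by (rule set_integral_mult_right)
  finally show ?thesis .
qed

abbreviation error :: "nat \<Rightarrow> nat \<Rightarrow> complex \<Rightarrow> complex" where
  "error k n z \<equiv> mu_hat M N c d k z - R_approx M N c d eta k n z"

lemma error_eq:
  assumes "z \<notin> of_real ` {-1..1}" "cpoly (S (n + k)) z \<noteq> 0"
  shows "error k n z =
    cauchy_transform (S (n + k) * (Q_poly M N c d (k - 1) * rho_poly)) z / cpoly (S (n + k)) z"
  unfolding R_approx_def S_assoc_eq[OF assms(1)] using assms(2) by (simp add: field_simps)

text \<open>
  Quasi-orthogonality allows the Cauchy kernel to be multiplied by \<open>P\<^sub>l(x) / P\<^sub>l(z)\<close>, because the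
  difference \<open>(P\<^sub>l(z) - P\<^sub>l(x)) / (z - x)\<close> is a polynomial in \<open>x\<close> of low degree.
\<close>

lemma second_kind_bound:
  assumes \<delta>: "\<delta> > 0" and z: "\<And>x. x \<in> {-1..1} \<Longrightarrow> cmod (z - of_real x) \<ge> \<delta>"
    and B: "\<And>x. x \<in> {-1..1} \<Longrightarrow> \<bar>poly (Q * rho_poly) x\<bar> \<le> B" "B > 0"
    and l: "l + degree Q + D \<le> m"
  shows "cmod (cpoly (P l) z) * cmod (cauchy_transform (S m * (Q * rho_poly)) z) \<le>
    B / \<delta> * (l2_norm (S m) * l2_norm (P l))"
proof -
  have zi: "z \<notin> of_real ` {-1..1}" using \<delta> z by (rule dist_pos_imp_off_interval)
  let ?g = "S m * (Q * rho_poly)"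
  obtain u v where uv: "\<And>i. i \<ge> l \<Longrightarrow> coeff u i = 0" "\<And>i. i \<ge> l \<Longrightarrow> coeff v i = 0"
    "\<And>x. of_real (poly (P l) x) - cpoly (P l) z = (of_real x - z) * Complex (poly u x) (poly v x)"
    using divided_difference_poly[of "P l" z] by auto
  have orth: "integ (?g * h) = 0" if h: "\<And>i. i \<ge> l \<Longrightarrow> coeff h i = 0" for h
  proof (cases "h = 0")
    case False
    then have "degree h < l" using h by (metis leading_coeff_0_iff not_le)
    then have "degree (Q * h) + D < m" using degree_mult_le[of Q h] l by linarith
    then have "integ (rho_poly * (Q * h) * S m) = 0" by (rule S_quasi_orthogonal)
    then show ?thesis by (simp add: mult_ac)
  qed simp
  let ?F = "\<lambda>x. of_real (poly (?g * P l) x) / (z - of_real x)"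
  let ?h = "\<lambda>x. complex_of_real (poly (?g * u) x) + \<i> * complex_of_real (poly (?g * v) x)"
  have "cpoly (P l) z * cauchy_transform ?g z =
    (LINT x:{-1..1}|M. cpoly (P l) z * (of_real (poly ?g x) / (z - of_real x)))"
    unfolding cauchy_transform_def by (rule set_integral_mult_right[symmetric])
  also have "\<dots> = (LINT x:{-1..1}|M. ?F x + ?h x)"
  proof (rule set_lebesgue_integral_cong)
    show "\<forall>x. x \<in> {-1..1} \<longrightarrow> cpoly (P l) z * (of_real (poly ?g x) / (z - of_real x)) = ?F x + ?h x"
    proof (intro allI impI)
      fix x :: real assume "x \<in> {-1..1}"
      then have nz: "z - of_real x \<noteq> 0" using zi by auto
      have "cpoly (P l) z = of_real (poly (P l) x) + (z - of_real x) * Complex (poly u x) (poly v x)"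
        using uv(3)[of x] by (simp add: algebra_simps)
      moreover have "?h x = of_real (poly ?g x) * Complex (poly u x) (poly v x)"
        by (simp add: complex_eq_iff)
      moreover have "(p + y * e) * (a / y) = a * p / y + a * e" if "y \<noteq> 0" for p y e a :: complex
        using that by (simp add: field_simps)
      ultimately show "cpoly (P l) z * (of_real (poly ?g x) / (z - of_real x)) = ?F x + ?h x"
        using nz by (simp only: poly_mult[of _ "P l"] of_real_mult[of _ "poly (P l) x"])
    qed
  qed (simp add: sets_M)
  also have "\<dots> = (LINT x:{-1..1}|M. ?F x) + (LINT x:{-1..1}|M. ?h x)"
    by (rule set_integral_add(2))
      (intro set_integrable_continuous continuous_on_cauchy_kernel zi continuous_intros)+
  also have "(LINT x:{-1..1}|M. ?h x) = of_real (integ (?g * u)) + \<i> * of_real (integ (?g * v))"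
  proof -
    have "(LINT x:{-1..1}|M. ?h x) = (LINT x:{-1..1}|M. complex_of_real (poly (?g * u) x)) +
        (LINT x:{-1..1}|M. \<i> * complex_of_real (poly (?g * v) x))"
      by (rule set_integral_add(2)) (intro set_integrable_continuous continuous_intros)+
    then show ?thesis
      by (simp only: set_integral_mult_right set_integral_complex_of_real integ_def)
  qed
  also have "\<dots> = 0" using orth uv(1,2) by simp
  finally have "cmod (cpoly (P l) z) * cmod (cauchy_transform ?g z) = cmod (LINT x:{-1..1}|M. ?F x)"
    by (simp only: norm_mult[symmetric] add_0_right)
  also have "\<dots> \<le> (LINT x:{-1..1}|M. B / \<delta> * \<bar>poly (S m) x * poly (P l) x\<bar>)"
  proof (rule cmod_set_integral_le[OF continuous_on_cauchy_kernel[OF zi]])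
    fix x :: real assume x: "x \<in> {-1..1}"
    have "cmod (?F x) = \<bar>poly (S m) x * poly (P l) x\<bar> *
      \<bar>poly (Q * rho_poly) x\<bar> / cmod (z - of_real x)"
      by (simp add: norm_divide norm_mult abs_mult mult_ac)
    also have "\<dots> \<le> \<bar>poly (S m) x * poly (P l) x\<bar> * B / \<delta>"
      using B x z[OF x] \<delta> by (intro frac_le mult_left_mono) auto
    finally show "cmod (?F x) \<le> B / \<delta> * \<bar>poly (S m) x * poly (P l) x\<bar>" by (simp add: mult_ac)
  qed (intro continuous_intros)
  also have "\<dots> = B / \<delta> * (LINT x:{-1..1}|M. \<bar>poly (S m) x * poly (P l) x\<bar>)"
    by (rule set_integral_mult_right)
  also have "\<dots> \<le> B / \<delta> * (l2_norm (S m) * l2_norm (P l))"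
    using B(2) \<delta> by (intro mult_left_mono set_integral_abs_mult_le) auto
  finally show ?thesis .
qed

text \<open>
  With \<open>m = n + k\<close>, the factors \<open>S\<^sub>m\<close> and \<open>P\<^sub>l\<close> contribute \<open>(\<bar>1 / \<phi>(z)\<bar> / s)\<^sup>m\<close> and
  \<open>(\<bar>1 / \<phi>(z)\<bar> / s)\<^sup>l\<close> with \<open>l = m - b\<close>. The growth of the cofactor \<open>w\<close> at infinity makes up for the
  \<open>N\<close> zeros of \<open>P\<^sub>m\<close> that have no counterpart in the interval, so the bound is uniform in \<open>z\<close>.
\<close>

lemma error_bound:
  assumes \<delta>: "\<delta> > 0" and s: "0 < s" "s < 1"
  obtains C b n0 where "C > 0"
    "\<And>n z. n \<ge> n0 \<Longrightarrow> (\<And>x. x \<in> {-1..1} \<union> c ` {1..N} \<Longrightarrow> cmod (z - of_real x) \<ge> \<delta>) \<Longrightarrow>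
       cmod (1 / phi z) \<le> s \<Longrightarrow>
       cpoly (S (n + k)) z \<noteq> 0 \<and> cmod (error k n z) \<le> C * (cmod (1 / phi z) / s) ^ (2 * (n + k) - b)"
proof -
  let ?Q = "Q_poly M N c d (k - 1)"
  define b where "b = D + degree ?Q"
  obtain B where B: "B > 0" "\<And>x. x \<in> {-1..1} \<Longrightarrow> \<bar>poly (?Q * rho_poly) x\<bar> \<le> B"
    using poly_bounded_on_interval[of "?Q * rho_poly"] by metis
  obtain C1 where C1: "C1 > 0"
    "\<And>n \<zeta>. \<zeta> \<noteq> 0 \<Longrightarrow> cmod \<zeta> \<le> s \<Longrightarrow>
      l2_norm (P n) * s ^ n \<le> C1 * (cmod \<zeta> ^ n * cmod (cpoly (P n) ((\<zeta> + 1 / \<zeta>) / 2)))"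
    using P_joukowski_lower_bound[OF s] by metis
  obtain C2 n2 where C2: "C2 > 0" "\<And>n. n \<ge> n2 \<Longrightarrow> l2_norm (S n) \<le> C2 * l2_norm (P n)"
    using S_norm_le by metis
  obtain \<kappa> n3 where \<kappa>: "\<kappa> > 0"
    "\<And>n Z w z. n \<ge> n3 \<Longrightarrow> S_splits n Z w \<Longrightarrow>
      (\<And>j. j \<in> {1..N} \<Longrightarrow> cmod (z - of_real (c j)) \<ge> \<delta>) \<Longrightarrow> cmod (cpoly w z) \<ge> \<kappa> * (1 + cmod z) ^ N"
    using cofactor_lower_bound[OF \<delta>] by metis
  define E where "E = exp (4 * real D / \<delta>)"
  have E: "E > 0" by (simp add: E_def)
  define C where "C = B / \<delta> * C2 * (E / \<kappa>) * C1 * C1"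
  have C: "C > 0" using B C2 E \<kappa> C1 \<delta> by (simp add: C_def)
  have main: "cpoly (S (n + k)) z \<noteq> 0 \<and> cmod (error k n z) \<le>
    C * (cmod (1 / phi z) / s) ^ (2 * (n + k) - b)"
    if n: "n \<ge> n2 + n3 + b" and z: "\<And>x. x \<in> {-1..1} \<union> c ` {1..N} \<Longrightarrow> cmod (z - of_real x) \<ge> \<delta>"
      and zs: "cmod (1 / phi z) \<le> s" for n z
  proof -
    define m where "m = n + k"
    define l where "l = m - b"
    define t where "t = cmod (1 / phi z)"
    have t: "t > 0" by (simp add: t_def norm_divide)
    have ml: "m \<ge> b" "l + degree ?Q + D \<le> m" "2 * m - b = m + l" "m \<ge> n2" "m \<ge> n3"
      using n by (auto simp: m_def l_def b_def)
    have zi: "z \<notin> of_real ` {-1..1}" using \<delta> z by (intro dist_pos_imp_off_interval) auto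
    have P: "l2_norm (P i) * s ^ i \<le> C1 * (t ^ i * cmod (cpoly (P i) z))" for i
    proof -
      have "(1 / phi z + 1 / (1 / phi z)) / 2 = z" using phi_joukowski[of z]
        by (simp add: add.commute)
      then show ?thesis using C1(2)[of "1 / phi z" i] zs unfolding t_def by simp
    qed
    have Ppos: "cmod (cpoly (P i) z) > 0" for i
    proof -
      have "0 < l2_norm (P i) * s ^ i" using l2_norm_pos[OF P_nonzero[of i]] s by simp
      also note P[of i]
      finally show ?thesis using C1(1) t by (auto simp: zero_less_mult_iff)
    qed
    have Pratio: "l2_norm (P i) / cmod (cpoly (P i) z) \<le> C1 * (t / s) ^ i" for i
      using P[of i] Ppos[of i] s by (simp add: power_divide field_simps)
    obtain Z w where split: "S_splits m Z w" using S_splits_exists by blast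
    have "cmod (cpoly (P m) z) \<le> E * (1 + cmod z) ^ N * cmod (cpoly (root_poly Z) z)"
      unfolding E_def using z by (intro P_le_root_poly_factor[OF split \<delta>]) auto
    then have "\<kappa> * cmod (cpoly (P m) z) \<le> \<kappa> * (E * (1 + cmod z) ^ N * cmod (cpoly (root_poly Z) z))"
      using \<kappa>(1) by (intro mult_left_mono) auto
    also have "\<dots> = E * cmod (cpoly (root_poly Z) z) * (\<kappa> * (1 + cmod z) ^ N)" by simp
    also have "\<dots> \<le> E * cmod (cpoly (root_poly Z) z) * cmod (cpoly w z)"
      using z E by (intro mult_left_mono \<kappa>(2)[OF ml(5) split]) auto
    also have "\<dots> = E * cmod (cpoly (S m) z)"
      using split by (simp add: S_splits_def cpoly_mult norm_mult)
    finally have SP: "\<kappa> / E * cmod (cpoly (P m) z) \<le> cmod (cpoly (S m) z)"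
      using E by (simp add: field_simps)
    have SPpos: "\<kappa> / E * cmod (cpoly (P m) z) > 0" using \<kappa>(1) E Ppos by simp
    then have Spos: "cmod (cpoly (S m) z) > 0" using SP by linarith
    then have S0: "cpoly (S m) z \<noteq> 0" by auto
    let ?I = "cmod (cauchy_transform (S m * (?Q * rho_poly)) z)"
    have "cmod (cpoly (P l) z) * ?I \<le> B / \<delta> * (l2_norm (S m) * l2_norm (P l))"
      using z by (intro second_kind_bound[OF \<delta> _ B(2,1) ml(2)]) auto
    also have "\<dots> \<le> B / \<delta> * (C2 * l2_norm (P m) * l2_norm (P l))"
      using C2(2)[OF ml(4)] B(1) \<delta> l2_norm_nonneg by (intro mult_left_mono mult_right_mono) auto
    finally have "?I * cmod (cpoly (P l) z) \<le> B / \<delta> * (C2 * l2_norm (P m) * l2_norm (P l))"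
      by (simp only: mult.commute)
    then have "?I \<le> B / \<delta> * (C2 * l2_norm (P m) * l2_norm (P l)) / cmod (cpoly (P l) z)"
      by (simp only: pos_le_divide_eq[OF Ppos])
    then have I: "?I \<le> B / \<delta> * C2 * l2_norm (P m) * (l2_norm (P l) / cmod (cpoly (P l) z))"
      by (simp only: times_divide_eq_right mult.assoc)
    have "cmod (error k n z) = ?I / cmod (cpoly (S m) z)"
      using error_eq[OF zi, of n k] S0 by (simp add: m_def norm_divide)
    also have "\<dots> \<le> (B / \<delta> * C2 * l2_norm (P m) * (l2_norm (P l) / cmod (cpoly (P l) z))) /
      (\<kappa> / E * cmod (cpoly (P m) z))"
      using SP SPpos I order.trans[OF norm_ge_zero I] by (intro frac_le) auto
    also have "\<dots> = B / \<delta> * C2 * (E / \<kappa>) * (l2_norm (P m) / cmod (cpoly (P m) z)) *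
      (l2_norm (P l) / cmod (cpoly (P l) z))"
      by (simp add: field_simps)
    also have "\<dots> \<le> B / \<delta> * C2 * (E / \<kappa>) * (C1 * (t / s) ^ m) * (C1 * (t / s) ^ l)"
      using B(1) \<delta> C2(1) E \<kappa>(1) C1(1) t s Pratio
      by (intro mult_mono mult_left_mono Pratio mult_nonneg_nonneg)
        (auto intro!: divide_nonneg_nonneg l2_norm_nonneg)
    also have "\<dots> = C * (t / s) ^ (2 * m - b)"
      unfolding ml(3) power_add C_def by simp
    finally show ?thesis using S0 unfolding t_def m_def by simp
  qed
  show ?thesis by (rule that[OF C main])
qed

end

section \<open>Suprema over compact subsets of the sphere\<close>

lemma ext_modulus_Some:
  assumes "eventually (\<lambda>w. f w = g w) (at z)" "isCont g z"
  shows "ext_modulus f (Some z) = ennreal (cmod (g z))"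
proof -
  have "((\<lambda>w. ennreal (cmod (g w))) \<longlongrightarrow> ennreal (cmod (g z))) (at z)"
    using assms(2) by (intro tendsto_ennrealI tendsto_norm) (simp add: isCont_def)
  moreover have "eventually (\<lambda>w. ennreal (cmod (g w)) = ennreal (cmod (f w))) (at z)"
    using assms(1) by eventually_elim simp
  ultimately have "((\<lambda>w. ennreal (cmod (f w))) \<longlongrightarrow> ennreal (cmod (g z))) (at z)"
    by (rule Lim_transform_eventually)
  then show ?thesis by (simp add: ext_modulus_def tendsto_Lim)
qed

lemma ext_modulus_None:
  assumes "(f \<longlongrightarrow> 0) at_infinity"
  shows "ext_modulus f None = 0"
proof -
  have "((\<lambda>w. ennreal (cmod (f w))) \<longlongrightarrow> ennreal 0) at_infinity"
    using assms by (intro tendsto_ennrealI tendsto_norm_zero)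
  then show ?thesis by (simp add: ext_modulus_def tendsto_Lim trivial_limit_at_infinity)
qed

lemma compactin_sphere_dist:
  assumes K: "compactin riemann_sphere K" and E: "compact E" and disj: "K \<inter> Some ` E = {}"
  obtains \<delta> where "\<delta> > 0" "\<And>z e. Some z \<in> K \<Longrightarrow> e \<in> E \<Longrightarrow> cmod (z - e) \<ge> \<delta>"
proof -
  let ?F = "{z. Some z \<in> K}"
  have "Hausdorff_space riemann_sphere"
    unfolding riemann_sphere_def Hausdorff_space_Alexandroff_compactification
    by (simp add: locally_compact_space_euclidean)
  then have "closedin riemann_sphere K" using K by (rule compactin_imp_closedin)
  then have "closed ?F"
    unfolding riemann_sphere_def closedin_Alexandroff_compactification
  proof (elim disjE exE conjE)
    fix K' assume "compactin euclidean K'" "K = Some ` K'"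
    moreover from this have "?F = K'" by auto
    ultimately show ?thesis by (simp add: compact_imp_closed)
  next
    fix U assume "openin euclidean U" "K =
      topspace (Alexandroff_compactification euclidean) - Some ` U"
    moreover from this have "?F = - U" by auto
    ultimately show ?thesis by (simp add: closed_Compl)
  qed
  moreover have "E \<inter> ?F = {}" using disj by auto
  ultimately obtain \<delta> where "\<delta> > 0" "\<forall>e\<in>E. \<forall>z\<in>?F. \<delta> \<le> dist e z"
    using separate_compact_closed[OF E] by blast
  then show ?thesis using that by (metis dist_commute dist_norm mem_Collect_eq)
qed

lemma ext_modulus_inverse_phi:
  assumes "z \<notin> of_real ` {-1..1}"
  shows "ext_modulus (\<lambda>z. 1 / phi z) (Some z) = ennreal (cmod (1 / phi z))"
  using assms by (intro ext_modulus_Some always_eventually allI refl)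
    (intro continuous_intros isCont_phi, auto)

lemma ennreal_powr_mono:
  assumes "x \<le> ennreal r" "r \<ge> 0" "a \<ge> 0"
  shows "ennreal_powr x a \<le> ennreal (r powr a)"
proof -
  have "x < \<infinity>" using assms(1) by (metis ennreal_less_top infinity_ennreal_def order.strict_trans1)
  moreover have "enn2real x \<le> r" using enn2real_mono[OF assms(1)] assms(2) by simp
  ultimately show ?thesis
    using assms(3) by (auto simp: ennreal_powr_def intro!: ennreal_leI powr_mono2)
qed

lemma geometric_root_limit:
  fixes C q :: real
  assumes C: "C > 0" and q: "q > 0"
  shows "(\<lambda>n. (C * q ^ (2 * (n + k) - b)) powr (1 / (2 * real n))) \<longlonglongrightarrow> q"
proof -
  have null: "(\<lambda>n. a / (2 * real n)) \<longlonglongrightarrow> 0" for a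
    using lim_const_over_n[of "a / 2"] by simp
  have "(\<lambda>n. C powr (1 / (2 * real n)) * q powr (1 + (2 * real k - real b) / (2 * real n))) \<longlonglongrightarrow>
      C powr 0 * q powr (1 + 0)"
    using C q by (intro tendsto_intros null) auto
  then have "(\<lambda>n. C powr (1 / (2 * real n)) * q powr (1 + (2 * real k - real b) / (2 * real n))) \<longlonglongrightarrow> q"
    using C q by simp
  moreover have "eventually (\<lambda>n. C powr (1 / (2 * real n)) *
    q powr (1 + (2 * real k - real b) / (2 * real n)) =
      (C * q ^ (2 * (n + k) - b)) powr (1 / (2 * real n))) sequentially"
    using eventually_ge_at_top[of "b + 1"]
  proof eventually_elim
    case (elim n)
    have "real (2 * (n + k) - b) = 2 * real n + (2 * real k - real b)" using elim
      by (simp add: of_nat_diff)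
    then have "real (2 * (n + k) - b) * (1 / (2 * real n)) = 1 + (2 * real k - real b) / (2 * real n)"
      using elim by (simp add: field_simps)
    moreover have "(C * q ^ (2 * (n + k) - b)) powr (1 / (2 * real n)) =
        C powr (1 / (2 * real n)) * q powr (real (2 * (n + k) - b) * (1 / (2 * real n)))"
      using C q by (simp only: powr_mult powr_powr powr_realpow[symmetric] less_imp_le)
    ultimately show ?case by simp
  qed
  ultimately show ?thesis by (rule Lim_transform_eventually)
qed

context nevai_sobolev
begin

text \<open>
  The bound of \<open>error_bound\<close> is increasing in \<open>\<bar>1 / \<phi>\<bar>\<close>, hence passes to the supremum over \<open>K\<close>; it also
  shows that the error vanishes at infinity.
\<close>

lemma limsup_error_le:
  assumes K: "\<And>z x. Some z \<in> K \<Longrightarrow> x \<in> {-1..1} \<union> c ` {1..N} \<Longrightarrow> cmod (z - of_real x) \<ge> \<delta>"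
    and \<delta>: "\<delta> > 0" and s: "1 / (1 + \<delta>) \<le> s" "s < 1"
    and A: "A > 0" "sup_norm K (\<lambda>z. 1 / phi z) \<le> ennreal A"
  shows "limsup (\<lambda>n. ennreal_powr (sup_norm K (error k n)) (1 / (2 * real n))) \<le> ennreal (A / s)"
proof -
  have "1 / (1 + \<delta>) > 0" using \<delta> by simp
  with s have s0: "s > 0" by linarith
  obtain C b n0 where C: "C > 0"
    and bound: "\<And>n z. n \<ge> n0 \<Longrightarrow> (\<And>x. x \<in> {-1..1} \<union> c ` {1..N} \<Longrightarrow> cmod (z - of_real x) \<ge> \<delta>) \<Longrightarrow>
       cmod (1 / phi z) \<le> s \<Longrightarrow>
       cpoly (S (n + k)) z \<noteq> 0 \<and> cmod (error k n z) \<le> C * (cmod (1 / phi z) / s) ^ (2 * (n + k) - b)"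
    using error_bound[OF \<delta> s0 s(2), of k] by metis
  have sup: "sup_norm K (error k n) \<le> ennreal (C * (A / s) ^ (2 * (n + k) - b))" 
    if n: "n \<ge> n0 + b + 1" for n
  proof -
    let ?L = "2 * (n + k) - b"
    have nn: "C * (A / s) ^ ?L \<ge> 0" using C A(1) s0 by simp
    have "ext_modulus (error k n) p \<le> ennreal (C * (A / s) ^ ?L)" if p: "p \<in> K" for p
    proof (cases p)
      case None
      have "(error k n \<longlongrightarrow> 0) at_infinity"
      proof (rule Lim_null_comparison)
        have "((\<lambda>z. C * (cmod (1 / phi z) / s) ^ ?L) \<longlongrightarrow> C * (0 / s) ^ ?L) at_infinity"
          using s0 by (intro tendsto_intros tendsto_norm_zero inverse_phi_at_infinity) auto
        moreover have "C * (0 / s) ^ ?L = 0" using n by (simp add: zero_power)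
        ultimately show "((\<lambda>z. C * (cmod (1 / phi z) / s) ^ ?L) \<longlongrightarrow> 0) at_infinity" by metis
        have "bounded ({-1..1} \<union> c ` {1..N})" by (auto intro: finite_imp_bounded)
        then obtain R where R: "\<And>x. x \<in> {-1..1} \<union> c ` {1..N} \<Longrightarrow> \<bar>x\<bar> \<le> R"
          unfolding bounded_iff real_norm_def by blast
        have "eventually (\<lambda>z::complex. cmod z \<ge> R + \<delta>) at_infinity"
          unfolding eventually_at_infinity by (rule exI[of _ "R + \<delta>"]) auto
        moreover have "eventually (\<lambda>z. cmod (1 / phi z) < s) at_infinity"
          using order_tendstoD(2)[OF tendsto_norm_zero[OF inverse_phi_at_infinity] s0] .
        ultimately show "eventually (\<lambda>z. norm (error k n z) \<le> C * (cmod (1 / phi z) / s) ^ ?L)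
          at_infinity"
        proof eventually_elim
          case (elim z)
          have "cmod (z - of_real x) \<ge> \<delta>" if "x \<in> {-1..1} \<union> c ` {1..N}" for x
            using norm_triangle_ineq2[of z "of_real x"] R[OF that] elim(1) by simp
          then show ?case using bound[of n z] n elim(2) by simp
        qed
      qed
      then show ?thesis using None by (simp add: ext_modulus_None)
    next
      case (Some z)
      have dist: "cmod (z - of_real x) \<ge> \<delta>" if "x \<in> {-1..1} \<union> c ` {1..N}" for x
        using K p Some that by blast
      have zi: "z \<notin> of_real ` {-1..1}" using \<delta> dist by (intro dist_pos_imp_off_interval) auto
      have "cmod (1 / phi z) \<le> 1 / (1 + \<delta>)" using \<delta> dist by (intro cmod_inverse_phi_le) auto
      then have "cmod (1 / phi z) \<le> s" using s(1) by linarith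
      then have S0: "cpoly (S (n + k)) z \<noteq> 0"
        and err: "cmod (error k n z) \<le> C * (cmod (1 / phi z) / s) ^ ?L"
        using bound[of n z] dist n by auto
      have "ennreal (cmod (1 / phi z)) \<le> sup_norm K (\<lambda>z. 1 / phi z)"
        unfolding sup_norm_def ext_modulus_inverse_phi[OF zi, symmetric] Some[symmetric]
        using p by (rule SUP_upper)
      then have "ennreal (cmod (1 / phi z)) \<le> ennreal A" using A(2) by (rule order.trans)
      then have tA: "cmod (1 / phi z) \<le> A" using A(1) by (simp add: ennreal_le_iff)
      let ?g = "\<lambda>z. cauchy_transform (S (n + k) * (Q_poly M N c d (k - 1) * rho_poly)) z /
        cpoly (S (n + k)) z"
      have cont: "isCont ?g z"
        using S0 zi by (intro continuous_intros isCont_cauchy_transform isCont_cpoly)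
      have "eventually (\<lambda>w. w \<in> - complex_of_real ` {-1..1}) (at z)"
        using zi closed_interval_complex by (intro eventually_at_in_open') auto
      moreover have "eventually (\<lambda>w. cpoly (S (n + k)) w \<noteq> 0) (at z)"
        using isCont_cpoly[where p = "S (n + k)" and z = z] S0 unfolding isCont_def
          by (rule tendsto_imp_eventually_ne)
      ultimately have "eventually (\<lambda>w. error k n w = ?g w) (at z)"
        by eventually_elim (simp add: error_eq)
      then have "ext_modulus (error k n) p = ennreal (cmod (?g z))"
        unfolding Some using cont by (rule ext_modulus_Some)
      also have "?g z = error k n z" using error_eq[OF zi S0] by simp
      also have "ennreal (cmod (error k n z)) \<le> ennreal (C * (A / s) ^ ?L)"
      proof (rule ennreal_leI, rule order.trans[OF err])
        show "C * (cmod (1 / phi z) / s) ^ ?L \<le> C * (A / s) ^ ?L"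
          using C s0 tA by (intro mult_left_mono power_mono divide_right_mono) auto
      qed
      finally show ?thesis .
    qed
    then show ?thesis unfolding sup_norm_def by (rule SUP_least)
  qed
  have "limsup (\<lambda>n. ennreal_powr (sup_norm K (error k n)) (1 / (2 * real n))) \<le>
      limsup (\<lambda>n. ennreal ((C * (A / s) ^ (2 * (n + k) - b)) powr (1 / (2 * real n))))"
  proof (rule Limsup_mono)
    show "eventually (\<lambda>n. ennreal_powr (sup_norm K (error k n)) (1 / (2 * real n)) \<le>
        ennreal ((C * (A / s) ^ (2 * (n + k) - b)) powr (1 / (2 * real n)))) sequentially"
      using eventually_ge_at_top[of "n0 + b + 1"]
      by eventually_elim (intro ennreal_powr_mono sup, use C A(1) s0 in auto)
  qed
  also have "\<dots> = ennreal (A / s)"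
    using geometric_root_limit[OF C, of "A / s" k b] A(1) s0
    by (intro lim_imp_Limsup tendsto_ennrealI) auto
  finally show ?thesis .
qed

end

theorem corollary2p1:
  fixes M :: "real measure" and N k :: nat
    and c eta :: "nat \<Rightarrow> real" and d :: "nat \<Rightarrow> nat"
    and K :: "complex option set"
  assumes "finite_borel_on_interval M"
    and "infinite (measure_supp M)"
    and "\<And>j. j \<in> {1..N} \<Longrightarrow> eta j > 0"
    and "\<And>j. j \<in> {1..N} \<Longrightarrow> c j \<notin> {-1..1}"
    and "sequentially_ordered N c d"
    and "nevai_class M"
    and "k \<ge> 1"
    and "K \<noteq> {}"
    and "compactin riemann_sphere K"
    and "K \<subseteq> Omega_star N c"
  shows "limsup (\<lambda>n. ennreal_powr
             (sup_norm K (\<lambda>z. mu_hat M N c d k z - R_approx M N c d eta k n z))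
             (1 / (2 * real n)))
           \<le> sup_norm K (\<lambda>z. 1 / phi z)
       \<and> sup_norm K (\<lambda>z. 1 / phi z) < 1"
proof -
  interpret nevai_sobolev M N c eta d
    using assms(1-6) by unfold_locales auto
  let ?E = "{-1..1} \<union> c ` {1..N}" and ?A = "sup_norm K (\<lambda>z. 1 / phi z)"
    and ?l = "limsup (\<lambda>n. ennreal_powr (sup_norm K (error k n)) (1 / (2 * real n)))"
  have "compact (complex_of_real ` ?E)"
    by (intro compact_continuous_image compact_Un compact_Icc finite_imp_compact continuous_intros)
      auto
  moreover have "K \<inter> Some ` complex_of_real ` ?E = {}"
    using assms(10) by (auto simp: Omega_star_def)
  ultimately obtain \<delta> where \<delta>: "\<delta> > 0"
    "\<And>z e. Some z \<in> K \<Longrightarrow> e \<in> complex_of_real ` ?E \<Longrightarrow> cmod (z - e) \<ge> \<delta>"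
    using compactin_sphere_dist[OF assms(9)] by metis
  have dist: "cmod (z - of_real x) \<ge> \<delta>" if "Some z \<in> K" "x \<in> ?E" for z x
    using \<delta>(2) that by blast
  have "?A \<le> ennreal (1 / (1 + \<delta>))"
    unfolding sup_norm_def
  proof (rule SUP_least)
    fix p assume p: "p \<in> K"
    show "ext_modulus (\<lambda>z. 1 / phi z) p \<le> ennreal (1 / (1 + \<delta>))"
    proof (cases p)
      case None
      then show ?thesis by (simp add: ext_modulus_None[OF inverse_phi_at_infinity])
    next
      case (Some z)
      have z: "\<And>x. x \<in> {-1..1} \<Longrightarrow> cmod (z - of_real x) \<ge> \<delta>" using dist p Some by blast
      have "ext_modulus (\<lambda>z. 1 / phi z) (Some z) = ennreal (cmod (1 / phi z))"
        using dist_pos_imp_off_interval[OF \<delta>(1) z] by (rule ext_modulus_inverse_phi)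
      also have "\<dots> \<le> ennreal (1 / (1 + \<delta>))"
        by (rule ennreal_leI, rule cmod_inverse_phi_le[OF \<delta>(1) z])
      finally show ?thesis unfolding Some .
    qed
  qed
  also have "ennreal (1 / (1 + \<delta>)) < 1" using \<delta>(1) by (simp add: ennreal_less_one_iff)
  finally have less1: "?A < 1" .
  then obtain A where A: "?A = ennreal A" "A \<ge> 0"
    by (cases ?A) auto
  have "?l \<le> ?A"
  proof (rule dense_ge)
    fix y assume y: "?A < y"
    show "?l \<le> y"
    proof (cases y)
      case (real B)
      \<comment> \<open>Any \<open>A' > A\<close> and any \<open>s < 1\<close> close to \<open>1\<close> give the bound \<open>A' / s\<close>; take \<open>A' / s \<le> B\<close>.\<close>
      have AB: "A < B" using y real A by (simp add: ennreal_less_iff)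
      define A' where "A' = (A + B) / 2"
      define s where "s = max (A' / B) (1 / (1 + \<delta>))"
      have A': "A' > 0" "A < A'" "A' < B" using AB A(2) by (auto simp: A'_def)
      have s: "1 / (1 + \<delta>) \<le> s" "s < 1" "A' / B \<le> s"
        using A' AB A(2) \<delta>(1) by (auto simp: s_def)
      have "?l \<le> ennreal (A' / s)"
        using dist \<delta>(1) s(1,2) A'(1)
        by (rule limsup_error_le) (use A A' in \<open>auto intro: ennreal_leI\<close>)
      also have "A' / s \<le> B"
      proof -
        have "B > 0" using AB A(2) by linarith
        moreover have "s > 0" using s(3) A'(1) \<open>B > 0\<close> divide_pos_pos[of A' B] by linarith
        ultimately show ?thesis using s(3) by (simp add: field_simps)
      qed
      then have "ennreal (A' / s) \<le> y" unfolding real by (rule ennreal_leI)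
      finally show ?thesis .
    qed simp
  qed
  then show ?thesis using less1 by simp
qed

end
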